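(* Let $P\subset\mathbb R^2$ be a simple polygon that admits a triangulation $\mathcal T_h(P)$ with no additional interior vertices (all edges of $\mathcal T_h(P)$ are formed solely by the vertices on $\partial P$). Then the degrees of freedom $\{\boldsymbol v_h\cdot\boldsymbol t_e:\ e\text{ an edge of }P\}$ are unisolvent on the space $$V_h(P)=\{\boldsymbol v_h\in\boldsymbol H(\mathrm{curl};P):\boldsymbol v_h|_K\in\mathcal{ND}_h(K)\ \forall K\in\mathcal T_h(P),\ \mathrm{curl}\,\boldsymbol v_h\in\mathbb P_0(P)\};$$ that is, for any prescribed real numbers $(c_e)_{e\subset\partial P}$ there is exactly one $\boldsymbol v_h\in V_h(P)$ with $\boldsymbol v_h\cdot\boldsymbol t_e=c_e$ on every edge $e\subset\partial P$.
   Context: $\mathrm{curl}\,\boldsymbol v=\partial_{x_1}v_2-\partial_{x_2}v_1$. $\mathcal{ND}_h(K)=\{\boldsymbol a+b(x_2,-x_1)^\intercal:\boldsymbol a\in\mathbb R^2,b\in\mathbb R\}$ is the lowest-order Nédélec space; tangential components of its functions are constant on any straight segment. $\mathbb P_0(P)$ denotes constants on $P$ (so the curl is the same constant on all triangles). $\boldsymbol t_e$ is a fixed unit tangent vector of the edge $e$. *)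

theory Defs
  imports "HOL-Analysis.Analysis"
begin

definition polygon_edge :: "(real^2) list \<Rightarrow> nat \<Rightarrow> (real^2) set" where
  "polygon_edge p i = closed_segment (p ! i) (p ! (Suc i mod length p))"

text \<open>A polygon is given by the cyclic list of its vertices. It is simple if any two distinct edges
  meet exactly in their common end points. Vertices with interior angle \<open>\<pi>\<close> are allowed.\<close>

definition simple_polygon :: "(real^2) list \<Rightarrow> bool" where
  "simple_polygon p \<longleftrightarrow>
     3 \<le> length p \<and> distinct p \<and>
     (\<forall>i<length p. \<forall>j<length p. i \<noteq> j \<longrightarrow>
        polygon_edge p i \<inter> polygon_edge p j =
          {p ! i, p ! (Suc i mod length p)} \<inter> {p ! j, p ! (Suc j mod length p)})"

definition polygon_boundary :: "(real^2) list \<Rightarrow> (real^2) set" where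
  "polygon_boundary p = (\<Union>i<length p. polygon_edge p i)"

definition polygon_region :: "(real^2) list \<Rightarrow> (real^2) set" where
  "polygon_region p = polygon_boundary p \<union> inside (polygon_boundary p)"

definition unit_tangent :: "(real^2) list \<Rightarrow> nat \<Rightarrow> real^2 \<Rightarrow> bool" where
  "unit_tangent p i t \<longleftrightarrow>
     norm t = 1 \<and> (\<exists>s. t = s *\<^sub>R (p ! (Suc i mod length p) - p ! i))"

text \<open>The library predicate \<open>triangulation\<close> contains finiteness and conformity: any two members
  meet in a common, possibly empty, face.\<close>

definition triangle_mesh :: "(real^2) set \<Rightarrow> (real^2) set set \<Rightarrow> bool" where
  "triangle_mesh P T \<longleftrightarrow> triangulation T \<and> (\<forall>K\<in>T. 2 simplex K) \<and> \<Union>T = P"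

definition mesh_vertices :: "(real^2) set set \<Rightarrow> (real^2) set" where
  "mesh_vertices T = (\<Union>K\<in>T. {x. x extreme_point_of K})"

definition partial_deriv :: "2 \<Rightarrow> (real^2 \<Rightarrow> real) \<Rightarrow> real^2 \<Rightarrow> real" where
  "partial_deriv i f x = frechet_derivative f (at x) (axis i 1)"

primrec C_k :: "nat \<Rightarrow> (real^2 \<Rightarrow> real) \<Rightarrow> bool" where
  "C_k 0 f \<longleftrightarrow> continuous_on UNIV f"
| "C_k (Suc k) f \<longleftrightarrow> f differentiable_on UNIV \<and> (\<forall>i. C_k k (partial_deriv i f))"

definition test_functions :: "(real^2) set \<Rightarrow> (real^2 \<Rightarrow> real) set" where
  "test_functions \<Omega> =
     {\<phi>. (\<forall>k. C_k k \<phi>) \<and> compact (closure {x. \<phi> x \<noteq> 0}) \<and> closure {x. \<phi> x \<noteq> 0} \<subseteq> \<Omega>}"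

definition square_integrable_on ::
    "(real^2 \<Rightarrow> 'b::euclidean_space) \<Rightarrow> (real^2) set \<Rightarrow> bool" where
  "square_integrable_on f \<Omega> \<longleftrightarrow>
     f \<in> borel_measurable (lebesgue_on \<Omega>) \<and> integrable (lebesgue_on \<Omega>) (\<lambda>x. (norm (f x))\<^sup>2)"

text \<open>\<open>w\<close> is the distributional curl \<open>\<partial>\<^sub>1 v\<^sub>2 - \<partial>\<^sub>2 v\<^sub>1\<close> of \<open>v\<close> on \<open>\<Omega>\<close>; both derivatives have been
  moved onto the test function, whence the signs.\<close>

definition has_weak_curl ::
    "(real^2) set \<Rightarrow> (real^2 \<Rightarrow> real^2) \<Rightarrow> (real^2 \<Rightarrow> real) \<Rightarrow> bool" where
  "has_weak_curl \<Omega> v w \<longleftrightarrow>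
     (\<forall>\<phi>\<in>test_functions \<Omega>.
        (LINT x|lebesgue_on \<Omega>. v x $ 1 * partial_deriv 2 \<phi> x - v x $ 2 * partial_deriv 1 \<phi> x) =
        (LINT x|lebesgue_on \<Omega>. w x * \<phi> x))"

text \<open>Members are representatives: a.e. equal functions stand for the same element.\<close>

definition H_curl :: "(real^2) set \<Rightarrow> (real^2 \<Rightarrow> real^2) set" where
  "H_curl \<Omega> = {v. square_integrable_on v \<Omega> \<and> (\<exists>w. square_integrable_on w \<Omega> \<and> has_weak_curl \<Omega> v w)}"

definition nedelec :: "(real^2 \<Rightarrow> real^2) set" where
  "nedelec = {q. \<exists>a b. q = (\<lambda>x. a + b *\<^sub>R vector [x $ 2, - (x $ 1)])}"

definition restricts_to :: "(real^2 \<Rightarrow> real^2) \<Rightarrow> (real^2) set \<Rightarrow> (real^2 \<Rightarrow> real^2) \<Rightarrow> bool" where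
  "restricts_to v K q \<longleftrightarrow> (AE x in lebesgue_on K. v x = q x)"

definition V_h :: "(real^2) set \<Rightarrow> (real^2) set set \<Rightarrow> (real^2 \<Rightarrow> real^2) set" where
  "V_h P T =
     {v \<in> H_curl (interior P).
        (\<forall>K\<in>T. \<exists>q\<in>nedelec. restricts_to v K q) \<and>
        (\<exists>k. has_weak_curl (interior P) v (\<lambda>x. k))}"

text \<open>The function \<open>v\<close> is only defined up to null sets, so its value on the edge \<open>e\<close> is that of the
  polynomial (unique, since \<open>K\<close> has positive measure) representing it on a triangle \<open>K\<close> that
  contains \<open>e\<close>. A boundary edge of the mesh lies in exactly one triangle.\<close>

definition tangential_value ::
    "(real^2) set set \<Rightarrow> (real^2 \<Rightarrow> real^2) \<Rightarrow> (real^2) set \<Rightarrow> real^2 \<Rightarrow> real \<Rightarrow> bool" where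
  "tangential_value T v e t c \<longleftrightarrow>
     (\<exists>K\<in>T. e \<subseteq> K \<and> (\<exists>q\<in>nedelec. restricts_to v K q \<and> (\<forall>x\<in>e. q x \<bullet> t = c)))"

end

(* On a mesh triangle K every v in V_h is a_K + (k/2) (-x2, x1), with one constant k for all triangles,
   and the weak curl condition forces the tangential components of the a_K to agree across interior
   edges.

   Existence: v = (k/2) (-x2, x1) + grad phi with phi the continuous piecewise affine interpolant of
   vertex values. All vertices lie on the boundary, so these are found by summing the prescribed edge
   values along the polygon; closing the cycle determines k because the shoelace sum is not zero. The
   latter is discrete Stokes: the sum of the boundaries of the positively oriented triangles is a cycle
   supported on the polygon, hence plus or minus the polygon itself.

   Uniqueness: for the difference of two solutions, the integrals of the tangential component along the
   edges form a cochain that vanishes on the boundary. Discrete Stokes gives k = 0, so the cochain is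
   closed. An interior edge is a chord and closes a part of the polygon to a Jordan curve. Summing over
   the triangles inside that curve leaves only the value on the chord, which is therefore zero. *)

theory Submission
  imports Defs
begin

section \<open>Oriented triangles\<close>

text \<open>The mesh is given only as a family of sets that meet in common faces, so incidences of
  edges and triangles have to be built. They are encoded by directed edges with the triangle on the
  left: conformity makes a directed edge determine its triangle, and interior edges are those that
  occur in both directions. That the edges without a neighbour are exactly the edges of the polygon
  is a topological fact; it rests on the Jordan curve theorem, by which every point of the polygon
  is a limit of outside points. After this, Stokes is pure cancellation, without line or area
  integrals. The other obstacle is that members of \<open>V_h\<close> are known only almost
  everywhere and that the curl is tested against smooth functions. Radial bumps localise the
  condition: one inside a triangle reads off its curl, one centred on an interior edge sees two half
  discs and reads off the tangential jump. For existence, the gradient part must have weak curl zero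
  although it jumps across edges; difference quotients take the place of Gauss's theorem on the
  triangles.\<close>

definition cross2 :: "real^2 \<Rightarrow> real^2 \<Rightarrow> real" where
  "cross2 a b = a$1 * b$2 - a$2 * b$1"

text \<open>Twice the signed area of the triangle \<open>a b c\<close>, positive for
  counterclockwise order. As a function of \<open>c\<close> it is affine, so its sign tells the two
  sides of the line through \<open>a\<close> and \<open>b\<close> apart.\<close>

definition orient :: "real^2 \<Rightarrow> real^2 \<Rightarrow> real^2 \<Rightarrow> real" where
  "orient a b c = cross2 (b - a) (c - a)"

lemma cross2_simps [simp]:
  "cross2 (a + b) c = cross2 a c + cross2 b c" "cross2 a (b + c) = cross2 a b + cross2 a c"
  "cross2 (a - b) c = cross2 a c - cross2 b c" "cross2 a (b - c) = cross2 a b - cross2 a c"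
  "cross2 (r *\<^sub>R a) b = r * cross2 a b" "cross2 a (r *\<^sub>R b) = r * cross2 a b"
  "cross2 a a = 0" "cross2 0 a = 0" "cross2 a 0 = 0"
  "cross2 (- a) b = - cross2 a b" "cross2 a (- b) = - cross2 a b"
  by (simp_all add: cross2_def algebra_simps)

lemma cross2_commute: "cross2 b a = - cross2 a b"
  by (simp add: cross2_def)

lemma orient_alt: "orient a b c = cross2 a b + cross2 b c + cross2 c a"
  unfolding orient_def by (simp add: cross2_def algebra_simps)

lemma orient_rotate: "orient b c a = orient a b c"
  by (simp add: orient_alt)

lemma orient_swap: "orient b a c = - orient a b c"
  by (simp add: orient_alt cross2_commute[of b a] cross2_commute[of c a] cross2_commute[of c b])

lemma orient_degenerate [simp]: "orient a a c = 0" "orient a b a = 0" "orient a b b = 0"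
  by (simp_all add: orient_def)

lemma orient_add_scaleR: "orient a b (x + s *\<^sub>R v) = orient a b x + s * cross2 (b - a) v"
  by (simp add: orient_def algebra_simps)

lemma orient_convex_comb:
  assumes "u + v = 1"
  shows "orient a b (u *\<^sub>R x + v *\<^sub>R y) = u * orient a b x + v * orient a b y"
proof -
  have "v = 1 - u" using assms by simp
  then show ?thesis
    by (simp add: orient_def cross2_def) (simp add: algebra_simps)
qed

lemma continuous_on_orient [continuous_intros]: "continuous_on S (\<lambda>x. orient a b x)"
  unfolding orient_def cross2_def by (intro continuous_intros)

lemma open_orient_pos: "open {x. orient a b x > 0}"
  by (intro open_Collect_less continuous_intros)

text \<open>Barycentric coordinates by Cramer's rule, with the common denominator multiplied
  out.\<close>

lemma barycentric:
  "orient a b c *\<^sub>R x = orient b c x *\<^sub>R a + orient c a x *\<^sub>R b + orient a b x *\<^sub>R c"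
  by (simp add: vec_eq_iff forall_2 orient_def cross2_def) (simp add: algebra_simps)

lemma orient_sum: "orient b c x + orient c a x + orient a b x = orient a b c"
  by (simp add: orient_def cross2_def algebra_simps)

lemma mem_triangle:
  assumes "orient a b c > 0"
  shows "x \<in> convex hull {a,b,c} \<longleftrightarrow> orient a b x \<ge> 0 \<and> orient b c x \<ge> 0 \<and> orient c a x \<ge> 0"
proof
  assume "x \<in> convex hull {a,b,c}"
  then obtain u v w where uvw: "u \<ge> 0" "v \<ge> 0" "w \<ge> 0" "u + v + w = 1"
    and x: "x = u *\<^sub>R a + v *\<^sub>R b + w *\<^sub>R c"
    by (auto simp: convex_hull_3)
  have u: "u = 1 - v - w" using uvw by simp
  have "orient a b x = w * orient a b c" "orient b c x = u * orient a b c"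
    "orient c a x = v * orient a b c"
    unfolding x u by (simp_all add: orient_def cross2_def) (simp_all add: algebra_simps)
  with uvw assms show "orient a b x \<ge> 0 \<and> orient b c x \<ge> 0 \<and> orient c a x \<ge> 0"
    by simp
next
  let ?D = "orient a b c"
  assume *: "orient a b x \<ge> 0 \<and> orient b c x \<ge> 0 \<and> orient c a x \<ge> 0"
  have "x = (1 / ?D) *\<^sub>R (?D *\<^sub>R x)" using assms by simp
  also have "\<dots> = (orient b c x / ?D) *\<^sub>R a + (orient c a x / ?D) *\<^sub>R b + (orient a b x / ?D) *\<^sub>R c"
    unfolding barycentric[of a b c x] by (simp add: scaleR_add_right divide_inverse mult.commute)
  finally have x: "x = \<dots>" .
  have "orient b c x / ?D + orient c a x / ?D + orient a b x / ?D = 1"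
    using orient_sum[of b c x a] assms by (simp add: add_divide_distrib [symmetric])
  with x * assms show "x \<in> convex hull {a,b,c}"
    unfolding convex_hull_3
    by (intro CollectI exI[of _ "orient b c x / ?D"] exI[of _ "orient c a x / ?D"] exI[of _ "orient a b x / ?D"]) auto
qed

lemma convex_hull_rotate: "convex hull {a,b,c} = convex hull {b,c,a}"
  by (simp add: insert_commute)

lemma interior_triangle_orient_pos:
  assumes "orient a b c > 0" "x \<in> interior (convex hull {a,b,c})"
  shows "orient a b x > 0"
proof (rule ccontr)
  assume neg: "\<not> orient a b x > 0"
  obtain e where e: "e > 0" "ball x e \<subseteq> convex hull {a,b,c}"
    using assms(2) by (meson mem_interior)
  \<comment> \<open>The direction \<open>a - c\<close> strictly decreases \<open>orient a b\<close>.
    The step is short enough to stay in the ball, and the \<open>+ 1\<close> keeps the denominator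
    positive.\<close>
  define s where "s = e / (2 * (norm (a - c) + 1))"
  have s: "s > 0" "s * norm (a - c) < e"
  proof -
    show "s > 0" using e by (simp add: s_def add_nonneg_pos)
    have "s * norm (a - c) < s * (2 * (norm (a - c) + 1))"
      by (rule mult_strict_left_mono[OF _ \<open>s > 0\<close>]) (smt (verit) norm_ge_zero)
    also have "\<dots> = e" using norm_ge_zero[of "a - c"] unfolding s_def
      by (simp add: field_simps add_nonneg_eq_0_iff)
    finally show "s * norm (a - c) < e" .
  qed
  then have "x + s *\<^sub>R (a - c) \<in> ball x e"
    by (simp add: dist_norm)
  with e have "x + s *\<^sub>R (a - c) \<in> convex hull {a,b,c}" by blast
  then have "orient a b (x + s *\<^sub>R (a - c)) \<ge> 0"
    using mem_triangle[OF assms(1)] by blast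
  moreover have "cross2 (b - a) (a - c) = - orient a b c"
    by (simp add: orient_def)
  ultimately have "orient a b x - s * orient a b c \<ge> 0"
    by (simp only: orient_add_scaleR)
  moreover have "s * orient a b c > 0" using s assms by simp
  ultimately show False using neg by linarith
qed

lemma interior_triangle:
  assumes "orient a b c > 0"
  shows "interior (convex hull {a,b,c}) = {x. orient a b x > 0 \<and> orient b c x > 0 \<and> orient c a x > 0}"
    (is "?I = ?R")
proof
  have r: "orient b c a > 0" "orient c a b > 0" using assms by (simp_all add: orient_alt)
  show "?I \<subseteq> ?R"
    using interior_triangle_orient_pos[OF assms] interior_triangle_orient_pos[OF r(1)]
      interior_triangle_orient_pos[OF r(2)] convex_hull_rotate by (metis (no_types, lifting) CollectI subsetI)
  have "open ?R"
    by (intro open_Collect_conj open_orient_pos)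
  moreover have "?R \<subseteq> convex hull {a,b,c}"
    by (intro subsetI) (simp add: mem_triangle[OF assms])
  ultimately show "?R \<subseteq> ?I" by (intro interior_maximal)
qed

lemma orient_nonzero_imp_distinct:
  assumes "orient a b c \<noteq> 0" shows "a \<noteq> b" "b \<noteq> c" "c \<noteq> a"
  using assms by auto

lemma collinear_iff_orient: "collinear {a,b,c} \<longleftrightarrow> orient a b c = 0"
proof (cases "a = b \<or> a = c")
  case True
  then show ?thesis by (auto simp: insert_commute)
next
  case False
  have "collinear {a,b,c} \<longleftrightarrow> collinear {0, b - a, c - a}"
    using collinear_3[of b a c] by (simp add: insert_commute[of a b])
  also have "\<dots> \<longleftrightarrow> (\<exists>k. c - a = k *\<^sub>R (b - a))"
    using False unfolding collinear_lemma by (metis right_minus_eq)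
  also have "\<dots> \<longleftrightarrow> orient a b c = 0"
  proof
    assume "\<exists>k. c - a = k *\<^sub>R (b - a)"
    then obtain k where "c - a = k *\<^sub>R (b - a)" by blast
    then show "orient a b c = 0" by (simp only: orient_def cross2_simps)
  next
    assume 0: "orient a b c = 0"
    let ?u = "b - a" and ?v = "c - a"
    have nz: "?u \<bullet> ?u \<noteq> 0" using False by auto
    \<comment> \<open>In the plane, a vector with vanishing \<open>cross2\<close> against
      \<open>u\<close> equals its own projection onto \<open>u\<close>.\<close>
    have *: "(u \<bullet> u) *\<^sub>R v = (u \<bullet> v) *\<^sub>R u" if "cross2 u v = 0" for u v
    proof -
      have "u$1 * v$2 = u$2 * v$1" using that by (simp add: cross2_def)
      then show ?thesis
        by (simp add: vec_eq_iff forall_2 sum_2 inner_vec_def algebra_simps power2_eq_square)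
    qed
    have "?v = (1 / (?u \<bullet> ?u)) *\<^sub>R ((?u \<bullet> ?u) *\<^sub>R ?v)" using nz by simp
    also have "\<dots> = ((?u \<bullet> ?v) / (?u \<bullet> ?u)) *\<^sub>R ?u"
      by (subst *) (use 0 in \<open>simp_all add: orient_def\<close>)
    finally show "\<exists>k. ?v = k *\<^sub>R ?u" by blast
  qed
  finally show ?thesis .
qed

lemma affine_dependent_iff_orient:
  assumes "card {a,b,c} = 3"
  shows "affine_dependent {a,b,c} \<longleftrightarrow> orient a b c = 0"
proof -
  have "a \<noteq> b" "a \<noteq> c" "b \<noteq> c" using assms by (auto simp: card_insert_if split: if_splits)
  then show ?thesis
    using collinear_3_eq_affine_dependent[of a b c] collinear_iff_orient[of a b c] by blast
qed

text \<open>Edges directed so that \<open>K\<close> lies to their left.\<close>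

definition oedges :: "(real^2) set \<Rightarrow> ((real^2) \<times> (real^2)) set" where
  "oedges K = {(x,y). \<exists>z. orient x y z > 0 \<and> K = convex hull {x,y,z}}"

lemma triangle_affine_independent:
  assumes "orient a b c > 0"
  shows "\<not> affine_dependent {a,b,c}" "card {a,b,c} = 3"
proof -
  show c: "card {a,b,c} = 3"
    using orient_nonzero_imp_distinct[of a b c] assms by auto
  show "\<not> affine_dependent {a,b,c}"
    using affine_dependent_iff_orient[OF c] assms by simp
qed

lemma extreme_points_triangle:
  assumes "orient a b c > 0"
  shows "x extreme_point_of (convex hull {a,b,c}) \<longleftrightarrow> x \<in> {a,b,c}"
  using extreme_point_of_convex_hull_affine_independent[OF triangle_affine_independent(1)[OF assms]] .

lemma two_simplex_oriented:
  assumes "2 simplex K"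
  obtains a b c where "orient a b c > 0" "K = convex hull {a,b,c}"
proof -
  obtain C where C: "\<not> affine_dependent C" "int (card C) = 2 + 1" "K = convex hull C"
    using assms unfolding simplex_def by auto
  then have c3: "card C = 3" by simp
  then obtain a b c where abc: "C = {a,b,c}" by (auto simp: card_3_iff)
  have "orient a b c \<noteq> 0"
    using affine_dependent_iff_orient[of a b c] c3 abc C by simp
  then consider "orient a b c > 0" | "orient b a c > 0"
    using orient_swap[of b a c] by fastforce
  then show ?thesis
  proof cases
    case 1 with that abc C show ?thesis by blast
  next
    case 2 with that[of b a c] abc C show ?thesis by (simp add: insert_commute)
  qed
qed

text \<open>The vertices are recovered as the extreme points of the triangle; of their six orderings
  the positive sign leaves the three cyclic ones.\<close>

lemma oedges_triangle:
  assumes "orient a b c > 0"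
  shows "oedges (convex hull {a,b,c}) = {(a,b),(b,c),(c,a)}"
proof
  have "orient b c a > 0" "orient c a b > 0"
    using assms by (simp_all add: orient_alt)
  moreover have "convex hull {a,b,c} = convex hull {b,c,a}" "convex hull {a,b,c} = convex hull {c,a,b}"
    by (simp_all add: insert_commute)
  ultimately show "{(a,b),(b,c),(c,a)} \<subseteq> oedges (convex hull {a,b,c})"
    using assms unfolding oedges_def by blast
  show "oedges (convex hull {a,b,c}) \<subseteq> {(a,b),(b,c),(c,a)}"
  proof (intro subrelI)
    fix x y assume "(x,y) \<in> oedges (convex hull {a,b,c})"
    then obtain z where z: "orient x y z > 0" "convex hull {a,b,c} = convex hull {x,y,z}"
      unfolding oedges_def by auto
    then have "{a,b,c} = {x,y,z}"
      using extreme_points_triangle[OF assms] extreme_points_triangle[OF z(1)] by (metis subsetI subset_antisym)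
    moreover have d: "x \<noteq> y" "y \<noteq> z" "z \<noteq> x" using orient_nonzero_imp_distinct[of x y z] z by auto
    ultimately have "(x,y,z) \<in> {(a,b,c),(b,c,a),(c,a,b),(b,a,c),(a,c,b),(c,b,a)}"
      by (simp add: set_eq_iff) metis
    moreover have "\<not> orient b a c > 0" "\<not> orient a c b > 0" "\<not> orient c b a > 0"
      using assms by (simp_all add: orient_def cross2_def algebra_simps)
    ultimately show "(x,y) \<in> {(a,b),(b,c),(c,a)}" using z(1) by auto
  qed
qed

lemma oedges_rotate:
  assumes "(x,y) \<in> oedges K"
  obtains z where "orient x y z > 0" "K = convex hull {x,y,z}" "oedges K = {(x,y),(y,z),(z,x)}"
  using assms oedges_triangle unfolding oedges_def by auto

lemma orient_open_segment:
  assumes "m \<in> open_segment x y" "orient x y z > 0"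
  shows "orient x y m = 0" "orient y z m > 0" "orient z x m > 0"
proof -
  obtain u where u: "0 < u" "u < 1" and m: "m = (1 - u) *\<^sub>R x + u *\<^sub>R y"
    using assms(1) by (auto simp: in_segment)
  have p: "orient y z x = orient x y z" "orient z x y = orient x y z"
    by (simp_all add: orient_alt)
  show "orient x y m = 0" "orient y z m > 0" "orient z x m > 0"
    unfolding m using u assms(2) by (simp_all add: orient_convex_comb p)
qed

text \<open>At an inner point of an edge the two other inequalities of the triangle are strict,
  hence hold in a whole disc; only the one belonging to the edge remains.\<close>

lemma half_disc:
  assumes "(x,y) \<in> oedges K" "m \<in> open_segment x y"
  obtains r where "r > 0" "\<And>w. w \<in> ball m r \<Longrightarrow> w \<in> K \<longleftrightarrow> orient x y w \<ge> 0"
    "\<And>w. w \<in> ball m r \<Longrightarrow> w \<in> interior K \<longleftrightarrow> orient x y w > 0"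
proof -
  obtain z where z: "orient x y z > 0" "K = convex hull {x,y,z}"
    using assms oedges_rotate by metis
  let ?U = "{w. orient y z w > 0} \<inter> {w. orient z x w > 0}"
  have "open ?U" "m \<in> ?U" using orient_open_segment[OF assms(2) z(1)]
    by (auto intro: open_orient_pos)
  then obtain r where "r > 0" "ball m r \<subseteq> ?U" by (meson open_contains_ball)
  then show ?thesis
    using that[of r] unfolding z(2) mem_triangle[OF z(1)] interior_triangle[OF z(1)]
    by (auto simp: subset_iff less_imp_le)
qed

lemma mem_triangle_cases:
  assumes "orient a b c > 0" "K = convex hull {a,b,c}" "x \<in> K"
  shows "x \<in> interior K \<or> x extreme_point_of K \<or> (\<exists>(u,v) \<in> oedges K. x \<in> open_segment u v)"
proof -
  have edge: "x \<in> {a,b} \<or> x \<in> open_segment a b" 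
    if o: "orient a b c > 0" "x \<in> convex hull {a,b,c}" "orient a b x = 0" for a b c
  proof -
    let ?D = "orient a b c"
    have nn: "orient b c x \<ge> 0" "orient c a x \<ge> 0" using mem_triangle[OF o(1)] o(2) by auto
    have "x = (1 / ?D) *\<^sub>R (?D *\<^sub>R x)" using o by simp
    also have "\<dots> = (orient b c x / ?D) *\<^sub>R a + (orient c a x / ?D) *\<^sub>R b"
      unfolding barycentric[of a b c x] using o(3) by (simp add: scaleR_add_right divide_inverse mult.commute)
    finally have x: "x = \<dots>" .
    have s: "orient b c x / ?D = 1 - orient c a x / ?D" 
      using orient_sum[of b c x a] o by (simp add: field_simps)
    have "x \<in> closed_segment a b"
      unfolding in_segment using nn o s x orient_sum[of b c x a]
      by (intro exI[of _ "orient c a x / ?D"]) auto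
    then show ?thesis by (auto simp: open_segment_def)
  qed
  consider "x \<in> interior K" | "orient a b x = 0" | "orient b c x = 0" | "orient c a x = 0"
    using assms mem_triangle[OF assms(1), of x] interior_triangle[OF assms(1)] by fastforce
  then show ?thesis
  proof cases
    case 2
    then show ?thesis using edge[OF assms(1)] assms oedges_triangle[OF assms(1)] extreme_points_triangle[OF assms(1)] by auto
  next
    case 3
    then show ?thesis using edge[of b c a] assms oedges_triangle[OF assms(1)] extreme_points_triangle[OF assms(1)]
      convex_hull_rotate[of a b c] orient_rotate[of b c a] by auto
  next
    case 4
    then show ?thesis using edge[of c a b] assms oedges_triangle[OF assms(1)] extreme_points_triangle[OF assms(1)]
      convex_hull_rotate[of c a b] orient_rotate[of a b c] by auto
  qed auto
qed

section \<open>Simple polygons as Jordan curves\<close>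

text \<open>One segment is appended at a time. The bound \<open>n\<close> is the index of the last
  segment, so the vertices run up to \<open>v (Suc n)\<close>.\<close>

lemma arc_of_segments:
  fixes v :: "nat \<Rightarrow> 'a::real_normed_vector"
  assumes "\<And>i. i \<le> n \<Longrightarrow> v i \<noteq> v (Suc i)"
    and "\<And>i j. i < j \<Longrightarrow> j \<le> n \<Longrightarrow>
      closed_segment (v i) (v (Suc i)) \<inter> closed_segment (v j) (v (Suc j)) \<subseteq> (if j = Suc i then {v j} else {})"
  shows "\<exists>g. arc g \<and> pathstart g = v 0 \<and> pathfinish g = v (Suc n) \<and>
    path_image g = (\<Union>i\<le>n. closed_segment (v i) (v (Suc i)))"
  using assms
proof (induction n)
  case 0
  then show ?case
    by (intro exI[of _ "linepath (v 0) (v (Suc 0))"]) (simp add: arc_linepath)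
next
  case (Suc n)
  have "\<exists>g. arc g \<and> pathstart g = v 0 \<and> pathfinish g = v (Suc n) \<and>
    path_image g = (\<Union>i\<le>n. closed_segment (v i) (v (Suc i)))"
    using Suc.prems by (intro Suc.IH) (meson le_SucI)+
  then obtain g where g: "arc g" "pathstart g = v 0" "pathfinish g = v (Suc n)"
    "path_image g = (\<Union>i\<le>n. closed_segment (v i) (v (Suc i)))" by blast
  let ?h = "linepath (v (Suc n)) (v (Suc (Suc n)))"
  have "closed_segment (v i) (v (Suc i)) \<inter> closed_segment (v (Suc n)) (v (Suc (Suc n))) \<subseteq> {v (Suc n)}"
    if "i \<le> n" for i
    using Suc.prems(2)[of i "Suc n"] that by (auto split: if_splits)
  then have "path_image g \<inter> path_image ?h \<subseteq> {pathstart ?h}"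
    unfolding g(4) by auto
  then have "arc (g +++ ?h)"
    using g Suc.prems(1)[of "Suc n"] by (intro arc_join) (auto simp: arc_linepath)
  moreover have "path_image (g +++ ?h) = (\<Union>i\<le>Suc n. closed_segment (v i) (v (Suc i)))"
    using g by (subst path_image_join) (auto simp: atMost_Suc)
  ultimately show ?case
    using g by (intro exI[of _ "g +++ ?h"]) simp
qed

lemma simple_polygon_path:
  assumes "simple_polygon p"
  obtains g where "simple_path g" "pathfinish g = pathstart g" "path_image g = polygon_boundary p"
proof -
  define N where "N = length p"
  have N: "N \<ge> 3" and dist: "distinct p"
    and edges: "\<And>i j. \<lbrakk>i < N; j < N; i \<noteq> j\<rbrakk> \<Longrightarrow> polygon_edge p i \<inter> polygon_edge p j =
          {p ! i, p ! (Suc i mod N)} \<inter> {p ! j, p ! (Suc j mod N)}"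
    using assms by (auto simp: simple_polygon_def N_def)
  have nth: "p ! i = p ! j \<longleftrightarrow> i = j" if "i < N" "j < N" for i j
    using that dist by (simp add: N_def nth_eq_iff_index_eq)
  have seg: "polygon_edge p i = closed_segment (p ! i) (p ! Suc i)" if "Suc i < N" for i
    using that by (simp add: polygon_edge_def N_def)
  \<comment> \<open>All edges but the closing one, that is, those with indices \<open>0\<close> to
    \<open>N - 2\<close>, form an arc; the closing edge then makes it a loop.\<close>
  have "\<exists>g. arc g \<and> pathstart g = p ! 0 \<and> pathfinish g = p ! Suc (N - 2) \<and>
    path_image g = (\<Union>i\<le>N - 2. closed_segment (p ! i) (p ! (Suc i)))"
  proof (rule arc_of_segments)
    show "p ! i \<noteq> p ! Suc i" if "i \<le> N - 2" for i
      using that N nth by simp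
    fix i j assume ij: "i < j" "j \<le> N - 2"
    then have "closed_segment (p ! i) (p ! Suc i) \<inter> closed_segment (p ! j) (p ! Suc j)
      = {p ! i, p ! Suc i} \<inter> {p ! j, p ! Suc j}"
      using edges[of i j] seg N by simp
    then show "closed_segment (p ! i) (p ! Suc i) \<inter> closed_segment (p ! j) (p ! Suc j)
      \<subseteq> (if j = Suc i then {p ! j} else {})"
      using ij N nth by auto
  qed
  moreover have N2: "Suc (N - 2) = N - 1" using N by simp
  ultimately obtain g where g: "arc g" "pathstart g = p ! 0" "pathfinish g = p ! (N - 1)"
    "path_image g = (\<Union>i\<le>N - 2. closed_segment (p ! i) (p ! (Suc i)))" by auto
  let ?h = "linepath (p ! (N - 1)) (p ! 0)"
  have last: "polygon_edge p (N - 1) = closed_segment (p ! (N - 1)) (p ! 0)"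
  proof -
    have "Suc (N - 1) mod N = 0" using N by simp
    then show ?thesis by (simp add: polygon_edge_def N_def)
  qed
  have gi: "path_image g = (\<Union>i<N - 1. polygon_edge p i)"
  proof -
    have "{..N - 2} = {..<N - 1}" using N by auto
    then show ?thesis unfolding g(4) by (intro SUP_cong) (simp_all add: seg)
  qed
  have "polygon_edge p i \<inter> closed_segment (p ! (N - 1)) (p ! 0) \<subseteq> {p ! 0, p ! (N - 1)}" if "i < N - 1" for i
  proof -
    have "Suc (N - 1) mod N = 0" using N by simp
    then show ?thesis using edges[of i "N - 1"] that N unfolding last by auto
  qed
  then have "path_image g \<inter> path_image ?h \<subseteq> {pathstart g, pathstart ?h}"
    unfolding gi using g by auto
  then have "simple_path (g +++ ?h)"
    using g nth[of "N - 1" 0] N by (intro simple_path_join_loop) (auto simp: arc_linepath)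
  moreover have "path_image (g +++ ?h) = polygon_boundary p"
  proof -
    have "{..<N} = insert (N - 1) {..<N - 1}" using N by auto
    then have "polygon_boundary p = path_image g \<union> polygon_edge p (N - 1)"
      unfolding polygon_boundary_def gi N_def[symmetric] by auto
    then show ?thesis using g last by (subst path_image_join) auto
  qed
  ultimately show ?thesis
    using g by (intro that[of "g +++ ?h"]) auto
qed

text \<open>Every component of the complement of a Jordan curve has the whole curve as frontier. It
  therefore suffices that \<open>inside B\<close> and \<open>outside B\<close> each contain a
  component; the inside is nonempty because the outside is connected while the curve separates the
  plane.\<close>

lemma simple_polygon_Jordan:
  assumes "simple_polygon p"
  defines "B \<equiv> polygon_boundary p"
  shows "compact B" "B \<subseteq> closure (inside B)" "B \<subseteq> closure (outside B)"
proof -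
  obtain g where g: "simple_path g" "pathfinish g = pathstart g" "path_image g = B"
    using simple_polygon_path[OF assms(1)] B_def by blast
  show cB: "compact B" using compact_simple_path_image[OF g(1)] g(3) by simp
  have "B homeomorphic sphere (0::complex) 1"
    using homeomorphic_simple_path_image_circle[OF g(1,2)] g(3) by simp
  moreover have "sphere (0::complex) 1 homeomorphic sphere (0::real^2) 1"
    by (rule homeomorphic_spheres_gen) auto
  ultimately have hom: "B homeomorphic sphere (0::real^2) 1"
    using homeomorphic_trans by blast
  have comp: "B \<subseteq> closure C" if "C \<in> components (- B)" for C
    using Jordan_Brouwer_frontier[OF hom that] by (auto simp: frontier_def)
  have conn: "connected (outside B)"
    using connected_outside[of B] cB by (simp add: compact_imp_bounded)
  have subset: "\<exists>C \<in> components (- B). C \<subseteq> S" if ne: "S \<noteq> {}" and S: "S = inside B \<or> S = outside B" for S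
  proof -
    obtain x where x: "x \<in> S" using ne by blast
    then have "x \<in> - B" using S by (auto simp: inside_def outside_def)
    then have "connected_component_set (- B) x \<in> components (- B)" by (simp add: componentsI)
    moreover have "connected_component_set (- B) x \<subseteq> S"
      using x S inside_same_component[of B x] outside_same_component[of B x] by auto
    ultimately show ?thesis by blast
  qed
  have "outside B \<noteq> {}"
    using cB outside_bounded_nonempty compact_imp_bounded by blast
  then show "B \<subseteq> closure (outside B)"
    using subset[of "outside B"] comp closure_mono by blast
  have "inside B \<noteq> {}"
  proof
    assume "inside B = {}"
    then have "- B = outside B" using inside_Un_outside[of B] by simp
    then show False using conn Jordan_Brouwer_separation[OF hom] by simp
  qed
  then show "B \<subseteq> closure (inside B)"
    using subset[of "inside B"] comp closure_mono by blast
qed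

section \<open>Edges of the mesh\<close>

lemma cross2_eq_0_imp_scaleR:
  assumes "u \<noteq> 0" "cross2 u v = 0"
  obtains k where "v = k *\<^sub>R u"
proof -
  have "orient 0 u v = 0" using assms by (simp add: orient_def)
  then have "collinear {0, u, v}" using collinear_iff_orient by blast
  then show ?thesis using that assms(1) unfolding collinear_lemma by (metis scaleR_zero_left)
qed

lemma orient_pos_near:
  assumes "x \<noteq> y" "orient x y m = 0" "r > 0"
  obtains w where "w \<in> ball m r" "orient x y w > 0"
proof -
  \<comment> \<open>The left normal of the segment, that is, \<open>y - x\<close> turned by a right
    angle.\<close>
  define v where "v = (vector [- ((y - x)$2), (y - x)$1] :: real^2)"
  have c: "cross2 (y - x) v = (y - x) \<bullet> (y - x)"
    by (simp add: v_def cross2_def inner_vec_def sum_2 algebra_simps)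
  have pos: "cross2 (y - x) v > 0" unfolding c using assms(1) by simp
  then have v: "norm v > 0" by auto
  have "m + (r / (2 * norm v)) *\<^sub>R v \<in> ball m r"
    using v assms(3) by (simp add: dist_norm)
  moreover have "orient x y (m + (r / (2 * norm v)) *\<^sub>R v) > 0"
    unfolding orient_add_scaleR using v pos assms by simp
  ultimately show ?thesis using that by blast
qed

lemma oedges_extreme:
  assumes "(x,y) \<in> oedges K"
  shows "x extreme_point_of K" "y extreme_point_of K" "x \<noteq> y"
  using oedges_rotate[OF assms] extreme_points_triangle orient_nonzero_imp_distinct
  by (metis insertCI less_irrefl)+

lemma oedges_subset:
  assumes "(x,y) \<in> oedges K"
  shows "closed_segment x y \<subseteq> K"
proof -
  obtain z where "K = convex hull {x,y,z}" using oedges_rotate[OF assms] by metis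
  then show ?thesis unfolding segment_convex_hull by (simp add: hull_mono)
qed

lemma extreme_pair_oedges:
  assumes "orient a b c > 0" "K = convex hull {a,b,c}"
    and "x extreme_point_of K" "y extreme_point_of K" "x \<noteq> y"
  shows "(x,y) \<in> oedges K \<or> (y,x) \<in> oedges K"
  using assms oedges_triangle[OF assms(1)] extreme_points_triangle[OF assms(1)] by auto

lemma oedge_mem_orient:
  assumes "(x,y) \<in> oedges K" "w \<in> K"
  shows "orient x y w \<ge> 0"
  using oedges_rotate[OF assms(1)] mem_triangle assms(2) by metis

text \<open>The half discs of the two triangles are complementary and fill a disc.\<close>

lemma opposite_triangles_interior:
  assumes "(x,y) \<in> oedges K" "(y,x) \<in> oedges K'"
  shows "open_segment x y \<subseteq> interior (K \<union> K')"
proof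
  fix m assume m: "m \<in> open_segment x y"
  then have m': "m \<in> open_segment y x" by (simp add: open_segment_commute)
  obtain r where r: "r > 0" "\<And>w. w \<in> ball m r \<Longrightarrow> w \<in> K \<longleftrightarrow> orient x y w \<ge> 0"
    using half_disc[OF assms(1) m] by metis
  obtain r' where r': "r' > 0" "\<And>w. w \<in> ball m r' \<Longrightarrow> w \<in> K' \<longleftrightarrow> orient y x w \<ge> 0"
    using half_disc[OF assms(2) m'] by metis
  have "ball m (min r r') \<subseteq> K \<union> K'"
  proof
    fix w assume w: "w \<in> ball m (min r r')"
    then show "w \<in> K \<union> K'"
      using r(2)[of w] r'(2)[of w] orient_swap[of y x w] by auto
  qed
  then show "m \<in> interior (K \<union> K')"
    using r(1) r'(1) by (meson mem_interior min_less_iff_conj)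
qed

lemma in_open_segment_offset:
  fixes x y :: "'a::real_vector"
  assumes "x \<noteq> y"
  shows "x + t *\<^sub>R (y - x) \<in> open_segment x y \<longleftrightarrow> 0 < t \<and> t < 1"
proof -
  have "x + t *\<^sub>R (y - x) = (1 - u) *\<^sub>R x + u *\<^sub>R y \<longleftrightarrow> u = t" for u
  proof -
    have "(1 - u) *\<^sub>R x + u *\<^sub>R y = x + u *\<^sub>R (y - x)" by (simp add: algebra_simps)
    then show ?thesis using assms by auto
  qed
  then show ?thesis using assms by (auto simp: in_segment)
qed

text \<open>In the coordinate \<open>k\<close> of \<open>x + k *\<^sub>R (y - x)\<close> the
  segments are the intervals with ends 0, 1 and \<open>s\<close>, \<open>t\<close>. Overlapping
  intervals neither of which has an end inside the other coincide.\<close>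

lemma collinear_segments_eq:
  assumes "m \<in> open_segment x y" "m \<in> open_segment a b"
    and "orient x y a = 0" "orient x y b = 0"
    and "a \<notin> open_segment x y" "b \<notin> open_segment x y" "x \<notin> open_segment a b" "y \<notin> open_segment a b"
  shows "{x,y} = {a,b}"
proof -
  have xy: "x \<noteq> y" and ab: "a \<noteq> b" using assms by (auto simp: open_segment_def)
  have o: "cross2 (y - x) (a - x) = 0" "cross2 (y - x) (b - x) = 0"
    using assms by (simp_all only: orient_def)
  obtain s where "a - x = s *\<^sub>R (y - x)"
    using cross2_eq_0_imp_scaleR[of "y - x" "a - x"] xy o by auto
  then have a: "a = x + s *\<^sub>R (y - x)" by (simp add: algebra_simps)
  obtain t where "b - x = t *\<^sub>R (y - x)"
    using cross2_eq_0_imp_scaleR[of "y - x" "b - x"] xy o by auto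
  then have b: "b = x + t *\<^sub>R (y - x)" by (simp add: algebra_simps)
  have st: "s \<noteq> t" using ab a b by auto
  have seg: "x + k *\<^sub>R (y - x) \<in> open_segment a b \<longleftrightarrow> (s < k \<and> k < t) \<or> (t < k \<and> k < s)" for k
  proof -
    have "((k - s) / (t - s)) *\<^sub>R (b - a) = (k - s) *\<^sub>R (y - x)"
      unfolding a b using st by (simp add: scaleR_diff_left[symmetric])
    then have "x + k *\<^sub>R (y - x) = a + ((k - s) / (t - s)) *\<^sub>R (b - a)"
      unfolding a by (simp add: algebra_simps)
    then have "x + k *\<^sub>R (y - x) \<in> open_segment a b \<longleftrightarrow> 0 < (k - s) / (t - s) \<and> (k - s) / (t - s) < 1"
      using in_open_segment_offset[OF ab] by metis
    also have "\<dots> \<longleftrightarrow> (s < k \<and> k < t) \<or> (t < k \<and> k < s)"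
      using st by (cases "s < t") (auto simp: zero_less_divide_iff divide_less_eq)
    finally show ?thesis .
  qed
  obtain k where k: "m = (1 - k) *\<^sub>R x + k *\<^sub>R y" "0 < k" "k < 1"
    using assms(1) by (auto simp: in_segment)
  have m: "m = x + k *\<^sub>R (y - x)" unfolding k by (simp add: algebra_simps)
  have 1: "\<not> (0 < s \<and> s < 1)" "\<not> (0 < t \<and> t < 1)"
    using assms(5,6) in_open_segment_offset[OF xy] a b by metis+
  have 2: "(s < k \<and> k < t) \<or> (t < k \<and> k < s)" using assms(2) m seg by metis
  have 3: "\<not> ((s < 0 \<and> 0 < t) \<or> (t < 0 \<and> 0 < s))" using assms(7) seg[of 0] by simp
  have 4: "\<not> ((s < 1 \<and> 1 < t) \<or> (t < 1 \<and> 1 < s))" using assms(8) seg[of 1] by simp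
  have "(s = 0 \<and> t = 1) \<or> (s = 1 \<and> t = 0)"
    using 1 2 3 4 k by linarith
  then show ?thesis using a b by auto
qed

section \<open>Conformity of the mesh, neighbours across edges and edges on the polygon\<close>

locale polygon_mesh =
  fixes p :: "(real^2) list" and T :: "(real^2) set set"
  assumes simple: "simple_polygon p"
    and mesh: "triangle_mesh (polygon_region p) T"
    and vertices: "mesh_vertices T = set p"
begin

abbreviation "P \<equiv> polygon_region p"
abbreviation "B \<equiv> polygon_boundary p"
abbreviation "N \<equiv> length p"
abbreviation "nxt i \<equiv> Suc i mod N"

lemma finite_T: "finite T" and Union_T: "\<Union>T = P"
  and face: "\<lbrakk>K \<in> T; K' \<in> T\<rbrakk> \<Longrightarrow> K \<inter> K' face_of K"
  using mesh by (auto simp: triangle_mesh_def triangulation_def)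

lemma face': "\<lbrakk>K \<in> T; K' \<in> T\<rbrakk> \<Longrightarrow> K \<inter> K' face_of K'"
  using face[of K' K] by (simp add: Int_commute)

lemma triangleE:
  assumes "K \<in> T"
  obtains a b c where "orient a b c > 0" "K = convex hull {a,b,c}"
  using two_simplex_oriented mesh assms unfolding triangle_mesh_def by metis

lemma compact_triangle: "K \<in> T \<Longrightarrow> compact K" and convex_triangle: "K \<in> T \<Longrightarrow> convex K"
  by (auto elim!: triangleE simp: compact_convex_hull)

lemma N_ge_3: "N \<ge> 3" and distinct_p: "distinct p"
  using simple by (auto simp: simple_polygon_def)

lemma nxt_less: "nxt i < N" 
  by (rule mod_less_divisor) (use N_ge_3 in linarith)

lemma nxt_neq: "i < N \<Longrightarrow> nxt i \<noteq> i"
  using N_ge_3 by (cases "Suc i < N") (auto simp: le_less_Suc_eq mod_Suc)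

lemma nth_eq: "\<lbrakk>i < N; j < N\<rbrakk> \<Longrightarrow> p ! i = p ! j \<longleftrightarrow> i = j"
  using distinct_p by (simp add: nth_eq_iff_index_eq)

lemma edge_Int:
  "\<lbrakk>i < N; j < N; i \<noteq> j\<rbrakk> \<Longrightarrow> polygon_edge p i \<inter> polygon_edge p j = {p ! i, p ! nxt i} \<inter> {p ! j, p ! nxt j}"
  using simple by (auto simp: simple_polygon_def)

lemma edge_ends_neq: "i < N \<Longrightarrow> p ! i \<noteq> p ! nxt i"
  using nth_eq nxt_less nxt_neq by metis

lemma vertex_on_edge:
  assumes "v \<in> set p" "i < N" "v \<in> polygon_edge p i"
  shows "v \<in> {p ! i, p ! nxt i}"
proof -
  obtain j where j: "j < N" "v = p ! j" using assms(1) by (metis in_set_conv_nth)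
  show ?thesis
  proof (cases "i = j")
    case False
    moreover have "v \<in> polygon_edge p j" using j by (simp add: polygon_edge_def)
    ultimately show ?thesis using edge_Int[OF assms(2) j(1)] assms(3) by blast
  qed (simp add: j)
qed

lemma compact_B: "compact B" and B_closure_outside: "B \<subseteq> closure (outside B)"
  using simple_polygon_Jordan[OF simple] by auto

lemma P_minus_interior: "P - interior P \<subseteq> B"
proof -
  have "open (inside B)" using compact_B open_inside compact_imp_closed by blast
  then have "inside B \<subseteq> interior P" by (intro interior_maximal) (auto simp: polygon_region_def)
  then show ?thesis by (auto simp: polygon_region_def)
qed

text \<open>An interior point of \<open>P\<close> on the curve would have outside points in its
  neighbourhood, and these do not belong to \<open>P\<close>.\<close>

lemma B_not_interior: "B \<inter> interior P = {}"
proof (rule ccontr)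
  assume "B \<inter> interior P \<noteq> {}"
  then obtain m where "m \<in> interior P" "m \<in> closure (outside B)" using B_closure_outside by blast
  then have "interior P \<inter> outside B \<noteq> {}"
    using open_Int_closure_eq_empty[of "interior P" "outside B"] by blast
  moreover have "P \<inter> outside B = {}"
    using inside_Int_outside[of B] outside_no_overlap[of B] unfolding polygon_region_def by blast
  ultimately show False using interior_subset by blast
qed

lemma edge_subset_B: "i < N \<Longrightarrow> polygon_edge p i \<subseteq> B" 
  by (auto simp: polygon_boundary_def)

lemma triangle_subset_P: "K \<in> T \<Longrightarrow> K \<subseteq> P" using Union_T by auto

lemma extreme_in_set: "\<lbrakk>K \<in> T; v extreme_point_of K\<rbrakk> \<Longrightarrow> v \<in> set p"
  using vertices by (auto simp: mesh_vertices_def)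

text \<open>The two inclusions of \<open>vertices\<close> have separate uses:
  \<open>extreme_in_set\<close> places all mesh vertices on the polygon, whereas here a polygon
  vertex is a vertex of some triangle and by conformity of every triangle containing it. Thus no
  vertex can lie inside a mesh edge.\<close>

lemma vertex_extreme:
  assumes "v \<in> set p" "K \<in> T" "v \<in> K"
  shows "v extreme_point_of K"
proof -
  obtain K' where K': "K' \<in> T" "v extreme_point_of K'"
    using assms(1) vertices by (auto simp: mesh_vertices_def)
  then have "v \<in> K'" by (simp add: extreme_point_of_def)
  then have "v extreme_point_of (K \<inter> K')"
    using extreme_point_of_face[OF face'[OF assms(2) K'(1)]] K'(2) assms(3) by blast
  then show ?thesis using extreme_point_of_face[OF face[OF assms(2) K'(1)]] by blast
qed

text \<open>A face that contains an interior point is the whole convex set. Applied to the common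
  face inside \<open>K\<close> this gives \<open>K \<subseteq> K'\<close>, which makes
  \<open>x\<close> interior to \<open>K'\<close> as well.\<close>

lemma interior_disjoint:
  assumes "K \<in> T" "K' \<in> T" "x \<in> interior K" "x \<in> K'"
  shows "K = K'"
proof -
  have "K \<inter> K' = K"
    using face_of_disjoint_interior[OF face[OF assms(1,2)]] assms interior_subset by blast
  then have "K \<subseteq> K'" by blast
  then have "x \<in> interior K'" using assms(3) interior_mono by blast
  then have "K \<inter> K' = K'"
    using face_of_disjoint_interior[OF face'[OF assms(1,2)]] assms interior_subset by blast
  with \<open>K \<inter> K' = K\<close> show ?thesis by simp
qed

lemma oedge_vertices:
  assumes "K \<in> T" "(x,y) \<in> oedges K"
  shows "x \<in> set p" "y \<in> set p" "x \<noteq> y"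
  using oedges_extreme[OF assms(2)] extreme_in_set[OF assms(1)] by auto

lemma no_vertex_in_edge:
  assumes "K \<in> T" "(x,y) \<in> oedges K" "v \<in> set p"
  shows "v \<notin> open_segment x y"
proof
  assume v: "v \<in> open_segment x y"
  then have "v \<in> K" using oedges_subset[OF assms(2)] open_closed_segment by blast
  then have "v extreme_point_of K" using vertex_extreme assms by blast
  moreover have "x \<in> K" "y \<in> K" using oedges_subset[OF assms(2)] by auto
  ultimately show False using v by (auto simp: extreme_point_of_def)
qed

text \<open>Both triangles lie to the left of the directed edge, so near its midpoint they fill the
  same half disc and their interiors overlap.\<close>

lemma oedge_unique:
  assumes "K \<in> T" "K' \<in> T" "(x,y) \<in> oedges K" "(x,y) \<in> oedges K'"
  shows "K = K'"
proof -
  have xy: "x \<noteq> y" using oedge_vertices[OF assms(1,3)] by simp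
  have m: "midpoint x y \<in> open_segment x y" using xy by simp
  obtain r where r: "r > 0" "\<And>w. w \<in> ball (midpoint x y) r \<Longrightarrow> w \<in> interior K \<longleftrightarrow> orient x y w > 0"
    using half_disc[OF assms(3) m] by metis
  obtain r' where r': "r' > 0" "\<And>w. w \<in> ball (midpoint x y) r' \<Longrightarrow> w \<in> K' \<longleftrightarrow> orient x y w \<ge> 0"
    using half_disc[OF assms(4) m] by metis
  obtain z where "orient x y z > 0" using assms(3) by (auto simp: oedges_def)
  then have "orient x y (midpoint x y) = 0" using orient_open_segment(1)[OF m] by blast
  then obtain w where "w \<in> ball (midpoint x y) (min r r')" "orient x y w > 0"
    using orient_pos_near[OF xy, of _ "min r r'"] r r' by (metis min_less_iff_conj)
  then have "w \<in> interior K" "w \<in> K'" using r r' by auto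
  then show ?thesis using interior_disjoint assms by blast
qed

text \<open>As \<open>T\<close> is finite and its members are closed, points of \<open>P\<close> to
  the right of the edge that tend to \<open>m\<close> put \<open>m\<close> into one triangle
  \<open>K'\<close> with points on that side. The common face contains an inner point of the edge,
  hence both ends; the edge belongs to \<open>K'\<close> and must be reversed there, since
  \<open>K'\<close> differs from \<open>K\<close>.\<close>

lemma neighbour_exists:
  assumes "K \<in> T" "(x,y) \<in> oedges K" "m \<in> open_segment x y"
    and "\<And>r. r > 0 \<Longrightarrow> \<exists>w \<in> P \<inter> ball m r. orient x y w < 0"
  shows "\<exists>K'\<in>T. (y,x) \<in> oedges K'"
proof -
  let ?S = "\<lambda>K'. K' \<inter> {w. orient x y w < 0}"
  have "m \<in> closure (\<Union>K'\<in>T. ?S K')"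
    unfolding closure_approachable
  proof (intro allI impI)
    fix r :: real assume "r > 0"
    then obtain w where "w \<in> P" "dist m w < r" "orient x y w < 0" using assms(4) by (meson IntE mem_ball)
    then show "\<exists>w\<in>(\<Union>K'\<in>T. ?S K'). dist w m < r"
      using Union_T by (auto simp: dist_commute)
  qed
  moreover have "closure (\<Union>K'\<in>T. ?S K') \<subseteq> (\<Union>K'\<in>T. closure (?S K'))"
  proof (rule closure_minimal)
    show "(\<Union>K'\<in>T. ?S K') \<subseteq> (\<Union>K'\<in>T. closure (?S K'))"
      by (rule UN_mono[OF order_refl closure_subset])
    show "closed (\<Union>K'\<in>T. closure (?S K'))"
      using finite_T by (intro closed_UN) auto
  qed
  ultimately obtain K' where K': "K' \<in> T" "m \<in> closure (?S K')" by blast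
  have "closure (?S K') \<subseteq> K'"
    using compact_triangle[OF K'(1)] by (intro closure_minimal) (auto intro: compact_imp_closed)
  then have mK': "m \<in> K'" using K' by blast
  obtain w where w: "w \<in> K'" "orient x y w < 0"
  proof -
    have "?S K' \<noteq> {}" using K'(2) by (metis closure_empty empty_iff)
    then show ?thesis using that by blast
  qed
  then have "w \<notin> K" using oedge_mem_orient[OF assms(2), of w] by linarith
  then have neq: "K' \<noteq> K" using w by blast
  have xyK: "x \<in> K" "y \<in> K" "m \<in> K"
    using oedges_subset[OF assms(2)] assms(3) open_closed_segment by blast+
  then have "x \<in> K'" "y \<in> K'"
    using face_ofD[OF face[OF assms(1) K'(1)] assms(3) xyK(1,2)] xyK(3) mK' by auto
  obtain a b c where abc: "orient a b c > 0" "K' = convex hull {a,b,c}" using triangleE[OF K'(1)] .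
  have "x extreme_point_of K'" "y extreme_point_of K'" "x \<noteq> y"
    using \<open>x \<in> K'\<close> \<open>y \<in> K'\<close> vertex_extreme[OF _ K'(1)] oedge_vertices[OF assms(1,2)] by simp_all
  then have "(x,y) \<in> oedges K' \<or> (y,x) \<in> oedges K'"
    using extreme_pair_oedges[OF abc] by blast
  then show ?thesis using oedge_unique[OF assms(1) K'(1) assms(2)] neq K'(1) by blast
qed

text \<open>All depends on the midpoint. If it is interior to \<open>P\<close>, there are points of
  \<open>P\<close> on the far side. Otherwise it lies on a polygon edge: a transversal one again
  leads to points of \<open>P\<close> on the far side, and a parallel one coincides with the mesh
  edge, because vertices lie only at the ends of either.\<close>

lemma oedge_cases:
  assumes "K \<in> T" "(x,y) \<in> oedges K"
  shows "(\<exists>K'\<in>T. (y,x) \<in> oedges K') \<or> (\<exists>i<N. {x,y} = {p ! i, p ! nxt i})"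
proof -
  have xy: "x \<noteq> y" and xp: "x \<in> set p" and yp: "y \<in> set p" using oedge_vertices[OF assms] by simp_all
  define m where "m = midpoint x y"
  have m: "m \<in> open_segment x y" using xy by (simp add: m_def)
  then have mK: "m \<in> K" using oedges_subset[OF assms(2)] open_closed_segment by blast
  obtain z where "orient x y z > 0" using assms(2) by (auto simp: oedges_def)
  then have m0: "orient x y m = 0" using orient_open_segment(1)[OF m] by blast
  show ?thesis
  proof (cases "m \<in> interior P")
    case True
    then obtain e where e: "e > 0" "ball m e \<subseteq> P" by (meson mem_interior)
    have "\<exists>w \<in> P \<inter> ball m r. orient x y w < 0" if "r > 0" for r
    proof -
      have "\<exists>w. w \<in> ball m (min r e) \<and> orient y x w > 0"
        using orient_pos_near[of y x m "min r e"] xy m0 \<open>r > 0\<close> \<open>e > 0\<close> orient_swap[of y x m]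
        by (metis min_less_iff_conj neg_equal_0_iff_equal)
      then obtain w where "w \<in> ball m (min r e)" "orient y x w > 0" by blast
      then show ?thesis using e orient_swap[of y x w] by (intro bexI[of _ w]) auto
    qed
    then show ?thesis using neighbour_exists[OF assms m] by blast
  next
    case False
    then have "m \<in> B" using P_minus_interior mK triangle_subset_P[OF assms(1)] by blast
    then obtain i where i: "i < N" "m \<in> polygon_edge p i" by (auto simp: polygon_boundary_def)
    define a b where "a = p ! i" and "b = p ! nxt i"
    have e: "polygon_edge p i = closed_segment a b" by (simp add: polygon_edge_def a_def b_def)
    have abp: "a \<in> set p" "b \<in> set p" using i nxt_less by (auto simp: a_def b_def)
    have ab: "a \<noteq> b" using edge_ends_neq[OF i(1)] by (simp add: a_def b_def)
    have "m \<notin> set p" using no_vertex_in_edge[OF assms] m by blast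
    then have mab: "m \<in> open_segment a b" using i abp e by (auto simp: open_segment_def)
    show ?thesis
    proof (cases "cross2 (y - x) (b - a) = 0")
      case False
      let ?c = "cross2 (y - x) (b - a)"
      obtain u where u: "0 < u" "u < 1" "m = (1 - u) *\<^sub>R a + u *\<^sub>R b"
        using mab by (auto simp: in_segment)
      have "\<exists>w \<in> P \<inter> ball m r. orient x y w < 0" if "r > 0" for r
      proof -
        \<comment> \<open>The bounds \<open>u\<close> and \<open>1 - u\<close> keep the displaced
          point on the polygon edge, the last one keeps it in the ball.\<close>
        define s where "s = min (min u (1 - u)) (r / (2 * norm (b - a)))"
        have s: "0 < s" "s \<le> u" "s \<le> 1 - u" "s \<le> r / (2 * norm (b - a))"
          using u that ab by (auto simp: s_def)
        then have sn: "s * norm (b - a) < r"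
          using ab that by (simp add: field_simps)
        \<comment> \<open>The direction along the polygon edge is chosen so that it leads to the
          right of the mesh edge.\<close>
        define q where "q = (if ?c > 0 then - s else s)"
        have q: "\<bar>q\<bar> = s" "q * ?c < 0" "0 \<le> u + q" "u + q \<le> 1"
          using s False by (auto simp: q_def mult_less_0_iff)
        have w: "m + q *\<^sub>R (b - a) = (1 - (u + q)) *\<^sub>R a + (u + q) *\<^sub>R b"
          unfolding u(3) by (simp add: algebra_simps)
        have "m + q *\<^sub>R (b - a) \<in> closed_segment a b" 
          unfolding w in_segment using q by blast
        then have "m + q *\<^sub>R (b - a) \<in> P" 
          using edge_subset_B[OF i(1)] e by (auto simp: polygon_region_def)
        moreover have "m + q *\<^sub>R (b - a) \<in> ball m r"
          using sn q(1) by (simp add: dist_norm)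
        moreover have "orient x y (m + q *\<^sub>R (b - a)) < 0"
          unfolding orient_add_scaleR using m0 q(2) by simp
        ultimately show ?thesis by blast
      qed
      then show ?thesis using neighbour_exists[OF assms m] by blast
    next
      case True
      obtain u where u: "0 < u" "u < 1" "m = (1 - u) *\<^sub>R a + u *\<^sub>R b"
        using mab by (auto simp: in_segment)
      have "a = m + (- u) *\<^sub>R (b - a)" "b = m + (1 - u) *\<^sub>R (b - a)"
        unfolding u(3) by (simp_all add: algebra_simps)
      then have "orient x y a = 0" "orient x y b = 0"
        using orient_add_scaleR[of x y m _ "b - a"] m0 True by (metis add_0 mult_zero_right)+
      moreover have "a \<notin> open_segment x y" "b \<notin> open_segment x y"
        using no_vertex_in_edge[OF assms] abp by blast+
      moreover have "x \<notin> open_segment a b" "y \<notin> open_segment a b"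
        using vertex_on_edge[OF xp i(1)] vertex_on_edge[OF yp i(1)] e 
        by (auto simp: a_def b_def open_segment_def)
      ultimately have "{x,y} = {a,b}" using collinear_segments_eq[OF m mab] by blast
      then show ?thesis using i(1) by (auto simp: a_def b_def)
    qed
  qed
qed

lemma opposite_interior_P:
  assumes "K \<in> T" "K' \<in> T" "(x,y) \<in> oedges K" "(y,x) \<in> oedges K'"
  shows "open_segment x y \<subseteq> interior P"
  using opposite_triangles_interior[OF assms(3,4)] triangle_subset_P assms(1,2)
    interior_mono[of "K \<union> K'" P] by blast

lemma boundary_edge_not_both:
  assumes "i < N" "K \<in> T" "K' \<in> T"
  shows "\<not> ((p ! i, p ! nxt i) \<in> oedges K \<and> (p ! nxt i, p ! i) \<in> oedges K')"
proof
  assume *: "(p ! i, p ! nxt i) \<in> oedges K \<and> (p ! nxt i, p ! i) \<in> oedges K'"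
  have "midpoint (p ! i) (p ! nxt i) \<in> open_segment (p ! i) (p ! nxt i)"
    using edge_ends_neq[OF assms(1)] by simp
  moreover have "midpoint (p ! i) (p ! nxt i) \<in> B"
    using edge_subset_B[OF assms(1)] by (auto simp: polygon_edge_def)
  ultimately show False
    using opposite_interior_P[OF assms(2,3)] * B_not_interior by blast
qed

text \<open>The midpoint \<open>m\<close> lies in some triangle, neither in its interior nor at a
  vertex, hence inside an edge of it. That edge has no neighbour, as otherwise \<open>m\<close>
  would be interior to \<open>P\<close>, so it is a polygon edge; two polygon edges share no point
  other than end points.\<close>

lemma boundary_edge_exists:
  assumes "i < N"
  shows "\<exists>K\<in>T. (p ! i, p ! nxt i) \<in> oedges K \<or> (p ! nxt i, p ! i) \<in> oedges K"
proof -
  define m where "m = midpoint (p ! i) (p ! nxt i)"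
  have m: "m \<in> open_segment (p ! i) (p ! nxt i)"
    using edge_ends_neq[OF assms] by (simp add: m_def)
  then have me: "m \<in> polygon_edge p i" by (simp add: polygon_edge_def open_closed_segment)
  then have mB: "m \<in> B" using edge_subset_B[OF assms] by blast
  then have notint: "m \<notin> interior P" using B_not_interior by blast
  obtain K where K: "K \<in> T" "m \<in> K" using mB Union_T by (auto simp: polygon_region_def)
  have mend: "m \<notin> {p ! i, p ! nxt i}" using m by (auto simp: open_segment_def)
  then have "m \<notin> set p" using vertex_on_edge[OF _ assms me] by blast
  then have "\<not> m extreme_point_of K" using extreme_in_set[OF K(1)] by blast
  moreover have "m \<notin> interior K" using notint interior_mono[OF triangle_subset_P[OF K(1)]] by blast
  ultimately obtain u v where uv: "(u,v) \<in> oedges K" "m \<in> open_segment u v"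
    using mem_triangle_cases triangleE[OF K(1)] K(2) by (metis (no_types, lifting) case_prodE)
  have "\<not> (\<exists>K'\<in>T. (v,u) \<in> oedges K')"
    using opposite_interior_P[OF K(1) _ uv(1)] uv(2) notint by blast
  then obtain j where j: "j < N" "{u,v} = {p ! j, p ! nxt j}"
    using oedge_cases[OF K(1) uv(1)] by blast
  have "m \<in> polygon_edge p j"
    using uv(2) j(2) open_closed_segment[OF uv(2)]
    by (auto simp: polygon_edge_def doubleton_eq_iff closed_segment_commute)
  then have "j = i" using edge_Int[OF assms j(1)] me mend by blast
  then show ?thesis using j uv(1) K(1) by (auto simp: doubleton_eq_iff)
qed

end

section \<open>Discrete Stokes theorem\<close>

lemma sum_antisym_eq_diff_converse:
  fixes g :: "'a \<Rightarrow> 'a \<Rightarrow> real"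
  assumes "finite S" "\<And>x y. g y x = - g x y"
  shows "(\<Sum>(x,y)\<in>S. g x y) = (\<Sum>(x,y)\<in>S - S\<inverse>. g x y)"
proof -
  let ?I = "S \<inter> S\<inverse>"
  have "(\<Sum>(x,y)\<in>?I. g x y) = (\<Sum>(x,y)\<in>?I. g y x)"
    by (rule sum.reindex_bij_witness[of _ prod.swap prod.swap]) auto
  also have "\<dots> = (\<Sum>(x,y)\<in>?I. - g x y)"
    by (intro sum.cong refl) (clarsimp, rule assms(2))
  also have "\<dots> = - (\<Sum>(x,y)\<in>?I. g x y)"
    by (simp add: sum_negf[symmetric] case_prod_unfold)
  finally have "(\<Sum>(x,y)\<in>?I. g x y) = 0" by simp
  moreover have "(\<Sum>(x,y)\<in>S. g x y) = (\<Sum>(x,y)\<in>S - ?I. g x y) + (\<Sum>(x,y)\<in>?I. g x y)"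
    by (rule sum.subset_diff) (use assms(1) in auto)
  moreover have "S - ?I = S - S\<inverse>" by blast
  ultimately show ?thesis by simp
qed

text \<open>The coboundary of the 1-cochain \<open>g\<close>, evaluated on the counterclockwise
  triangle.\<close>

definition circulation :: "(real^2 \<Rightarrow> real^2 \<Rightarrow> real) \<Rightarrow> (real^2) set \<Rightarrow> real" where
  "circulation g K = (\<Sum>(x,y)\<in>oedges K. g x y)"

lemma circulation_triangle:
  assumes "orient a b c > 0"
  shows "circulation g (convex hull {a,b,c}) = g a b + g b c + g c a"
  using orient_nonzero_imp_distinct[of a b c] assms
  by (simp add: circulation_def oedges_triangle)

context polygon_mesh
begin

lemma finite_oedges: "K \<in> T \<Longrightarrow> finite (oedges K)"
  by (elim triangleE) (simp add: oedges_triangle)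

text \<open>By \<open>oedge_unique\<close> a directed edge is counted for one triangle only. The
  edges present in both directions cancel, and \<open>E - E\<inverse>\<close> is the boundary of the
  chain \<open>S\<close>.\<close>

lemma sum_circulation:
  fixes g :: "real^2 \<Rightarrow> real^2 \<Rightarrow> real"
  assumes "S \<subseteq> T" "\<And>x y. g y x = - g x y"
  defines "E \<equiv> (\<Union>K\<in>S. oedges K)"
  shows "(\<Sum>K\<in>S. circulation g K) = (\<Sum>(x,y)\<in>E - E\<inverse>. g x y)"
proof -
  have fin: "finite S" using finite_T assms(1) finite_subset by blast
  have "(\<Sum>(x,y)\<in>E. g x y) = (\<Sum>K\<in>S. circulation g K)"
    unfolding E_def circulation_def
  proof (rule sum.UNION_disjoint)
    show "\<forall>K\<in>S. finite (oedges K)" using finite_oedges assms(1) by blast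
    show "\<forall>K\<in>S. \<forall>L\<in>S. K \<noteq> L \<longrightarrow> oedges K \<inter> oedges L = {}"
    proof (intro ballI impI)
      fix K L assume "K \<in> S" "L \<in> S" and neq: "K \<noteq> L"
      then have KL: "K \<in> T" "L \<in> T" using assms(1) by auto
      have "(x,y) \<notin> oedges L" if "(x,y) \<in> oedges K" for x y
        using oedge_unique[OF KL that] neq by auto
      then show "oedges K \<inter> oedges L = {}" by auto
    qed
  qed (fact fin)
  moreover have finE: "finite E"
    unfolding E_def using assms(1) by (intro finite_UN_I fin finite_oedges) auto
  ultimately show ?thesis using sum_antisym_eq_diff_converse[of E g, OF finE assms(2)] by simp
qed

text \<open>The value 1 means that some triangle lies to the left of the edge as listed. The list
  \<open>p\<close> may run either way round; that all signs agree is derived below.\<close>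

definition edge_sign :: "nat \<Rightarrow> real" where
  "edge_sign i = (if (p ! i, p ! nxt i) \<in> (\<Union>K\<in>T. oedges K) then 1 else - 1)"

lemma boundary_edge_inj:
  assumes "i < N" "j < N" "{p ! i, p ! nxt i} = {p ! j, p ! nxt j}"
  shows "i = j"
proof (rule ccontr)
  assume "i \<noteq> j"
  have "polygon_edge p i = polygon_edge p j"
    using assms(3) by (simp add: polygon_edge_def segment_convex_hull)
  then have "polygon_edge p i = {p ! i, p ! nxt i}"
    using edge_Int[OF assms(1,2) \<open>i \<noteq> j\<close>] assms(3) by simp
  then have "finite (closed_segment (p ! i) (p ! nxt i))" by (simp add: polygon_edge_def)
  then show False using edge_ends_neq[OF assms(1)] finite_closed_segment by blast
qed

text \<open>The directed edges without opposite are the polygon edges, each in exactly one of its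
  directions; \<open>e i\<close> is that direction.\<close>

lemma sum_circulation_boundary:
  assumes "\<And>x y. g y x = - g x y"
  shows "(\<Sum>K\<in>T. circulation g K) = (\<Sum>i<N. edge_sign i * g (p ! i) (p ! nxt i))"
proof -
  let ?E = "\<Union>K\<in>T. oedges K"
  define e where "e i = (if (p ! i, p ! nxt i) \<in> ?E then (p ! i, p ! nxt i) else (p ! nxt i, p ! i))" for i
  have inj: "inj_on e {..<N}"
  proof (rule inj_onI)
    fix i j assume ij: "i \<in> {..<N}" "j \<in> {..<N}" "e i = e j"
    then have "{p ! i, p ! nxt i} = {p ! j, p ! nxt j}"
      by (auto simp: e_def split: if_splits)
    then show "i = j" using boundary_edge_inj ij by blast
  qed
  have "?E - ?E\<inverse> = e ` {..<N}"
  proof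
    show "?E - ?E\<inverse> \<subseteq> e ` {..<N}"
    proof
      fix z assume z: "z \<in> ?E - ?E\<inverse>"
      then obtain x y K where xy: "z = (x,y)" "K \<in> T" "(x,y) \<in> oedges K" by (cases z) blast
      then have "\<not> (\<exists>K'\<in>T. (y,x) \<in> oedges K')" using z by blast
      then obtain i where i: "i < N" "{x,y} = {p ! i, p ! nxt i}"
        using oedge_cases[OF xy(2,3)] by blast
      then have "(x,y) = e i" using z xy by (auto simp: e_def doubleton_eq_iff)
      then show "z \<in> e ` {..<N}" using i xy by blast
    qed
    show "e ` {..<N} \<subseteq> ?E - ?E\<inverse>"
    proof
      fix z assume "z \<in> e ` {..<N}"
      then obtain i where i: "i < N" "z = e i" by blast
      have 1: "\<not> ((p ! i, p ! nxt i) \<in> ?E \<and> (p ! nxt i, p ! i) \<in> ?E)"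
        using boundary_edge_not_both[OF i(1)] by blast
      have 2: "(p ! i, p ! nxt i) \<in> ?E \<or> (p ! nxt i, p ! i) \<in> ?E"
        using boundary_edge_exists[OF i(1)] by blast
      show "z \<in> ?E - ?E\<inverse>"
        unfolding i(2) e_def using 1 2 by (simp only: Diff_iff converse_iff split: if_split) blast
    qed
  qed
  then have "(\<Sum>K\<in>T. circulation g K) = (\<Sum>(x,y)\<in>e ` {..<N}. g x y)"
    using sum_circulation[OF order_refl, of g, OF assms] by simp
  also have "\<dots> = (\<Sum>i<N. case e i of (x,y) \<Rightarrow> g x y)"
    using inj by (subst sum.reindex) auto
  also have "\<dots> = (\<Sum>i<N. edge_sign i * g (p ! i) (p ! nxt i))"
    using assms[of "p ! nxt i" "p ! i" for i]
    by (intro sum.cong) (simp_all add: e_def edge_sign_def)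
  finally show ?thesis .
qed

text \<open>The boundary of a boundary vanishes: the signs are constant along the polygon.\<close>

lemma edge_sign_nxt:
  assumes "i < N"
  shows "edge_sign (nxt i) = edge_sign i"
proof -
  let ?v = "p ! nxt i"
  \<comment> \<open>\<open>?g\<close> is the coboundary of the indicator of one vertex. Its
    circulations vanish, and among the polygon edges only the two at that vertex contribute.\<close>
  let ?f = "\<lambda>x. if x = ?v then 1 else 0 :: real"
  let ?g = "\<lambda>x y. ?f y - ?f x"
  have "circulation ?g K = 0" if "K \<in> T" for K
    by (rule triangleE[OF that]) (simp add: circulation_triangle)
  then have "0 = (\<Sum>j<N. edge_sign j * ?g (p ! j) (p ! nxt j))"
    using sum_circulation_boundary[of ?g] by simp
  also have "\<dots> = (\<Sum>j<N. edge_sign j * ?f (p ! nxt j)) - (\<Sum>j<N. edge_sign j * ?f (p ! j))"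
    by (simp only: right_diff_distrib sum_subtractf)
  also have "(\<Sum>j<N. edge_sign j * ?f (p ! j)) = (\<Sum>j<N. if j = nxt i then edge_sign j else 0)"
    using nth_eq nxt_less by (intro sum.cong) auto
  also have "\<dots> = edge_sign (nxt i)" using nxt_less[of i] by simp
  also have "(\<Sum>j<N. edge_sign j * ?f (p ! nxt j)) = (\<Sum>j<N. if j = i then edge_sign j else 0)"
  proof (intro sum.cong refl)
    fix j assume "j \<in> {..<N}"
    moreover from this have "nxt j = nxt i \<longleftrightarrow> j = i"
      using assms by (auto simp: mod_Suc split: if_splits)
    ultimately show "edge_sign j * ?f (p ! nxt j) = (if j = i then edge_sign j else 0)"
      using nth_eq[OF nxt_less nxt_less] by simp
  qed
  also have "\<dots> = edge_sign i" using assms by simp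
  finally show ?thesis by simp
qed

lemma discrete_Stokes:
  assumes "\<And>x y. g y x = - g x y"
  shows "(\<Sum>K\<in>T. circulation g K) = edge_sign 0 * (\<Sum>i<N. g (p ! i) (p ! nxt i))"
proof -
  have "i < N \<Longrightarrow> edge_sign i = edge_sign 0" for i
  proof (induction i)
    case (Suc i)
    then show ?case using edge_sign_nxt[of i] by simp
  qed simp
  then show ?thesis
    unfolding sum_circulation_boundary[of g, OF assms] by (simp add: sum_distrib_left)
qed

text \<open>The circulation of \<open>cross2\<close> around a triangle is twice its area; discrete
  Stokes turns the positive sum of areas into the shoelace sum up to sign.\<close>

lemma shoelace_nonzero: "(\<Sum>i<N. cross2 (p ! i) (p ! nxt i)) \<noteq> 0"
proof -
  have "circulation cross2 K > 0" if "K \<in> T" for K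
    using that by (elim triangleE) (simp add: circulation_triangle orient_alt)
  moreover have "T \<noteq> {}"
  proof -
    have "p ! 0 \<in> B" using edge_subset_B[of 0] N_ge_3
      by (metis polygon_edge_def ends_in_segment(1) subsetD less_le_trans zero_less_numeral)
    then show ?thesis using Union_T by (auto simp: polygon_region_def)
  qed
  ultimately have "(\<Sum>K\<in>T. circulation cross2 K) > 0"
    using finite_T by (intro sum_pos) auto
  then show ?thesis
    using discrete_Stokes[of cross2, OF cross2_commute] by auto
qed

text \<open>A common inner point forces, by the face property, both ends of the second edge into
  \<open>K\<close>. The second edge is then an edge of \<open>K\<close> too, and open edges of one
  triangle are disjoint.\<close>

lemma open_edges_disjoint:
  assumes "K \<in> T" "L \<in> T" "(x,y) \<in> oedges K" "(u,v) \<in> oedges L"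
    and "m \<in> open_segment x y" "m \<in> open_segment u v"
  shows "{x,y} = {u,v}"
proof (rule ccontr)
  assume neq: "{x,y} \<noteq> {u,v}"
  obtain z where z: "orient x y z > 0" "K = convex hull {x,y,z}"
    using oedges_rotate[OF assms(3)] by metis
  have uv: "u \<noteq> v" "u \<in> set p" "v \<in> set p" using oedge_vertices assms by blast+
  have m: "m \<in> K" "m \<in> L"
    using oedges_subset[OF assms(3)] oedges_subset[OF assms(4)] assms open_closed_segment by blast+
  have "u \<in> L" "v \<in> L" using oedges_subset[OF assms(4)] by auto
  then have "u \<in> K" "v \<in> K"
    using face'[OF assms(1,2)] assms(6) m unfolding face_of_def by blast+
  then have "u extreme_point_of K" "v extreme_point_of K" using vertex_extreme assms uv by blast+
  then have "u \<in> {x,y,z}" "v \<in> {x,y,z}"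
    using extreme_points_triangle[OF z(1)] z(2) by auto
  then have "{u,v} = {y,z} \<or> {u,v} = {z,x}" using uv(1) neq by auto
  then have "m \<in> open_segment y z \<or> m \<in> open_segment z x"
    using assms(6) by (auto simp: doubleton_eq_iff open_segment_commute)
  then have "orient y z m = 0 \<or> orient z x m = 0"
    using orient_open_segment(1)[of m y z x] orient_open_segment(1)[of m z x y] z(1)
      orient_rotate[of y z x] orient_rotate[of x y z] by auto
  then show False using orient_open_segment(2,3)[OF assms(5) z(1)] by auto
qed

end

section \<open>Chords and closed cochains\<close>

context polygon_mesh
begin

lemma interior_triangle_nonempty:
  assumes "K \<in> T" shows "interior K \<noteq> {}"
proof -
  obtain a b c where abc: "orient a b c > 0" "K = convex hull {a,b,c}" using triangleE[OF assms] .
  have "a \<noteq> b" using orient_nonzero_imp_distinct[of a b c] abc(1) by auto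
  then have m: "midpoint a b \<in> open_segment a b" by simp
  have e: "(a,b) \<in> oedges K" using oedges_triangle[OF abc(1)] abc(2) by simp
  obtain r where r: "r > 0" "\<And>w. w \<in> ball (midpoint a b) r \<Longrightarrow> w \<in> interior K \<longleftrightarrow> orient a b w > 0"
    using half_disc[OF e m] by metis
  obtain w where "w \<in> ball (midpoint a b) r" "orient a b w > 0"
    using orient_pos_near[OF \<open>a \<noteq> b\<close> orient_open_segment(1)[OF m abc(1)] r(1)] .
  then show ?thesis using r(2) by blast
qed

lemma edge_in_closure_interior:
  assumes "K \<in> T" "(x,y) \<in> oedges K" "m \<in> open_segment x y" "open U" "m \<in> U"
  shows "U \<inter> interior K \<noteq> {}"
proof -
  have xy: "x \<noteq> y" using oedge_vertices[OF assms(1,2)] by simp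
  obtain z where z: "orient x y z > 0" using assms(2) by (auto simp: oedges_def)
  obtain r where r: "r > 0" "\<And>w. w \<in> ball m r \<Longrightarrow> w \<in> interior K \<longleftrightarrow> orient x y w > 0"
    using half_disc[OF assms(2,3)] by metis
  obtain s where s: "s > 0" "ball m s \<subseteq> U" using assms(4,5) open_contains_ball by blast
  obtain w where "w \<in> ball m (min r s)" "orient x y w > 0"
    using orient_pos_near[OF xy orient_open_segment(1)[OF assms(3) z], of "min r s"] r(1) s(1) by auto
  then have "w \<in> interior K" "w \<in> U" using r(2)[of w] s(2) by auto
  then show ?thesis by blast
qed

text \<open>The point \<open>m\<close> need only be a limit of \<open>U\<close>: the lemma serves
  for the two sides of a Jordan curve that passes through \<open>m\<close>. Near \<open>m\<close>
  the plane is covered by the two triangles, and an open set cannot be contained in the line of the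
  edge.\<close>

lemma opposite_open_meets:
  assumes "K \<in> T" "K' \<in> T" "(x,y) \<in> oedges K" "(y,x) \<in> oedges K'"
    and "m \<in> open_segment x y" "open U" "m \<in> closure U"
  shows "U \<inter> interior K \<noteq> {} \<or> U \<inter> interior K' \<noteq> {}"
proof -
  have xy: "x \<noteq> y" using oedge_vertices[OF assms(1,3)] by simp
  have m': "m \<in> open_segment y x" using assms(5) by (simp add: open_segment_commute)
  obtain r where r: "r > 0" "\<And>w. w \<in> ball m r \<Longrightarrow> w \<in> interior K \<longleftrightarrow> orient x y w > 0"
    using half_disc[OF assms(3,5)] by metis
  obtain r' where r': "r' > 0" "\<And>w. w \<in> ball m r' \<Longrightarrow> w \<in> interior K' \<longleftrightarrow> orient y x w > 0"
    using half_disc[OF assms(4) m'] by metis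
  let ?V = "U \<inter> ball m (min r r')"
  have "m \<in> ball m (min r r')" using r(1) r'(1) by simp
  then have "?V \<noteq> {}"
    using assms(7) open_Int_closure_eq_empty[of "ball m (min r r')" U] by blast
  then obtain w where w: "w \<in> ?V" by blast
  obtain s where s: "s > 0" "ball w s \<subseteq> ?V" 
    using w assms(6) open_contains_ball[of ?V] by (meson open_Int open_ball)
  obtain w' where w': "w' \<in> ?V" "orient x y w' \<noteq> 0"
  proof (cases "orient x y w = 0")
    case True
    then obtain w' where "w' \<in> ball w s" "orient x y w' > 0"
      using orient_pos_near[OF xy True s(1)] by blast
    then show ?thesis using that[of w'] s(2) by (metis less_irrefl subsetD)
  qed (use w that in blast)
  then show ?thesis
    using r(2)[of w'] r'(2)[of w'] orient_swap[of y x w'] by force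
qed

text \<open>\<open>q\<close> is the part of the polygon from \<open>p ! i\<close> to
  \<open>p ! j\<close>, closed by the chord. No triangle has an edge in both directions, so the
  chord separates two triangles and its open segment is interior to \<open>P\<close>; it can meet
  the polygon only at its ends.\<close>

lemma chord_polygon_simple:
  assumes "i < j" "j < N" "K \<in> T" "K' \<in> T" "(p ! i, p ! j) \<in> oedges K \<union> oedges K'"
    and "(p ! j, p ! i) \<in> oedges K \<union> oedges K'"
  defines "q \<equiv> take (Suc j - i) (drop i p)"
  shows "simple_polygon q"
    and "polygon_boundary q \<subseteq> B \<union> closed_segment (p ! i) (p ! j)"
    and "closed_segment (p ! i) (p ! j) \<subseteq> polygon_boundary q"
proof -
  define n where "n = Suc j - i"
  have len: "length q = n" using assms(1,2) by (simp add: q_def n_def)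
  have qnth: "q ! k = p ! (i + k)" if "k < n" for k
    using that assms(1,2) by (simp add: q_def n_def)
  have opn: "open_segment (p ! i) (p ! j) \<subseteq> interior P"
  proof -
    have "\<not> ((p ! i, p ! j) \<in> oedges L \<and> (p ! j, p ! i) \<in> oedges L)" if "L \<in> T" for L
    proof (rule triangleE[OF that])
      fix a b c assume abc: "orient a b c > 0" "L = convex hull {a,b,c}"
      show ?thesis using orient_nonzero_imp_distinct[of a b c] abc oedges_triangle[OF abc(1)] by auto
    qed
    then show ?thesis using assms(3-6) opposite_interior_P[of K K' "p ! i" "p ! j"]
        opposite_interior_P[of K' K "p ! i" "p ! j"] by blast
  qed
  \<comment> \<open>The chord is no polygon edge, so \<open>i\<close> and \<open>j\<close> are not
    consecutive and \<open>q\<close> has at least three vertices.\<close>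
  have notb: "\<not> {p ! i, p ! j} = {p ! l, p ! nxt l}" if l: "l < N" for l
  proof
    assume eq: "{p ! i, p ! j} = {p ! l, p ! nxt l}"
    have "midpoint (p ! l) (p ! nxt l) \<in> open_segment (p ! l) (p ! nxt l)"
      using edge_ends_neq[OF l] by simp
    moreover have "open_segment (p ! l) (p ! nxt l) = open_segment (p ! i) (p ! j)"
      using eq by (metis open_segment_def segment_convex_hull)
    moreover have "midpoint (p ! l) (p ! nxt l) \<in> B"
      using edge_subset_B[OF l] by (auto simp: polygon_edge_def)
    ultimately show False using opn B_not_interior by blast
  qed
  have n3: "n \<ge> 3"
  proof (rule ccontr)
    assume "\<not> n \<ge> 3"
    then have "j = Suc i" using assms(1) by (simp add: n_def)
    then show False using notb[of i] assms(1,2) by simp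
  qed
  have edge: "polygon_edge q k = polygon_edge p (i + k)" if "Suc k < n" for k
    using that assms(1,2) qnth by (simp add: polygon_edge_def len n_def)
  have chord: "polygon_edge q (n - 1) = closed_segment (p ! i) (p ! j)"
  proof -
    have "Suc (n - 1) mod n = 0" using n3 by simp
    moreover have "i + (n - 1) = j" using assms(1) by (simp add: n_def)
    ultimately show ?thesis using n3 qnth[of "n - 1"] qnth[of 0]
      by (simp add: polygon_edge_def len closed_segment_commute)
  qed
  have chord_Int: "closed_segment (p ! i) (p ! j) \<inter> polygon_edge p l = {p ! i, p ! j} \<inter> {p ! l, p ! nxt l}"
    if l: "l < N" for l
  proof
    have ij: "p ! i \<in> set p" "p ! j \<in> set p" using assms(1,2) by auto
    show "closed_segment (p ! i) (p ! j) \<inter> polygon_edge p l \<subseteq> {p ! i, p ! j} \<inter> {p ! l, p ! nxt l}"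
    proof
      fix w assume w: "w \<in> closed_segment (p ! i) (p ! j) \<inter> polygon_edge p l"
      then have "w \<notin> interior P" using edge_subset_B[OF l] B_not_interior by blast
      then have "w \<in> {p ! i, p ! j}" using w opn by (auto simp: open_segment_def)
      moreover from this have "w \<in> {p ! l, p ! nxt l}" using vertex_on_edge[OF _ l, of w] w ij by auto
      ultimately show "w \<in> {p ! i, p ! j} \<inter> {p ! l, p ! nxt l}" by blast
    qed
  qed (auto simp: polygon_edge_def)
  have "distinct q" using distinct_p by (simp add: q_def)
  moreover have "polygon_edge q k \<inter> polygon_edge q l = {q ! k, q ! (Suc k mod n)} \<inter> {q ! l, q ! (Suc l mod n)}"
    if kl: "k < l" "l < n" for k l
  proof -
    have k: "Suc k < n" using kl by simp
    have ik: "i + k < N" "nxt (i + k) = Suc (i + k)" using k assms(1,2) by (simp_all add: n_def)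
    show ?thesis
    proof (cases "l = n - 1")
      case True
      have "Suc l mod n = 0" using n3 True by simp
      moreover have "i + (n - 1) = j" using assms(1) by (simp add: n_def)
      ultimately show ?thesis
        using True chord edge[OF k] chord_Int[OF ik(1)] qnth[of "n - 1"] qnth[of 0] qnth[of k] qnth[of "Suc k"] k n3 ik
        by (simp add: Int_commute insert_commute)
    next
      case False
      then have l: "Suc l < n" using kl by simp
      have il: "i + l < N" "nxt (i + l) = Suc (i + l)" using l assms(1,2) by (simp_all add: n_def)
      show ?thesis
        using edge[OF k] edge[OF l] edge_Int[OF ik(1) il(1)] kl ik il qnth[of k] qnth[of l] qnth[of "Suc k"] qnth[of "Suc l"] k l
        by simp
    qed
  qed
  then have "polygon_edge q k \<inter> polygon_edge q l = {q ! k, q ! (Suc k mod n)} \<inter> {q ! l, q ! (Suc l mod n)}"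
    if "k < n" "l < n" "k \<noteq> l" for k l
    using that by (metis Int_commute nat_neq_iff)
  ultimately show "simple_polygon q"
    unfolding simple_polygon_def len using n3 by blast
  show "polygon_boundary q \<subseteq> B \<union> closed_segment (p ! i) (p ! j)"
    unfolding polygon_boundary_def[of q] len
  proof (rule UN_least)
    fix k assume "k \<in> {..<n}"
    then consider "k = n - 1" | "Suc k < n" by fastforce
    then show "polygon_edge q k \<subseteq> B \<union> closed_segment (p ! i) (p ! j)"
    proof cases
      case 1
      then show ?thesis using chord by (metis Un_upper2)
    next
      case 2
      then have "i + k < N" using assms(1,2) by (simp add: n_def)
      then show ?thesis using edge[OF 2] edge_subset_B by blast
    qed
  qed
  show "closed_segment (p ! i) (p ! j) \<subseteq> polygon_boundary q"
    unfolding polygon_boundary_def len using chord n3 by (intro subsetI UN_I[of "n - 1"]) auto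
qed

lemma chord_value_zero:
  assumes g: "\<And>x y. g y x = - g x y"
    and cl: "\<And>K. K \<in> T \<Longrightarrow> circulation g K = 0"
    and bd: "\<And>i. i < N \<Longrightarrow> g (p ! i) (p ! nxt i) = 0"
    and ij: "i < j" "j < N" and KT: "K \<in> T" "K' \<in> T"
    and xy: "(x,y) \<in> oedges K" "(y,x) \<in> oedges K'" and eq: "{x,y} = {p ! i, p ! j}"
  shows "g x y = 0"
proof -
  define q where "q = take (Suc j - i) (drop i p)"
  define J where "J = polygon_boundary q"
  have "(p ! i, p ! j) \<in> oedges K \<union> oedges K'" "(p ! j, p ! i) \<in> oedges K \<union> oedges K'"
    using xy eq by (auto simp: doubleton_eq_iff)
  note chord = chord_polygon_simple[OF ij KT this, folded q_def J_def]
  have seg: "closed_segment (p ! i) (p ! j) = closed_segment x y"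
    using eq by (metis segment_convex_hull)
  have JB: "J \<subseteq> B \<union> closed_segment x y" and xyJ: "closed_segment x y \<subseteq> J"
    using chord seg by auto
  have Jordan: "compact J" "J \<subseteq> closure (inside J)" "J \<subseteq> closure (outside J)"
    using simple_polygon_Jordan[OF chord(1)] J_def by auto
  have opn: "open (inside J)" "open (outside J)"
    using Jordan(1) compact_imp_closed open_inside open_outside by auto
  have K0: "interior K \<inter> closed_segment x y = {}"
  proof -
    obtain z where z: "orient x y z > 0" "K = convex hull {x,y,z}" using oedges_rotate[OF xy(1)] by metis
    have "orient x y w = 0" if "w \<in> closed_segment x y" for w
      using that by (auto simp: in_segment orient_convex_comb)
    then show ?thesis using interior_triangle[OF z(1)] z(2) by fastforce
  qed
  have LJ: "interior L \<inter> J = {}" if L: "L \<in> T" for L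
  proof -
    have "interior L \<inter> closed_segment x y = {}"
    proof (cases "L = K")
      case False
      have "w \<notin> interior L" if "w \<in> closed_segment x y" for w
        using interior_disjoint[OF L KT(1), of w] oedges_subset[OF xy(1)] that False by blast
      then show ?thesis by blast
    qed (simp add: K0)
    moreover have "interior L \<inter> B = {}"
      using B_not_interior interior_mono[OF triangle_subset_P[OF L]] by blast
    ultimately show ?thesis using JB by blast
  qed
  have io: "inside J \<union> outside J = - J" "inside J \<inter> outside J = {}"
    by (simp_all add: inside_Un_outside inside_Int_outside)
  \<comment> \<open>The interior of a triangle is connected and misses \<open>J\<close>.\<close>
  have side: "interior L \<subseteq> inside J \<or> interior L \<subseteq> outside J" if L: "L \<in> T" for L
  proof -
    have "connected (interior L)" using convex_triangle[OF L] by (simp add: convex_connected)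
    moreover have "interior L \<subseteq> inside J \<union> outside J" using LJ[OF L] io by blast
    ultimately show ?thesis
      using connectedD[of "interior L" "inside J" "outside J"] opn io by blast
  qed
  have side_in: "interior L \<subseteq> inside J" if "L \<in> T" "inside J \<inter> interior L \<noteq> {}" for L
    using side[OF that(1)] that(2) io by blast
  have side_out: "\<not> interior L \<subseteq> inside J" if "L \<in> T" "outside J \<inter> interior L \<noteq> {}" for L
    using that(2) io by blast
  define S where "S = {L \<in> T. interior L \<subseteq> inside J}"
  have ST: "S \<subseteq> T" by (auto simp: S_def)
  \<comment> \<open>The midpoint of any interior edge other than the chord is off \<open>J\<close>,
    so one side of \<open>J\<close> is a neighbourhood of it and meets both adjacent
    triangles.\<close>
  have nb: "L \<in> S \<longleftrightarrow> L' \<in> S"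
    if L: "L \<in> T" "L' \<in> T" "(u,v) \<in> oedges L" "(v,u) \<in> oedges L'" "{u,v} \<noteq> {x,y}" for L L' u v
  proof -
    define m where "m = midpoint u v"
    have uv: "u \<noteq> v" using oedge_vertices[OF L(1,3)] by simp
    have m: "m \<in> open_segment u v" "m \<in> open_segment v u" using uv by (simp_all add: m_def open_segment_commute)
    have mP: "m \<in> interior P" using opposite_interior_P[OF L(1-4)] m by blast
    have "m \<notin> open_segment x y" using open_edges_disjoint[OF L(1) KT(1) L(3) xy(1) m(1)] L(5) by blast
    moreover have "m \<notin> {x,y}"
      using no_vertex_in_edge[OF L(1,3)] m(1) oedge_vertices[OF KT(1) xy(1)] by blast
    ultimately have "m \<notin> J" using JB mP B_not_interior by (auto simp: open_segment_def)
    then consider "m \<in> inside J" | "m \<in> outside J" using io by blast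
    then show ?thesis
    proof cases
      case 1
      then show ?thesis
        using edge_in_closure_interior[OF L(1,3) m(1) opn(1)] edge_in_closure_interior[OF L(2,4) m(2) opn(1)]
          side_in L by (simp add: S_def)
    next
      case 2
      then show ?thesis
        using edge_in_closure_interior[OF L(1,3) m(1) opn(2)] edge_in_closure_interior[OF L(2,4) m(2) opn(2)]
          side_out L by (simp add: S_def)
    qed
  qed
  \<comment> \<open>Across the chord the side changes: both sides of \<open>J\<close> accumulate at
    its midpoint, and near this point there are only \<open>K\<close> and \<open>K'\<close>.\<close>
  have one: "K \<in> S \<longleftrightarrow> K' \<notin> S"
  proof -
    have xyn: "x \<noteq> y" using oedge_vertices[OF KT(1) xy(1)] by simp
    have m: "midpoint x y \<in> open_segment x y" using xyn by simp
    then have "midpoint x y \<in> J" using xyJ by auto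
    then have cl: "midpoint x y \<in> closure (inside J)" "midpoint x y \<in> closure (outside J)" using Jordan by blast+
    show ?thesis
      using opposite_open_meets[OF KT xy m opn(1) cl(1)] opposite_open_meets[OF KT xy m opn(2) cl(2)]
        side_in[OF KT(1)] side_in[OF KT(2)] side_out[OF KT(1)] side_out[OF KT(2)] KT
      by (auto simp: S_def)
  qed
  define E where "E = (\<Union>L\<in>S. oedges L)"
  have E1: "(x,y) \<in> E \<longleftrightarrow> K \<in> S" "(y,x) \<in> E \<longleftrightarrow> K' \<in> S"
    using oedge_unique[OF KT(1) _ xy(1)] oedge_unique[OF KT(2) _ xy(2)] xy ST unfolding E_def by blast+
  \<comment> \<open>By \<open>nb\<close>, an uncancelled edge other than the chord has no neighbour
    in \<open>T\<close>, so it lies on the polygon, where \<open>g\<close> vanishes.\<close>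
  have "g u v = 0" if uv: "(u,v) \<in> E - E\<inverse>" "{u,v} \<noteq> {x,y}" for u v
  proof -
    obtain L where L: "L \<in> S" "(u,v) \<in> oedges L" using uv unfolding E_def by blast
    have LT: "L \<in> T" using L ST by blast
    have "\<not> (\<exists>L'\<in>T. (v,u) \<in> oedges L')"
    proof
      assume "\<exists>L'\<in>T. (v,u) \<in> oedges L'"
      then obtain L' where L': "L' \<in> T" "(v,u) \<in> oedges L'" by blast
      then have "L' \<in> S" using nb[OF LT L'(1) L(2) L'(2) uv(2)] L(1) by simp
      then show False using uv(1) L'(2) unfolding E_def by blast
    qed
    then obtain l where l: "l < N" "{u,v} = {p ! l, p ! nxt l}"
      using oedge_cases[OF LT L(2)] by blast
    then show "g u v = 0" using bd[OF l(1)] g[of "p ! l" "p ! nxt l"] by (auto simp: doubleton_eq_iff)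
  qed
  note zero = this
  have fin: "finite (E - E\<inverse>)"
    unfolding E_def using ST finite_T finite_subset[OF ST finite_T] finite_oedges
    by (intro finite_Diff finite_UN_I) auto
  have "0 = (\<Sum>L\<in>S. circulation g L)" using cl ST by (simp add: subset_iff)
  also have "\<dots> = (\<Sum>(u,v)\<in>E - E\<inverse>. g u v)"
    unfolding E_def by (rule sum_circulation[OF ST g])
  also have "\<dots> = (\<Sum>(u,v)\<in>(E - E\<inverse>) \<inter> {(x,y),(y,x)}. g u v)"
    using fin zero by (intro sum.mono_neutral_right) (auto simp: doubleton_eq_iff)
  also have "(E - E\<inverse>) \<inter> {(x,y),(y,x)} = (if K \<in> S then {(x,y)} else {(y,x)})"
    using E1 one by auto
  finally show ?thesis using g[of x y] by (simp split: if_splits)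
qed

text \<open>All vertices lie on the boundary, so a closed cochain that vanishes there is zero: every
  interior edge is a chord, and the polygon that it cuts off is a union of triangles.\<close>

lemma closed_cochain_zero:
  assumes g: "\<And>x y. g y x = - g x y"
    and "\<And>K. K \<in> T \<Longrightarrow> circulation g K = 0"
    and "\<And>i. i < N \<Longrightarrow> g (p ! i) (p ! nxt i) = 0"
    and "K \<in> T" "(x,y) \<in> oedges K"
  shows "g x y = 0"
proof -
  consider l where "l < N" "{x,y} = {p ! l, p ! nxt l}" | K' where "K' \<in> T" "(y,x) \<in> oedges K'"
    using oedge_cases[OF assms(4,5)] by blast
  then show ?thesis
  proof cases
    case 1
    then show ?thesis using assms(3)[OF 1(1)] g[of "p ! l" "p ! nxt l"] by (auto simp: doubleton_eq_iff)
  next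
    case 2
    note K' = 2
    obtain i j where ij: "i < N" "j < N" "x = p ! i" "y = p ! j"
      using oedge_vertices[OF assms(4,5)] by (auto simp: in_set_conv_nth)
    have "i \<noteq> j" using ij oedge_vertices[OF assms(4,5)] by auto
    then consider "i < j" | "j < i" by linarith
    then show ?thesis
    proof cases
      case 1
      show ?thesis 
        by (rule chord_value_zero[OF assms(1-3) 1 ij(2) assms(4) K'(1) assms(5) K'(2)]) (simp_all add: ij)
    next
      case 2
      show ?thesis 
        by (rule chord_value_zero[OF assms(1-3) 2 ij(1) assms(4) K'(1) assms(5) K'(2)]) (auto simp: ij)
    qed
  qed
qed

end

section \<open>Smooth bump functions\<close>

lemma C_k_SucD: "C_k (Suc k) f \<Longrightarrow> C_k k f"
proof (induction k arbitrary: f)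
  case 0
  then show ?case using differentiable_imp_continuous_on by auto
next
  case (Suc k)
  then show ?case by (meson C_k.simps(2))
qed

lemma partial_deriv_eq:
  assumes "(f has_derivative f') (at x)"
  shows "partial_deriv i f x = f' (axis i 1)"
  using frechet_derivative_at[OF assms] by (simp add: partial_deriv_def)

lemma differentiable_on_UNIV_has_derivative:
  assumes "f differentiable_on UNIV"
  shows "(f has_derivative frechet_derivative f (at x)) (at x)"
  using assms by (simp add: differentiable_on_def frechet_derivative_works)

lemma C_k_const: "C_k k (\<lambda>x. c)"
proof (induction k arbitrary: c)
  case (Suc k)
  have "partial_deriv i (\<lambda>x. c) = (\<lambda>x. 0)" for i
    by (intro ext) (simp add: partial_deriv_eq[OF has_derivative_const])
  then show ?case using Suc by simp
qed simp

lemma C_k_add: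
  assumes "C_k k f" "C_k k g"
  shows "C_k k (\<lambda>x. f x + g x)"
  using assms
proof (induction k arbitrary: f g)
  case (Suc k)
  then have d: "f differentiable_on UNIV" "g differentiable_on UNIV" by auto
  have "partial_deriv i (\<lambda>x. f x + g x) = (\<lambda>x. partial_deriv i f x + partial_deriv i g x)" for i
    by (intro ext, subst partial_deriv_eq[OF has_derivative_add[OF d[THEN differentiable_on_UNIV_has_derivative]]])
      (simp add: partial_deriv_def)
  moreover have "(\<lambda>x. f x + g x) differentiable_on UNIV" using d by simp
  ultimately show ?case using Suc by simp
qed (auto intro: continuous_on_add)

lemma C_k_mult:
  assumes "C_k k f" "C_k k g"
  shows "C_k k (\<lambda>x. f x * g x)"
  using assms
proof (induction k arbitrary: f g)
  case (Suc k)
  then have d: "f differentiable_on UNIV" "g differentiable_on UNIV" by auto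
  have "partial_deriv i (\<lambda>x. f x * g x) = (\<lambda>x. f x * partial_deriv i g x + partial_deriv i f x * g x)" for i
    by (intro ext, subst partial_deriv_eq[OF has_derivative_mult[OF d[THEN differentiable_on_UNIV_has_derivative]]])
      (simp add: partial_deriv_def)
  moreover have "C_k k (\<lambda>x. f x * partial_deriv i g x + partial_deriv i f x * g x)" for i
    using Suc.prems C_k_SucD by (intro C_k_add Suc.IH) auto
  moreover have "(\<lambda>x. f x * g x) differentiable_on UNIV"
    using d by (simp add: differentiable_on_mult)
  ultimately show ?case by simp
qed (auto intro: continuous_on_mult)

lemma C_k_coordinate: "C_k k (\<lambda>x. x $ i)"
proof (cases k)
  case 0
  then show ?thesis by (auto intro!: continuous_intros)
next
  case (Suc n)
  have d: "((\<lambda>x. x $ i) has_derivative (\<lambda>h. h $ i)) (at x)" for x :: "real^2"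
    by (rule bounded_linear_imp_has_derivative) (rule bounded_linear_vec_nth)
  have "partial_deriv j (\<lambda>x. x $ i) = (\<lambda>x. axis j 1 $ i)" for j
    by (intro ext) (simp add: partial_deriv_eq[OF d])
  moreover have "(\<lambda>x. x $ i) differentiable_on (UNIV :: (real^2) set)"
    using d by (intro differentiable_at_imp_differentiable_on) (auto simp: differentiable_def)
  ultimately show ?thesis using Suc C_k_const by simp
qed

text \<open>\<open>flat 0\<close> is the classical smooth function that vanishes to infinite order
  at 0. The powers in the denominator make the linear span of the family closed under
  differentiation, so that smoothness follows by induction over all \<open>m\<close> at
  once.\<close>

definition flat :: "nat \<Rightarrow> real \<Rightarrow> real" where
  "flat m s = (if s > 0 then exp (- 1 / s) / s ^ m else 0)"

lemma flat_pos: "s > 0 \<Longrightarrow> flat m s > 0" and flat_zero: "s \<le> 0 \<Longrightarrow> flat m s = 0"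
  by (auto simp: flat_def)

lemma flat_tendsto_0: "(flat m \<longlongrightarrow> 0) (at 0)"
proof (rule filterlim_split_at)
  have "\<forall>\<^sub>F s in at_left 0. flat m s = 0"
    by (auto simp: flat_def eventually_at_filter)
  then show "(flat m \<longlongrightarrow> 0) (at_left 0)" by (simp add: tendsto_eventually)
  have "((\<lambda>s. inverse s ^ m / exp (inverse s)) \<longlongrightarrow> (0::real)) (at_right 0)"
    by (rule filterlim_compose[OF tendsto_power_div_exp_0 filterlim_inverse_at_top_right])
  moreover have "\<forall>\<^sub>F s in at_right 0. inverse s ^ m / exp (inverse s) = flat m s"
    unfolding eventually_at_filter
    by (intro always_eventually allI impI)
      (simp add: flat_def exp_minus power_inverse inverse_eq_divide field_simps)
  ultimately show "(flat m \<longlongrightarrow> 0) (at_right 0)" by (rule Lim_transform_eventually)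
qed

lemma flat_deriv:
  "(flat m has_real_derivative (flat (m + 2) s - real m * flat (m + 1) s)) (at s)"
proof -
  consider "s > 0" | "s < 0" | "s = 0" by linarith
  then show ?thesis
  proof cases
    case 1
    have "((\<lambda>s. exp (- 1 / s) / s ^ m) has_real_derivative (flat (m + 2) s - real m * flat (m + 1) s)) (at s)"
    proof (cases m)
      case 0
      then show ?thesis using 1
        by (auto intro!: derivative_eq_intros simp: flat_def field_simps power2_eq_square)
    next
      case (Suc n)
      have "((\<lambda>s. exp (- 1 / s)) has_real_derivative exp (- 1 / s) / s\<^sup>2) (at s)"
        using 1 by (auto intro!: derivative_eq_intros simp: field_simps power2_eq_square)
      moreover have "((\<lambda>s. s ^ m) has_real_derivative real m * s ^ n) (at s)"
        using DERIV_pow[of m s] Suc by simp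
      ultimately have "((\<lambda>s. exp (- 1 / s) / s ^ m) has_real_derivative
          (exp (- 1 / s) / s\<^sup>2 * s ^ m - exp (- 1 / s) * (real m * s ^ n)) / (s ^ m * s ^ m)) (at s)"
        by (rule DERIV_divide) (use 1 in simp)
      moreover have "(exp (- 1 / s) / s\<^sup>2 * s ^ m - exp (- 1 / s) * (real m * s ^ n)) / (s ^ m * s ^ m)
          = flat (m + 2) s - real m * flat (m + 1) s"
        using 1 Suc by (simp add: flat_def field_simps power2_eq_square)
      ultimately show ?thesis by simp
    qed
    then show ?thesis
      by (rule has_field_derivative_transform_within_open[of _ _ _ "{0<..}"]) (use 1 in \<open>auto simp: flat_def\<close>)
  next
    case 2
    have "((\<lambda>s. 0) has_real_derivative 0) (at s)" by simp
    then have "(flat m has_real_derivative 0) (at s)"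
      by (rule has_field_derivative_transform_within_open[of _ _ _ "{..<0}"]) (use 2 in \<open>auto simp: flat_def\<close>)
    then show ?thesis using 2 by (simp add: flat_zero)
  next
    \<comment> \<open>At 0 the difference quotient of \<open>flat m\<close> is
      \<open>flat (m + 1)\<close> itself, which tends to 0.\<close>
    case 3
    have "\<forall>\<^sub>F h in at 0. flat (m + 1) h = (flat m (0 + h) - flat m 0) / h"
      by (auto simp: flat_def eventually_at_filter)
    then have "((\<lambda>h. (flat m (0 + h) - flat m 0) / h) \<longlongrightarrow> 0) (at 0)"
      by (rule Lim_transform_eventually[OF flat_tendsto_0])
    then show ?thesis using 3 by (simp add: DERIV_def flat_zero)
  qed
qed

text \<open>The squared norm makes the argument a polynomial, smooth at the centre too. The index
  \<open>m\<close> is kept because partial derivatives lead to \<open>bump (m + 1)\<close> and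
  \<open>bump (m + 2)\<close>.\<close>

definition bump :: "nat \<Rightarrow> real^2 \<Rightarrow> real \<Rightarrow> real^2 \<Rightarrow> real" where
  "bump m z r w = flat m (r\<^sup>2 - (norm (w - z))\<^sup>2)"

lemma bump_has_derivative:
  "(bump m z r has_derivative (\<lambda>h. (bump (m + 2) z r w - real m * bump (m + 1) z r w) * (- 2 * ((w - z) \<bullet> h)))) (at w)"
proof -
  have "((\<lambda>w. r\<^sup>2 - (norm (w - z))\<^sup>2) has_derivative (\<lambda>h. - 2 * ((w - z) \<bullet> h))) (at w)"
    unfolding power2_norm_eq_inner
    by (auto intro!: derivative_eq_intros simp: inner_commute)
  then have "(flat m \<circ> (\<lambda>w. r\<^sup>2 - (norm (w - z))\<^sup>2) has_derivative
     (*) (flat (m + 2) (r\<^sup>2 - (norm (w - z))\<^sup>2) - real m * flat (m + 1) (r\<^sup>2 - (norm (w - z))\<^sup>2)) \<circ> (\<lambda>h. - 2 * ((w - z) \<bullet> h))) (at w)"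
    by (intro diff_chain_at) (use flat_deriv[THEN has_field_derivative_imp_has_derivative] in auto)
  then show ?thesis by (simp add: o_def bump_def[abs_def])
qed

lemma partial_deriv_bump:
  "partial_deriv i (bump m z r) w = (bump (m + 2) z r w - real m * bump (m + 1) z r w) * (- 2 * (w $ i - z $ i))"
  by (simp add: partial_deriv_eq[OF bump_has_derivative] inner_axis)

lemma C_k_bump: "C_k k (bump m z r)"
proof (induction k arbitrary: m)
  case 0
  have "isCont (bump m z r) w" for w
    by (rule has_derivative_continuous[OF bump_has_derivative])
  then show ?case by (simp add: continuous_at_imp_continuous_on)
next
  case (Suc k)
  \<comment> \<open>Differences are written as sums, so that the closure of \<open>C_k\<close> under
    sums and products applies.\<close>
  have "partial_deriv i (bump m z r) = (\<lambda>w. (bump (m + 2) z r w + (- real m) * bump (m + 1) z r w) * (- 2 * (w $ i + - z $ i)))" for i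
    by (intro ext) (simp add: partial_deriv_bump)
  moreover have "C_k k (\<lambda>w. (bump (m + 2) z r w + (- real m) * bump (m + 1) z r w) * (- 2 * (w $ i + - z $ i)))" for i
    by (intro C_k_mult C_k_add C_k_const C_k_coordinate Suc.IH)
  moreover have "bump m z r differentiable_on UNIV"
    using bump_has_derivative
    by (intro differentiable_at_imp_differentiable_on) (unfold differentiable_def, blast)
  ultimately show ?case by simp
qed

lemma bump_pos_iff: "r > 0 \<Longrightarrow> bump m z r w > 0 \<longleftrightarrow> w \<in> ball z r"
  and bump_nonneg: "bump m z r w \<ge> 0"
  and bump_zero: "r > 0 \<Longrightarrow> w \<notin> ball z r \<Longrightarrow> bump m z r w = 0"
proof -
  have *: "r\<^sup>2 - (norm (w - z))\<^sup>2 > 0 \<longleftrightarrow> w \<in> ball z r" if "r > 0"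
    using that abs_square_less_1 power_strict_mono[of "norm (w - z)" r 2] power_mono[of r "norm (w - z)" 2]
    by (auto simp: dist_norm norm_minus_commute not_less[symmetric])
  then show "r > 0 \<Longrightarrow> bump m z r w > 0 \<longleftrightarrow> w \<in> ball z r"
    unfolding bump_def by (metis flat_pos flat_zero less_irrefl not_less)
  show "bump m z r w \<ge> 0" unfolding bump_def by (simp add: flat_def)
  show "r > 0 \<Longrightarrow> w \<notin> ball z r \<Longrightarrow> bump m z r w = 0"
    unfolding bump_def using * flat_zero by (meson not_less)
qed

lemma bump_test_function:
  assumes "r > 0" "cball z r \<subseteq> \<Omega>"
  shows "bump m z r \<in> test_functions \<Omega>"
proof -
  have "bump m z r w \<noteq> 0 \<longleftrightarrow> w \<in> ball z r" for w
    using bump_pos_iff[OF assms(1), of m z w] bump_zero[OF assms(1), of w z m] by auto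
  then have "{w. bump m z r w \<noteq> 0} = ball z r" by blast
  then have "closure {w. bump m z r w \<noteq> 0} = cball z r"
    using closure_ball[OF assms(1)] by metis
  then show ?thesis
    unfolding test_functions_def using assms(2) by (intro CollectI conjI allI C_k_bump) simp_all
qed

lemma test_function_has_derivative:
  assumes "\<psi> \<in> test_functions \<Omega>"
  shows "(\<psi> has_derivative (\<lambda>h. h $ 1 * partial_deriv 1 \<psi> x + h $ 2 * partial_deriv 2 \<psi> x)) (at x)"
proof -
  have "C_k (Suc 0) \<psi>" using assms by (simp add: test_functions_def del: C_k.simps)
  then have d: "(\<psi> has_derivative frechet_derivative \<psi> (at x)) (at x)"
    using differentiable_on_UNIV_has_derivative by auto
  interpret linear "frechet_derivative \<psi> (at x)" using d by (rule has_derivative_linear)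
  have "h = h $ 1 *\<^sub>R axis 1 1 + h $ 2 *\<^sub>R axis 2 1" for h :: "real^2"
    by (simp add: vec_eq_iff forall_2 axis_def)
  then have "frechet_derivative \<psi> (at x) h = h $ 1 * partial_deriv 1 \<psi> x + h $ 2 * partial_deriv 2 \<psi> x" for h
    unfolding partial_deriv_def by (metis add scale real_scaleR_def)
  then show ?thesis using d by (metis (no_types, lifting) ext)
qed

lemma test_function_partial_continuous:
  assumes "\<psi> \<in> test_functions \<Omega>"
  shows "continuous_on UNIV (partial_deriv i \<psi>)"
proof -
  have "C_k (Suc 0) \<psi>" using assms by (simp add: test_functions_def del: C_k.simps)
  then show ?thesis by simp
qed

lemma test_function_continuous:
  assumes "\<psi> \<in> test_functions \<Omega>"
  shows "continuous_on UNIV \<psi>"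
proof -
  have "C_k 0 \<psi>" using assms by (simp add: test_functions_def del: C_k.simps)
  then show ?thesis by simp
qed

lemma test_function_zero:
  assumes "\<psi> \<in> test_functions \<Omega>" "x \<notin> closure {x. \<psi> x \<noteq> 0}"
  shows "\<psi> x = 0" "partial_deriv i \<psi> x = 0"
proof -
  have z: "\<psi> x = 0" if "x \<notin> closure {x. \<psi> x \<noteq> 0}" for x
    using that closure_subset[of "{x. \<psi> x \<noteq> 0}"] by blast
  show "\<psi> x = 0" by (rule z[OF assms(2)])
  have "((\<lambda>x. 0) has_derivative (\<lambda>h. 0)) (at x)" by simp
  then have "(\<psi> has_derivative (\<lambda>h. 0)) (at x)"
  proof (rule has_derivative_transform_within_open)
    show "open (- closure {x. \<psi> x \<noteq> 0})" by (rule open_Compl) (rule closed_closure)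
    show "x \<in> - closure {x. \<psi> x \<noteq> 0}" using assms(2) by blast
    show "0 = \<psi> y" if "y \<in> - closure {x. \<psi> x \<noteq> 0}" for y
      by (rule z[OF ComplD[OF that], symmetric])
  qed
  then show "partial_deriv i \<psi> x = 0" by (rule partial_deriv_eq)
qed

lemma test_function_support:
  assumes "\<psi> \<in> test_functions \<Omega>"
  shows "compact (closure {x. \<psi> x \<noteq> 0})" "closure {x. \<psi> x \<noteq> 0} \<subseteq> \<Omega>"
  using assms by (auto simp: test_functions_def)

section \<open>Integration by parts\<close>

lemma integrable_bounded_support:
  fixes F :: "real^2 \<Rightarrow> real"
  assumes "F \<in> borel_measurable borel" "\<And>x. \<bar>F x\<bar> \<le> C" "\<And>x. x \<notin> cball 0 R \<Longrightarrow> F x = 0"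
  shows "integrable lborel F"
proof (rule Bochner_Integration.integrable_bound)
  show "integrable lborel (\<lambda>x. C * indicator (cball 0 R) (x :: real^2))"
    using emeasure_lborel_cball_finite[of "0 :: real^2" R] by simp
  show "F \<in> borel_measurable lborel" using assms(1) by simp
  have "C \<ge> 0" using assms(2)[of 0] by linarith
  then show "AE x in lborel. norm (F x) \<le> norm (C * indicator (cball 0 R) x)"
    using assms(2,3) by (intro always_eventually allI) (auto simp: indicator_def)
qed

lemma integral_lborel_shift:
  fixes F :: "real^2 \<Rightarrow> real"
  assumes "F \<in> borel_measurable borel"
  shows "integral\<^sup>L lborel (\<lambda>x. F (x + c)) = integral\<^sup>L lborel F"
proof -
  have "integral\<^sup>L lborel F = integral\<^sup>L (distr lborel borel ((+) c)) F"
    by (simp add: lborel_distr_plus)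
  also have "\<dots> = integral\<^sup>L lborel (\<lambda>x. F (c + x))"
    using assms by (intro integral_distr) auto
  finally show ?thesis by (simp add: add.commute)
qed

lemma integral_limit_zero:
  fixes G :: "nat \<Rightarrow> real^2 \<Rightarrow> real"
  assumes "\<And>n. G n \<in> borel_measurable borel" "D \<in> borel_measurable borel"
    and "\<And>n x. \<bar>G n x\<bar> \<le> C" "\<And>n x. x \<notin> cball 0 R \<Longrightarrow> G n x = 0"
    and "AE x in lborel. (\<lambda>n. G n x) \<longlonglongrightarrow> D x"
    and "\<And>n. integral\<^sup>L lborel (G n) = 0"
  shows "integral\<^sup>L lborel D = 0"
proof -
  have C: "C \<ge> 0" using assms(3)[of 0 0] by linarith
  have "(\<lambda>n. integral\<^sup>L lborel (G n)) \<longlonglongrightarrow> integral\<^sup>L lborel D"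
  proof (rule integral_dominated_convergence[where w = "\<lambda>x. C * indicator (cball 0 R) x"])
    show "integrable lborel (\<lambda>x. C * indicator (cball 0 R) (x :: real^2))"
      using emeasure_lborel_cball_finite[of "0 :: real^2" R] by simp
    show "AE x in lborel. norm (G n x) \<le> C * indicator (cball 0 R) x" for n
      using assms(3)[of n] assms(4)[of _ n] C by (intro always_eventually allI) (auto simp: indicator_def)
  qed (use assms in auto)
  then show ?thesis using assms(6) LIMSEQ_unique[OF _ tendsto_const] by simp
qed

lemma tendsto_difference_quotient_seq:
  assumes "((\<lambda>h. (f h - f 0) / h) \<longlongrightarrow> (d::real)) (at 0)" "\<delta> > 0"
  shows "(\<lambda>n. (f (\<delta> / real (Suc n)) - f 0) / (\<delta> / real (Suc n))) \<longlonglongrightarrow> d"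
proof -
  have "filterlim (\<lambda>n. \<delta> / real (Suc n)) (at 0) sequentially"
    unfolding filterlim_at
  proof
    show "\<forall>\<^sub>F n in sequentially. \<delta> / real (Suc n) \<in> UNIV \<and> \<delta> / real (Suc n) \<noteq> 0"
      using assms(2) by (intro always_eventually) auto
    have "(\<lambda>n. \<delta> * inverse (real (Suc n))) \<longlonglongrightarrow> \<delta> * 0"
      by (intro tendsto_intros LIMSEQ_inverse_real_of_nat)
    then show "(\<lambda>n. \<delta> / real (Suc n)) \<longlonglongrightarrow> 0" by (simp add: divide_inverse)
  qed
  from filterlim_compose[OF assms(1) this] show ?thesis .
qed

text \<open>Difference quotients integrate to zero by translation invariance, and the Lipschitz
  bound permits dominated convergence. Regularity is asked along \<open>e\<close> only; this covers
  a test function cut off at a half plane with \<open>e\<close> parallel to its boundary.\<close>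

lemma integral_directional_derivative_zero:
  fixes F :: "real^2 \<Rightarrow> real"
  assumes F: "F \<in> borel_measurable borel" "\<And>x. \<bar>F x\<bar> \<le> C" "\<And>x. x \<notin> cball 0 R \<Longrightarrow> F x = 0"
    and lip: "\<And>x h. \<bar>F (x + h *\<^sub>R e) - F x\<bar> \<le> M * \<bar>h\<bar>"
    and D: "D \<in> borel_measurable borel"
    and lim: "\<And>x. ((\<lambda>h. (F (x + h *\<^sub>R e) - F x) / h) \<longlongrightarrow> D x) (at 0)"
  shows "integral\<^sup>L lborel D = 0"
proof (rule integral_limit_zero[where D = D])
  let ?h = "\<lambda>n. 1 / real (Suc n)"
  define G where "G n x = (F (x + ?h n *\<^sub>R e) - F x) / ?h n" for n x
  have Fs: "(\<lambda>x. F (x + c)) \<in> borel_measurable borel" for c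
    using measurable_compose[OF _ F(1), of "\<lambda>x. x + c" borel] by simp
  show "G n \<in> borel_measurable borel" for n
    unfolding G_def[abs_def] using Fs F(1) by simp
  show "\<bar>G n x\<bar> \<le> M" for n x
  proof -
    have "\<bar>a / h\<bar> \<le> M" if "\<bar>a\<bar> \<le> M * \<bar>h\<bar>" "h > 0" for a h :: real
      using that by (simp add: divide_le_eq)
    note * = this
    show ?thesis unfolding G_def by (rule *[OF lip]) simp
  qed
  \<comment> \<open>The step lengths are at most 1, so the shifted support stays within distance
    \<open>norm e\<close> of the old one.\<close>
  show "G n x = 0" if x: "x \<notin> cball 0 (R + norm e)" for n x
  proof -
    have h: "norm (?h n *\<^sub>R e) \<le> norm e" by (simp add: field_simps mult_left_le_one_le)
    have "norm (x + ?h n *\<^sub>R e) \<ge> norm x - norm (?h n *\<^sub>R e)"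
      by (metis norm_diff_ineq)
    then have "x + ?h n *\<^sub>R e \<notin> cball 0 R" using x h by simp
    moreover have "x \<notin> cball 0 R" using x unfolding mem_cball_0 using norm_ge_zero[of e] by linarith
    ultimately show ?thesis using F(3) by (simp add: G_def)
  qed
  show "AE x in lborel. (\<lambda>n. G n x) \<longlonglongrightarrow> D x"
  proof (intro always_eventually allI)
    fix x
    show "(\<lambda>n. G n x) \<longlonglongrightarrow> D x"
      using tendsto_difference_quotient_seq[of "\<lambda>h. F (x + h *\<^sub>R e)" "D x" 1] lim[of x]
      by (simp add: G_def)
  qed
  show "integral\<^sup>L lborel (G n) = 0" for n
  proof -
    let ?c = "?h n *\<^sub>R e"
    have i1: "integrable lborel F" by (rule integrable_bounded_support[OF F])
    have i2: "integrable lborel (\<lambda>x. F (x + ?c))"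
    proof (rule integrable_bounded_support[OF Fs])
      show "\<bar>F (x + ?c)\<bar> \<le> C" for x by (rule F(2))
      show "F (x + ?c) = 0" if "x \<notin> cball 0 (R + norm ?c)" for x
      proof (rule F(3))
        have "norm (x + ?c) \<ge> norm x - norm ?c" by (metis norm_diff_ineq)
        then show "x + ?c \<notin> cball 0 R" using that by simp
      qed
    qed
    show ?thesis
      unfolding G_def using integral_lborel_shift[OF F(1), of ?c] i1 i2 by simp
  qed
qed (use D in auto)

lemma bounded_support_cball:
  assumes "compact (S :: (real^2) set)"
  obtains R where "S \<subseteq> cball 0 R"
proof -
  obtain B where "\<And>x. x \<in> S \<Longrightarrow> norm x \<le> B"
    using compact_imp_bounded[OF assms] unfolding bounded_iff by blast
  then show ?thesis using that[of B] by (simp add: subset_iff)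
qed

lemma continuous_support_bound:
  fixes G :: "real^2 \<Rightarrow> real"
  assumes "continuous_on UNIV G" "compact S" "\<And>x. x \<notin> S \<Longrightarrow> G x = 0"
  obtains C where "\<And>x. \<bar>G x\<bar> \<le> C"
proof -
  have "compact (G ` S)"
    using assms(1,2) continuous_on_subset by (intro compact_continuous_image) auto
  from compact_imp_bounded[OF this] obtain C where C: "\<And>x. x \<in> S \<Longrightarrow> norm (G x) \<le> C"
    unfolding bounded_iff by auto
  have "\<bar>G x\<bar> \<le> max C 0" for x
    using assms(3)[of x] C[of x] by (cases "x \<in> S") auto
  then show ?thesis using that by blast
qed

lemma continuous_support_integrable:
  fixes G :: "real^2 \<Rightarrow> real"
  assumes "continuous_on UNIV G" "compact S" "\<And>x. x \<notin> S \<Longrightarrow> G x = 0"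
  shows "integrable lborel G"
proof -
  obtain C where C: "\<And>x. \<bar>G x\<bar> \<le> C" using continuous_support_bound[OF assms] by blast
  obtain R where R: "S \<subseteq> cball 0 R" using bounded_support_cball[OF assms(2)] .
  show ?thesis
  proof (rule integrable_bounded_support[OF borel_measurable_continuous_onI[OF assms(1)] C])
    show "G x = 0" if "x \<notin> cball 0 R" for x
      using R that by (intro assms(3)) blast
  qed
qed

text \<open>Compact support bounds the continuous derivative, and the mean value inequality turns
  this bound into the Lipschitz condition along \<open>e\<close>.\<close>

lemma integral_derivative_zero:
  fixes F :: "real^2 \<Rightarrow> real"
  assumes d: "\<And>x. (F has_derivative F' x) (at x)" and c: "continuous_on UNIV (\<lambda>x. F' x e)"
    and z: "\<And>x. x \<notin> cball 0 R \<Longrightarrow> F x = 0"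
  shows "integral\<^sup>L lborel (\<lambda>x. F' x e) = 0" "integrable lborel (\<lambda>x. F' x e)"
proof -
  have cF: "continuous_on UNIV F"
    by (intro continuous_at_imp_continuous_on ballI) (rule has_derivative_continuous[OF d])
  have zF': "F' x e = 0" if "x \<notin> cball 0 R" for x
  proof -
    have "((\<lambda>x. 0) has_derivative (\<lambda>h. 0)) (at x)" by simp
    then have "(F has_derivative (\<lambda>h. 0)) (at x)"
    proof (rule has_derivative_transform_within_open)
      show "open (- cball 0 R :: (real^2) set)" by (rule open_Compl) (rule closed_cball)
      show "x \<in> - cball 0 R" using that by blast
      show "0 = F y" if "y \<in> - cball 0 R" for y by (rule z[OF ComplD[OF that], symmetric])
    qed
    then have "F' x = (\<lambda>h. 0)" using d[of x] has_derivative_unique by blast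
    then show ?thesis by simp
  qed
  obtain C where C: "\<And>x. \<bar>F x\<bar> \<le> C" using continuous_support_bound[OF cF compact_cball z] by blast
  obtain M where M: "\<And>x. \<bar>F' x e\<bar> \<le> M" using continuous_support_bound[OF c compact_cball zF'] by blast
  have line: "((\<lambda>t. F (x + t *\<^sub>R e)) has_real_derivative F' (x + t *\<^sub>R e) e) (at t)" for x t
  proof -
    have "((\<lambda>t. x + t *\<^sub>R e) has_derivative (\<lambda>h. h *\<^sub>R e)) (at t)"
      by (auto intro!: derivative_eq_intros)
    from has_derivative_compose[OF this d]
    have "((\<lambda>t. F (x + t *\<^sub>R e)) has_derivative (\<lambda>h. F' (x + t *\<^sub>R e) (h *\<^sub>R e))) (at t)" .
    moreover have "F' (x + t *\<^sub>R e) (h *\<^sub>R e) = F' (x + t *\<^sub>R e) e * h" for h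
      using linear_scale[OF has_derivative_linear[OF d]] by simp
    ultimately show ?thesis by (simp add: has_field_derivative_def)
  qed
  show "integral\<^sup>L lborel (\<lambda>x. F' x e) = 0"
  proof (rule integral_directional_derivative_zero)
    show "F \<in> borel_measurable borel" by (rule borel_measurable_continuous_onI[OF cF])
    show "(\<lambda>x. F' x e) \<in> borel_measurable borel" by (rule borel_measurable_continuous_onI[OF c])
    show "\<bar>F (x + h *\<^sub>R e) - F x\<bar> \<le> M * \<bar>h\<bar>" for x h
    proof -
      have "norm (F (x + h *\<^sub>R e) - F (x + 0 *\<^sub>R e)) \<le> M * norm (h - 0)"
        by (rule field_differentiable_bound[OF convex_UNIV, where f' = "\<lambda>t. F' (x + t *\<^sub>R e) e"])
          (use line M in auto)
      then show ?thesis by simp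
    qed
    show "((\<lambda>h. (F (x + h *\<^sub>R e) - F x) / h) \<longlongrightarrow> F' x e) (at 0)" for x
      using line[of x 0] by (simp add: DERIV_def)
  qed (use C z in auto)
  show "integrable lborel (\<lambda>x. F' x e)"
    by (rule integrable_bounded_support[OF borel_measurable_continuous_onI[OF c] M zF'])
qed

text \<open>The classical curl of \<open>q\<close> is the constant \<open>- 2 * b\<close>. The
  product rule is applied to the first component of \<open>q\<close> times \<psi> in direction
  \<open>axis 2 1\<close> and to the second in direction \<open>axis 1 1\<close>; each total
  derivative integrates to zero.\<close>

lemma nedelec_weak_curl:
  fixes q :: "real^2 \<Rightarrow> real^2"
  assumes \<psi>: "\<psi> \<in> test_functions \<Omega>"
    and q_def: "\<And>x. q x = a + b *\<^sub>R vector [x $ 2, - (x $ 1)]"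
  shows "integral\<^sup>L lborel (\<lambda>x. q x $ 1 * partial_deriv 2 \<psi> x - q x $ 2 * partial_deriv 1 \<psi> x)
    = - 2 * b * integral\<^sup>L lborel \<psi>"
proof -
  let ?S = "closure {x. \<psi> x \<noteq> 0}"
  note supp = test_function_support[OF \<psi>] and dpsi = test_function_has_derivative[OF \<psi>]
  note cont = test_function_continuous[OF \<psi>] test_function_partial_continuous[OF \<psi>]
  note zero = test_function_zero[OF \<psi>]
  obtain R where R: "?S \<subseteq> cball 0 R" using bounded_support_cball[OF supp(1)] .
  have q: "q x $ 1 = a $ 1 + b * x $ 2" "q x $ 2 = a $ 2 - b * x $ 1" for x
    by (simp_all add: q_def)
  have coord: "((\<lambda>x. x $ i) has_derivative (\<lambda>h. h $ i)) (at x)" for x :: "real^2" and i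
    by (rule bounded_linear_imp_has_derivative) (rule bounded_linear_vec_nth)
  let ?F1 = "\<lambda>x::real^2. (a $ 1 + b * x $ 2) * \<psi> x"
  let ?F1' = "\<lambda>(x::real^2) (h::real^2). (a $ 1 + b * x $ 2) * (h $ 1 * partial_deriv 1 \<psi> x + h $ 2 * partial_deriv 2 \<psi> x) + (b * h $ 2) * \<psi> x"
  let ?F2 = "\<lambda>x::real^2. (a $ 2 - b * x $ 1) * \<psi> x"
  let ?F2' = "\<lambda>(x::real^2) (h::real^2). (a $ 2 - b * x $ 1) * (h $ 1 * partial_deriv 1 \<psi> x + h $ 2 * partial_deriv 2 \<psi> x) + (- (b * h $ 1)) * \<psi> x"
  have d1: "(?F1 has_derivative ?F1' x) (at x)" for x
    by (auto intro!: derivative_eq_intros coord dpsi)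
  have d2: "(?F2 has_derivative ?F2' x) (at x)" for x
    by (auto intro!: derivative_eq_intros coord dpsi)
  have c: "continuous_on UNIV (\<lambda>x. ?F1' x e)" "continuous_on UNIV (\<lambda>x. ?F2' x e)" for e
    by (intro continuous_intros cont)+
  have z: "?F1 x = 0" "?F2 x = 0" if "x \<notin> cball 0 R" for x
  proof -
    have "\<psi> x = 0" using zero(1)[of x] R that by blast
    then show "?F1 x = 0" "?F2 x = 0" by simp_all
  qed
  note I1 = integral_derivative_zero[where F = ?F1 and F' = ?F1' and e = "axis 2 1 :: real^2" and R = R, OF d1 c(1) z(1)]
  note I2 = integral_derivative_zero[where F = ?F2 and F' = ?F2' and e = "axis 1 1 :: real^2" and R = R, OF d2 c(2) z(2)]
  have ip: "integrable lborel \<psi>"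
    by (rule continuous_support_integrable[OF cont(1) supp(1) zero(1)])
  define A1 where "A1 x = ?F1' x (axis 2 1)" for x
  define A2 where "A2 x = ?F2' x (axis 1 1)" for x
  have A: "integral\<^sup>L lborel A1 = 0" "integrable lborel A1" "integral\<^sup>L lborel A2 = 0" "integrable lborel A2"
    unfolding A1_def[abs_def] A2_def[abs_def] by (rule I1 I2; assumption)+
  have "q x $ 1 * partial_deriv 2 \<psi> x - q x $ 2 * partial_deriv 1 \<psi> x = (A1 x - A2 x) + (- 2 * b) * \<psi> x" for x
    unfolding q A1_def A2_def by (simp add: axis_def algebra_simps)
  then have "integral\<^sup>L lborel (\<lambda>x. q x $ 1 * partial_deriv 2 \<psi> x - q x $ 2 * partial_deriv 1 \<psi> x)
    = integral\<^sup>L lborel (\<lambda>x. (A1 x - A2 x) + (- 2 * b) * \<psi> x)"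
    by (intro Bochner_Integration.integral_cong refl)
  also have "\<dots> = integral\<^sup>L lborel (\<lambda>x. A1 x - A2 x) + integral\<^sup>L lborel (\<lambda>x. (- 2 * b) * \<psi> x)"
    by (rule Bochner_Integration.integral_add) (intro Bochner_Integration.integrable_diff A integrable_mult_right ip)+
  also have "integral\<^sup>L lborel (\<lambda>x. A1 x - A2 x) = 0"
    using Bochner_Integration.integral_diff[OF A(2,4)] A by simp
  finally show ?thesis by simp
qed

section \<open>Weak curl of piecewise fields\<close>

lemma integral_pos_open:
  fixes F :: "real^2 \<Rightarrow> real"
  assumes "integrable lborel F" "\<And>x. F x \<ge> 0" "open U" "U \<noteq> {}" "\<And>x. x \<in> U \<Longrightarrow> F x > 0"
  shows "integral\<^sup>L lborel F > 0"
proof -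
  have "integral\<^sup>L lborel F \<ge> 0" using assms(2) by (intro Bochner_Integration.integral_nonneg) auto
  moreover have "integral\<^sup>L lborel F \<noteq> 0"
  proof
    assume "integral\<^sup>L lborel F = 0"
    then have "AE x in lborel. F x = 0"
      using integral_nonneg_eq_0_iff_AE[OF assms(1)] assms(2) by simp
    then have "AE x in lborel. x \<notin> U"
      by eventually_elim (use assms(5) in fastforce)
    moreover have "U \<in> sets lborel" using assms(3) by simp
    ultimately have "U \<in> null_sets lborel" using AE_iff_null_sets[of U lborel] by blast
    then have "negligible U" by (simp add: negligible_iff_null_sets null_sets_completionI)
    then show False using open_not_negligible[OF assms(3,4)] by blast
  qed
  ultimately show ?thesis by linarith
qed

text \<open>The weak curl is stated on \<open>lebesgue_on \<Omega>\<close> for fields known almost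
  everywhere, whereas the arguments by translation concern Borel functions on the plane.
  \<open>D\<close> is a Borel representative extended by zero.\<close>

lemma integral_lebesgue_on_eq_lborel:
  fixes f D :: "real^2 \<Rightarrow> real"
  assumes "open \<Omega>" "f \<in> borel_measurable (lebesgue_on \<Omega>)" "D \<in> borel_measurable borel"
    and "\<And>x. x \<notin> \<Omega> \<Longrightarrow> D x = 0" "AE x in lebesgue. x \<in> \<Omega> \<longrightarrow> f x = D x"
  shows "integral\<^sup>L (lebesgue_on \<Omega>) f = integral\<^sup>L lborel D"
proof -
  have \<Omega>: "\<Omega> \<in> sets lebesgue" using assms(1) by simp
  have Dl: "D \<in> borel_measurable lebesgue" using assms(3) by (simp add: measurable_completion)
  have "AE x in lebesgue_on \<Omega>. f x = D x"
    using assms(5) \<Omega> by (simp add: AE_restrict_space_iff)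
  then have "integral\<^sup>L (lebesgue_on \<Omega>) f = integral\<^sup>L (lebesgue_on \<Omega>) D"
    by (intro integral_cong_AE assms(2) measurable_restrict_space1 Dl)
  also have "\<dots> = integral\<^sup>L lebesgue (\<lambda>x. if x \<in> \<Omega> then D x else 0)"
    by (simp add: Lebesgue_Measure.integral_restrict_UNIV[OF \<Omega>])
  also have "(\<lambda>x. if x \<in> \<Omega> then D x else 0) = D" using assms(4) by auto
  also have "integral\<^sup>L lebesgue D = integral\<^sup>L lborel D"
    using assms(3) by (intro integral_completion) simp
  finally show ?thesis .
qed

lemma test_function_line:
  assumes "\<psi> \<in> test_functions \<Omega>"
  shows "((\<lambda>t. \<psi> (x + t *\<^sub>R e)) has_real_derivative
    e $ 1 * partial_deriv 1 \<psi> (x + t *\<^sub>R e) + e $ 2 * partial_deriv 2 \<psi> (x + t *\<^sub>R e)) (at t)"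
proof -
  have "((\<lambda>t. x + t *\<^sub>R e) has_derivative (\<lambda>h. h *\<^sub>R e)) (at t)"
    by (auto intro!: derivative_eq_intros)
  from has_derivative_compose[OF this test_function_has_derivative[OF assms]]
  have "((\<lambda>t. \<psi> (x + t *\<^sub>R e)) has_derivative (\<lambda>h. (h *\<^sub>R e) $ 1 * partial_deriv 1 \<psi> (x + t *\<^sub>R e)
    + (h *\<^sub>R e) $ 2 * partial_deriv 2 \<psi> (x + t *\<^sub>R e))) (at t)" .
  then show ?thesis
    unfolding has_field_derivative_def by (rule has_derivative_eq_rhs) (simp add: fun_eq_iff algebra_simps)
qed

lemma test_function_lipschitz:
  assumes "\<psi> \<in> test_functions \<Omega>"
  obtains M where "\<And>x h. \<bar>\<psi> (x + h *\<^sub>R e) - \<psi> x\<bar> \<le> M * \<bar>h\<bar>"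
proof -
  let ?D = "\<lambda>x. e $ 1 * partial_deriv 1 \<psi> x + e $ 2 * partial_deriv 2 \<psi> x"
  have c: "continuous_on UNIV ?D"
    by (intro continuous_intros test_function_partial_continuous[OF assms])
  have z: "?D x = 0" if "x \<notin> closure {x. \<psi> x \<noteq> 0}" for x
    by (simp add: test_function_zero(2)[OF assms that])
  obtain M where M: "\<And>x. \<bar>?D x\<bar> \<le> M"
    using continuous_support_bound[OF c test_function_support(1)[OF assms] z] by blast
  have "\<bar>\<psi> (x + h *\<^sub>R e) - \<psi> x\<bar> \<le> M * \<bar>h\<bar>" for x h
  proof -
    have "norm (\<psi> (x + h *\<^sub>R e) - \<psi> (x + 0 *\<^sub>R e)) \<le> M * norm (h - 0)"
    proof (rule field_differentiable_bound[OF convex_UNIV])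
      show "((\<lambda>t. \<psi> (x + t *\<^sub>R e)) has_field_derivative ?D (x + t *\<^sub>R e)) (at t)" for t
        by (rule test_function_line[OF assms])
      show "norm (?D (x + t *\<^sub>R e)) \<le> M" for t using M by simp
    qed auto
    then show ?thesis by simp
  qed
  then show ?thesis using that by blast
qed

lemma test_function_quotient_tendsto:
  assumes "\<psi> \<in> test_functions \<Omega>"
  shows "((\<lambda>h. (\<psi> (x + h *\<^sub>R e) - \<psi> x) / h) \<longlongrightarrow> e $ 1 * partial_deriv 1 \<psi> x + e $ 2 * partial_deriv 2 \<psi> x) (at 0)"
  using test_function_line[OF assms, of x e 0] by (simp add: DERIV_def)

text \<open>The tangential derivative of the bump integrates to zero over the half plane, while the normal
  derivative has a strict sign there.\<close>

lemma half_plane_jump: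
  assumes xy: "x \<noteq> y" and z: "orient x y z = 0" and r: "r > 0"
  defines "\<psi> \<equiv> bump 0 z r"
  defines "H \<equiv> {w. orient x y w < 0}"
  assumes zero: "integral\<^sup>L lborel (\<lambda>w. indicator H w * (d $ 1 * partial_deriv 2 \<psi> w - d $ 2 * partial_deriv 1 \<psi> w)) = 0"
  shows "d \<bullet> (y - x) = 0"
proof -
  define \<tau> where "\<tau> = y - x"
  \<comment> \<open>The radial factor of the gradient of \<psi>: for index 0 the derivative of the
    bump involves \<open>bump 2\<close> alone.\<close>
  define \<beta> where "\<beta> = bump 2 z r"
  have \<psi>: "\<psi> \<in> test_functions UNIV" unfolding \<psi>_def using bump_test_function[OF r] by simp
  have H_open: "open H" unfolding H_def by (intro open_Collect_less continuous_intros)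
  have [measurable]: "H \<in> sets borel" using H_open by simp
  have \<beta>c: "continuous_on UNIV \<beta>" using C_k_bump[of 0 2 z r] by (simp add: \<beta>_def)
  have \<beta>0: "\<beta> w = 0" if "w \<notin> cball z r" for w 
    using bump_zero[OF r, of w z 2] that by (simp add: \<beta>_def)
  have pd: "partial_deriv i \<psi> w = - 2 * \<beta> w * (w $ i - z $ i)" for i w
    by (simp add: \<psi>_def \<beta>_def partial_deriv_bump numeral_2_eq_2 algebra_simps)
  have oH: "cross2 \<tau> (w - z) = orient x y w" for w
    using z by (simp add: orient_def \<tau>_def)
  \<comment> \<open>\<open>A\<close> and \<open>B\<close> are the normal and the tangential
    derivative of \<psi> on \<open>H\<close>, both scaled by the length of \<tau>.\<close>
  define A where "A w = indicator H w * (- 2 * \<beta> w * cross2 \<tau> (w - z))" for w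
  define B where "B w = indicator H w * (- 2 * \<beta> w * (\<tau> \<bullet> (w - z)))" for w
  have bnd: "\<exists>C. \<forall>w. \<bar>G w\<bar> \<le> C"
    if fc: "continuous_on UNIV f" and G: "\<And>w. G w = indicator H w * (- 2 * \<beta> w * f w)" for f G :: "real^2 \<Rightarrow> real"
  proof -
    have c: "continuous_on UNIV (\<lambda>w. - 2 * \<beta> w * f w)" by (intro continuous_intros \<beta>c fc)
    have "- 2 * \<beta> w * f w = 0" if "w \<notin> cball z r" for w using \<beta>0[OF that] by simp
    then obtain C where C: "\<And>w. \<bar>- 2 * \<beta> w * f w\<bar> \<le> C"
      using continuous_support_bound[OF c compact_cball] by metis
    have "C \<ge> 0" using C[of 0] by linarith
    then have "\<bar>G w\<bar> \<le> C" for w using C[of w] unfolding G by (auto simp: indicator_def)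
    then show ?thesis by blast
  qed
  obtain R where R: "cball z r \<subseteq> cball 0 R" using bounded_support_cball[OF compact_cball] .
  have int: "integrable lborel G"
    if fc: "continuous_on UNIV f" and G: "\<And>w. G w = indicator H w * (- 2 * \<beta> w * f w)" for f G
  proof -
    obtain C where C: "\<And>w. \<bar>G w\<bar> \<le> C" using bnd[OF fc G] by blast
    have [measurable]: "f \<in> borel_measurable borel" "\<beta> \<in> borel_measurable borel"
      by (rule borel_measurable_continuous_onI[OF fc] borel_measurable_continuous_onI[OF \<beta>c])+
    show ?thesis
    proof (rule integrable_bounded_support[OF _ C])
      show "G \<in> borel_measurable borel" unfolding G[abs_def] by measurable
      show "G w = 0" if "w \<notin> cball 0 R" for w
      proof -
        have "\<beta> w = 0" using that R by (intro \<beta>0) blast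
        then show ?thesis unfolding G by simp
      qed
    qed
  qed
  have cA: "continuous_on UNIV (\<lambda>w. cross2 \<tau> (w - z))" unfolding oH by (intro continuous_intros)
  have cB: "continuous_on UNIV (\<lambda>w. \<tau> \<bullet> (w - z))" by (intro continuous_intros)
  have iA: "integrable lborel A" by (rule int[OF cA A_def])
  have iB: "integrable lborel B" by (rule int[OF cB B_def])
  have Apos: "integral\<^sup>L lborel A > 0"
  proof (rule integral_pos_open[OF iA])
    have \<beta>nn: "\<beta> w \<ge> 0" for w by (simp add: \<beta>_def bump_nonneg)
    show "A w \<ge> 0" for w
      unfolding A_def oH using \<beta>nn[of w] by (auto simp: H_def indicator_def mult_nonneg_nonpos)
    show "open (H \<inter> ball z r)" by (intro open_Int H_open open_ball)
    have "orient y x z = 0" using z orient_swap[of y x z] by simp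
    then obtain w where "w \<in> ball z r" "orient y x w > 0" using orient_pos_near[of y x z r] xy r by metis
    then show "H \<inter> ball z r \<noteq> {}" using orient_swap[of y x w] by (auto simp: H_def)
    show "A w > 0" if "w \<in> H \<inter> ball z r" for w
    proof -
      have "\<beta> w > 0" using bump_pos_iff[OF r] that by (simp add: \<beta>_def)
      then show ?thesis unfolding A_def oH using that by (auto simp: H_def mult_pos_neg)
    qed
  qed
  have B0: "integral\<^sup>L lborel B = 0"
  proof -
    obtain M where M: "\<And>w h. \<bar>\<psi> (w + h *\<^sub>R \<tau>) - \<psi> w\<bar> \<le> M * \<bar>h\<bar>" using test_function_lipschitz[OF \<psi>] by blast
    let ?F = "\<lambda>w. indicator H w * \<psi> w"
    \<comment> \<open>The half plane is invariant under translation along its boundary, so the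
      cut-off function is still differentiable in direction \<tau> and
      \<open>integral_directional_derivative_zero\<close> applies to \<open>B\<close>.\<close>
    have inv: "indicator H (w + h *\<^sub>R \<tau>) = (indicator H w :: real)" for w h
      using orient_add_scaleR[of x y w h \<tau>] by (simp add: H_def indicator_def \<tau>_def[symmetric])
    have F_diff: "?F (w + h *\<^sub>R \<tau>) - ?F w = indicator H w * (\<psi> (w + h *\<^sub>R \<tau>) - \<psi> w)" for w h
      unfolding inv by (simp add: algebra_simps)
    have psi0: "\<psi> w = 0" if "w \<notin> cball z r" for w
      using bump_zero[OF r, of w z 0] that by (simp add: \<psi>_def)
    obtain C where C: "\<And>w. \<bar>\<psi> w\<bar> \<le> C"
      using continuous_support_bound[OF test_function_continuous[OF \<psi>] compact_cball psi0] by blast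
    obtain CB where CB: "\<And>w. \<bar>B w\<bar> \<le> CB" using bnd[OF cB B_def] by blast
    show ?thesis
    proof (rule integral_directional_derivative_zero[where F = ?F and e = \<tau>])
      have "\<psi> \<in> borel_measurable borel" using test_function_continuous[OF \<psi>] borel_measurable_continuous_onI by blast
      then show "?F \<in> borel_measurable borel" by measurable
      have "C \<ge> 0" using C[of 0] by linarith
      then show "\<bar>?F w\<bar> \<le> C" for w using C[of w] by (auto simp: indicator_def)
      show "?F w = 0" if "w \<notin> cball 0 R" for w
      proof -
        have "\<psi> w = 0" using that R by (intro psi0) blast
        then show ?thesis by simp
      qed
      show "\<bar>?F (w + h *\<^sub>R \<tau>) - ?F w\<bar> \<le> M * \<bar>h\<bar>" for w h
      proof -
        have "\<bar>indicator H w * (\<psi> (w + h *\<^sub>R \<tau>) - \<psi> w)\<bar> \<le> \<bar>\<psi> (w + h *\<^sub>R \<tau>) - \<psi> w\<bar>"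
          by (simp add: indicator_def)
        then show ?thesis unfolding F_diff using M[of w h] by linarith
      qed
      show "B \<in> borel_measurable borel" using iB by simp
      show "((\<lambda>h. (?F (w + h *\<^sub>R \<tau>) - ?F w) / h) \<longlongrightarrow> B w) (at 0)" for w
      proof -
        have "((\<lambda>h. indicator H w * ((\<psi> (w + h *\<^sub>R \<tau>) - \<psi> w) / h)) \<longlongrightarrow>
           indicator H w * (\<tau> $ 1 * partial_deriv 1 \<psi> w + \<tau> $ 2 * partial_deriv 2 \<psi> w)) (at 0)"
          by (intro tendsto_mult tendsto_const test_function_quotient_tendsto[OF \<psi>])
        moreover have "indicator H w * (\<tau> $ 1 * partial_deriv 1 \<psi> w + \<tau> $ 2 * partial_deriv 2 \<psi> w) = B w"
          unfolding pd B_def by (simp add: inner_vec_def sum_2 algebra_simps)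
        ultimately show ?thesis unfolding F_diff by simp
      qed
    qed
  qed
  \<comment> \<open>The vector \<open>d\<close>, times \<tau> \<bullet> \<tau>, is split into
    components along \<tau> and normal to it. The tangential component of \<open>d\<close> pairs
    with \<open>A\<close>, the normal one with \<open>B\<close>.\<close>
  have decomp: "(\<tau> \<bullet> \<tau>) * (indicator H w * (d $ 1 * partial_deriv 2 \<psi> w - d $ 2 * partial_deriv 1 \<psi> w))
     = (d \<bullet> \<tau>) * A w + cross2 d \<tau> * B w" for w
    unfolding pd A_def B_def cross2_def inner_vec_def sum_2 by (simp add: algebra_simps)
  have "0 = (\<tau> \<bullet> \<tau>) * integral\<^sup>L lborel (\<lambda>w. indicator H w * (d $ 1 * partial_deriv 2 \<psi> w - d $ 2 * partial_deriv 1 \<psi> w))"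
    using zero by simp
  also have "\<dots> = integral\<^sup>L lborel (\<lambda>w. (d \<bullet> \<tau>) * A w + cross2 d \<tau> * B w)"
    unfolding decomp[symmetric] by (rule integral_mult_right_zero[symmetric])
  also have "\<dots> = integral\<^sup>L lborel (\<lambda>w. (d \<bullet> \<tau>) * A w) + integral\<^sup>L lborel (\<lambda>w. cross2 d \<tau> * B w)"
    by (intro Bochner_Integration.integral_add integrable_mult_right iA iB)
  also have "\<dots> = (d \<bullet> \<tau>) * integral\<^sup>L lborel A" using B0 by simp
  finally show ?thesis using Apos by (simp add: \<tau>_def)
qed

lemma partial_deriv_bump_zero:
  "r > 0 \<Longrightarrow> w \<notin> ball z r \<Longrightarrow> partial_deriv i (bump m z r) w = 0"
  by (simp add: partial_deriv_bump bump_zero)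

lemma test_function_measurable:
  assumes "\<psi> \<in> test_functions \<Omega>"
  shows "\<psi> \<in> borel_measurable borel" "partial_deriv i \<psi> \<in> borel_measurable borel"
  by (rule borel_measurable_continuous_onI[OF test_function_continuous[OF assms]]
      borel_measurable_continuous_onI[OF test_function_partial_continuous[OF assms]])+

lemma weak_curl_integrand_measurable:
  fixes v :: "real^2 \<Rightarrow> real^2"
  assumes "v \<in> borel_measurable (lebesgue_on \<Omega>)" "\<psi> \<in> test_functions \<Omega>"
  shows "(\<lambda>x. v x $ 1 * partial_deriv 2 \<psi> x - v x $ 2 * partial_deriv 1 \<psi> x) \<in> borel_measurable (lebesgue_on \<Omega>)"
proof -
  have nth: "(\<lambda>x::real^2. x $ i) \<in> borel_measurable borel" for i
    by (intro borel_measurable_continuous_onI continuous_intros)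
  have v: "(\<lambda>x. v x $ i) \<in> borel_measurable (lebesgue_on \<Omega>)" for i
    by (rule measurable_compose[OF assms(1) nth])
  have p: "partial_deriv i \<psi> \<in> borel_measurable (lebesgue_on \<Omega>)" for i
    using test_function_measurable(2)[OF assms(2)]
    by (intro measurable_restrict_space1 measurable_completion) simp
  show ?thesis
    by (intro borel_measurable_diff borel_measurable_times v p)
qed

text \<open>The weak curl condition for a single bump, with the integrand replaced by a Borel
  function \<open>D\<close> that has to be right only almost everywhere on the ball. It is applied
  to balls inside one triangle and to balls centred on an interior edge.\<close>

lemma weak_curl_bump:
  assumes \<Omega>: "open \<Omega>" and v: "v \<in> borel_measurable (lebesgue_on \<Omega>)"
    and wc: "has_weak_curl \<Omega> v (\<lambda>x. k)" and r: "r > 0" "cball z r \<subseteq> \<Omega>"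
  defines "\<psi> \<equiv> bump 0 z r"
  assumes D: "D \<in> borel_measurable borel" "\<And>x. x \<notin> ball z r \<Longrightarrow> D x = 0"
    and AE: "AE x in lebesgue. x \<in> ball z r \<longrightarrow> v x $ 1 * partial_deriv 2 \<psi> x - v x $ 2 * partial_deriv 1 \<psi> x = D x"
  shows "integral\<^sup>L lborel D = k * integral\<^sup>L lborel \<psi>"
proof -
  have \<psi>: "\<psi> \<in> test_functions \<Omega>" unfolding \<psi>_def by (rule bump_test_function[OF r])
  have sub: "ball z r \<subseteq> \<Omega>" using r(2) ball_subset_cball by blast
  have "integral\<^sup>L lborel D = (LINT x|lebesgue_on \<Omega>. v x $ 1 * partial_deriv 2 \<psi> x - v x $ 2 * partial_deriv 1 \<psi> x)"
  proof (rule integral_lebesgue_on_eq_lborel[symmetric, OF \<Omega> weak_curl_integrand_measurable[OF v \<psi>] D(1)])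
    show "D x = 0" if "x \<notin> \<Omega>" for x using D(2) sub that by blast
    show "AE x in lebesgue. x \<in> \<Omega> \<longrightarrow> v x $ 1 * partial_deriv 2 \<psi> x - v x $ 2 * partial_deriv 1 \<psi> x = D x"
      using AE
    proof eventually_elim
      case (elim x)
      then show ?case
        using D(2)[of x] partial_deriv_bump_zero[OF r(1), of x z] by (cases "x \<in> ball z r") (auto simp: \<psi>_def)
    qed
  qed
  also have "\<dots> = (LINT x|lebesgue_on \<Omega>. k * \<psi> x)"
    using wc \<psi> by (simp add: has_weak_curl_def)
  also have "\<dots> = integral\<^sup>L lborel (\<lambda>x. k * \<psi> x)"
  proof (rule integral_lebesgue_on_eq_lborel[OF \<Omega>])
    show m: "(\<lambda>x. k * \<psi> x) \<in> borel_measurable borel" using test_function_measurable(1)[OF \<psi>] by simp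
    show "(\<lambda>x. k * \<psi> x) \<in> borel_measurable (lebesgue_on \<Omega>)"
      using m by (intro measurable_restrict_space1 measurable_completion) simp
    show "k * \<psi> x = 0" if "x \<notin> \<Omega>" for x
    proof -
      have "x \<notin> ball z r" using sub that by blast
      then show ?thesis using bump_zero[OF r(1)] by (simp add: \<psi>_def)
    qed
  qed simp
  also have "\<dots> = k * integral\<^sup>L lborel \<psi>" by simp
  finally show ?thesis .
qed

lemma integral_bump_pos:
  assumes "r > 0"
  shows "integral\<^sup>L lborel (bump m z r) > 0"
proof (rule integral_pos_open)
  have "continuous_on UNIV (bump m z r)" using C_k_bump[of 0] by simp
  then show "integrable lborel (bump m z r)"
  proof (rule continuous_support_integrable[OF _ compact_cball])
    show "bump m z r w = 0" if "w \<notin> cball z r" for w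
      using that by (intro bump_zero[OF assms]) auto
  qed
  show "open (ball z r)" "ball z r \<noteq> {}" using assms by auto
qed (use bump_nonneg bump_pos_iff[OF assms] in auto)

lemma AE_restricts_to:
  assumes "K \<in> sets lebesgue"
  shows "restricts_to v K q \<longleftrightarrow> (AE x in lebesgue. x \<in> K \<longrightarrow> v x = q x)"
  using assms by (simp add: restricts_to_def AE_restrict_space_iff)

section \<open>Structure of \<open>V_h\<close>: one curl and tangential continuity\<close>

context polygon_mesh
begin

lemma triangle_lebesgue: "K \<in> T \<Longrightarrow> K \<in> sets lebesgue"
  using compact_triangle compact_imp_closed by (metis borel_closed sets_completionI_sets sets_lborel)

text \<open>The coefficient is \<open>- k / 2\<close> because a field with coefficient
  \<open>b\<close> has curl \<open>- 2 * b\<close>. With equal coefficients on both sides of an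
  edge, the jump across it is the constant vector \<open>a K' - a K\<close>.\<close>

lemma V_h_pieces:
  assumes "v \<in> V_h P T"
  obtains k a where "\<And>K. K \<in> T \<Longrightarrow> restricts_to v K (\<lambda>x. a K + (- k / 2) *\<^sub>R vector [x $ 2, - (x $ 1)])"
    and "\<And>K K' x y. \<lbrakk>K \<in> T; K' \<in> T; (x,y) \<in> oedges K; (y,x) \<in> oedges K'\<rbrakk> \<Longrightarrow> (a K' - a K) \<bullet> (y - x) = 0"
proof -
  let ?\<Omega> = "interior P"
  let ?rot = "\<lambda>x::real^2. vector [x $ 2, - (x $ 1)] :: real^2"
  have vm: "v \<in> borel_measurable (lebesgue_on ?\<Omega>)"
    using assms by (auto simp: V_h_def H_curl_def square_integrable_on_def)
  obtain k where wc: "has_weak_curl ?\<Omega> v (\<lambda>x. k)" using assms by (auto simp: V_h_def)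
  have "\<forall>K\<in>T. \<exists>ab. restricts_to v K (\<lambda>x. fst ab + snd ab *\<^sub>R ?rot x)"
  proof
    fix K assume "K \<in> T"
    then obtain q where "q \<in> nedelec" "restricts_to v K q" using assms by (auto simp: V_h_def)
    then obtain a b where "restricts_to v K (\<lambda>x. a + b *\<^sub>R ?rot x)" by (auto simp: nedelec_def)
    then show "\<exists>ab. restricts_to v K (\<lambda>x. fst ab + snd ab *\<^sub>R ?rot x)" by (intro exI[of _ "(a,b)"]) simp
  qed
  from bchoice[OF this] obtain ab
    where "\<forall>K\<in>T. restricts_to v K (\<lambda>x. fst (ab K) + snd (ab K) *\<^sub>R ?rot x)" ..
  then have q: "\<And>K. K \<in> T \<Longrightarrow> restricts_to v K (\<lambda>x. (fst \<circ> ab) K + (snd \<circ> ab) K *\<^sub>R ?rot x)" by simp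
  define a where "a = fst \<circ> ab"
  define b where "b = snd \<circ> ab"
  have AE: "AE x in lebesgue. x \<in> K \<longrightarrow> v x = a K + b K *\<^sub>R ?rot x" if "K \<in> T" for K
    using q[OF that] AE_restricts_to[OF triangle_lebesgue[OF that]] by (simp add: a_def b_def)
  have measD: "(\<lambda>x. (c + d *\<^sub>R ?rot x) $ 1 * partial_deriv 2 \<psi> x - (c + d *\<^sub>R ?rot x) $ 2 * partial_deriv 1 \<psi> x) \<in> borel_measurable borel"
    if "\<psi> \<in> test_functions \<Omega>" for c d \<psi> \<Omega>
    by (simp, intro borel_measurable_continuous_onI continuous_intros test_function_partial_continuous[OF that])
  \<comment> \<open>A bump supported in the interior of \<open>K\<close> compares the weak curl with
    the classical curl of the polynomial on \<open>K\<close>.\<close>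
  have b: "b K = - k / 2" if K: "K \<in> T" for K
  proof -
    obtain z where "z \<in> interior K" using interior_triangle_nonempty[OF K] by blast
    then obtain r where r: "r > 0" "cball z r \<subseteq> interior K" using open_contains_cball[of "interior K"] by auto
    then have r': "cball z r \<subseteq> ?\<Omega>" using interior_mono[OF triangle_subset_P[OF K]] by blast
    let ?\<psi> = "bump 0 z r"
    have \<psi>: "?\<psi> \<in> test_functions ?\<Omega>" by (rule bump_test_function[OF r(1) r'])
    let ?D = "\<lambda>x. (a K + b K *\<^sub>R ?rot x) $ 1 * partial_deriv 2 ?\<psi> x - (a K + b K *\<^sub>R ?rot x) $ 2 * partial_deriv 1 ?\<psi> x"
    have "integral\<^sup>L lborel ?D = k * integral\<^sup>L lborel ?\<psi>"
    proof (rule weak_curl_bump[OF open_interior vm wc r(1) r' measD[OF \<psi>]])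
      show "?D x = 0" if "x \<notin> ball z r" for x by (simp add: partial_deriv_bump_zero[OF r(1) that])
      show "AE x in lebesgue. x \<in> ball z r \<longrightarrow> v x $ 1 * partial_deriv 2 ?\<psi> x - v x $ 2 * partial_deriv 1 ?\<psi> x = ?D x"
        using AE[OF K]
      proof eventually_elim
        case (elim x)
        then show ?case using r(2) interior_subset[of K] ball_subset_cball[of z r] by (simp add: subset_iff)
      qed
    qed
    moreover have "integral\<^sup>L lborel ?D = - 2 * b K * integral\<^sup>L lborel ?\<psi>"
      by (rule nedelec_weak_curl[OF \<psi>]) simp
    ultimately have "k * integral\<^sup>L lborel ?\<psi> = (- 2 * b K) * integral\<^sup>L lborel ?\<psi>" by linarith
    then have "k = - 2 * b K"
      using integral_bump_pos[OF r(1), of 0 z] by (metis mult_right_cancel less_irrefl)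
    then show ?thesis by simp
  qed
  have "(a K' - a K) \<bullet> (y - x) = 0"
    if K: "K \<in> T" "K' \<in> T" and xy: "(x,y) \<in> oedges K" "(y,x) \<in> oedges K'" for K K' x y
  proof -
    define z where "z = midpoint x y"
    define d where "d = a K' - a K"
    have xyn: "x \<noteq> y" using oedge_vertices[OF K(1) xy(1)] by simp
    have zs: "z \<in> open_segment x y" "z \<in> open_segment y x" using xyn by (simp_all add: z_def open_segment_commute)
    obtain w where "orient x y w > 0" using xy(1) by (auto simp: oedges_def)
    then have z0: "orient x y z = 0" using orient_open_segment(1)[OF zs(1)] by blast
    obtain r1 where r1: "r1 > 0" "\<And>w. w \<in> ball z r1 \<Longrightarrow> w \<in> K \<longleftrightarrow> orient x y w \<ge> 0"
      using half_disc[OF xy(1) zs(1)] by metis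
    obtain r2 where r2: "r2 > 0" "\<And>w. w \<in> ball z r2 \<Longrightarrow> w \<in> K' \<longleftrightarrow> orient y x w \<ge> 0"
      using half_disc[OF xy(2) zs(2)] by metis
    have "z \<in> ?\<Omega>" using opposite_interior_P[OF K xy] zs(1) by blast
    then obtain r3 where r3: "r3 > 0" "cball z r3 \<subseteq> ?\<Omega>" using open_contains_cball[of ?\<Omega>] by auto
    define r where "r = min r1 (min r2 r3)"
    have r: "r > 0" "r \<le> r1" "r \<le> r2" "cball z r \<subseteq> ?\<Omega>"
      using r1(1) r2(1) r3 by (auto simp: r_def subset_iff)
    let ?\<psi> = "bump 0 z r"
    have \<psi>: "?\<psi> \<in> test_functions ?\<Omega>" by (rule bump_test_function[OF r(1,4)])
    define H where "H = {w. orient x y w < 0}"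
    have H_open: "open H" unfolding H_def by (intro open_Collect_less continuous_intros)
    \<comment> \<open>\<open>D1\<close> stems from the polynomial of \<open>K\<close> continued
      across the edge, \<open>D2\<close> from the jump \<open>d\<close> on the side \<open>H\<close>
      of \<open>K'\<close>. The first already accounts for the whole curl \<open>k\<close>, so the
      integral of \<open>D2\<close> must vanish.\<close>
    define D1 where "D1 x = (a K + b K *\<^sub>R ?rot x) $ 1 * partial_deriv 2 ?\<psi> x - (a K + b K *\<^sub>R ?rot x) $ 2 * partial_deriv 1 ?\<psi> x" for x
    define D2 where "D2 x = indicator H x * (d $ 1 * partial_deriv 2 ?\<psi> x - d $ 2 * partial_deriv 1 ?\<psi> x)" for x
    have m1: "D1 \<in> borel_measurable borel" unfolding D1_def[abs_def] by (rule measD[OF \<psi>])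
    have m2: "D2 \<in> borel_measurable borel"
      unfolding D2_def[abs_def]
      using test_function_measurable(2)[OF \<psi>] H_open
      by (intro borel_measurable_times borel_measurable_diff borel_measurable_indicator borel_measurable_const) auto
    have D0: "D1 w = 0" "D2 w = 0" if "w \<notin> ball z r" for w
      by (simp_all add: D1_def D2_def partial_deriv_bump_zero[OF r(1) that])
    have ID1: "integral\<^sup>L lborel D1 = k * integral\<^sup>L lborel ?\<psi>"
    proof -
      have "integral\<^sup>L lborel D1 = - 2 * b K * integral\<^sup>L lborel ?\<psi>"
        unfolding D1_def by (rule nedelec_weak_curl[OF \<psi>]) simp
      then show ?thesis using b[OF K(1)] by simp
    qed
    let ?G = "\<lambda>w. d $ 1 * partial_deriv 2 ?\<psi> w - d $ 2 * partial_deriv 1 ?\<psi> w"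
    have Gc: "continuous_on UNIV ?G"
      by (intro continuous_intros test_function_partial_continuous[OF \<psi>])
    have G0: "?G w = 0" if "w \<notin> cball z r" for w
      using that partial_deriv_bump_zero[OF r(1), of w z] by simp
    obtain C where C: "\<And>w. \<bar>?G w\<bar> \<le> C"
      using continuous_support_bound[OF Gc compact_cball G0] by blast
    obtain R where R: "cball z r \<subseteq> cball 0 R" using bounded_support_cball[OF compact_cball] .
    have i1: "integrable lborel D1"
    proof (rule continuous_support_integrable[OF _ compact_cball])
      show "continuous_on UNIV D1"
        unfolding D1_def[abs_def] by (simp, intro continuous_intros test_function_partial_continuous[OF \<psi>])
      show "D1 w = 0" if "w \<notin> cball z r" for w using D0(1)[of w] that by simp
    qed
    have i2: "integrable lborel D2"
    proof (rule integrable_bounded_support[OF m2])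
      have "C \<ge> 0" using C[of 0] by linarith
      then show "\<bar>D2 w\<bar> \<le> C" for w using C[of w] unfolding D2_def by (auto simp: indicator_def)
      show "D2 w = 0" if "w \<notin> cball 0 R" for w
        using that R ball_subset_cball[of z r] by (intro D0(2)) blast
    qed
    have "integral\<^sup>L lborel (\<lambda>w. D1 w + D2 w) = k * integral\<^sup>L lborel ?\<psi>"
    proof (rule weak_curl_bump[OF open_interior vm wc r(1,4)])
      show "(\<lambda>w. D1 w + D2 w) \<in> borel_measurable borel" using m1 m2 by simp
      show "D1 w + D2 w = 0" if "w \<notin> ball z r" for w using D0[OF that] by simp
      show "AE w in lebesgue. w \<in> ball z r \<longrightarrow> v w $ 1 * partial_deriv 2 ?\<psi> w - v w $ 2 * partial_deriv 1 ?\<psi> w = D1 w + D2 w"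
        using AE[OF K(1)] AE[OF K(2)]
      proof eventually_elim
        case (elim w)
        show ?case
        proof
          assume w: "w \<in> ball z r"
          show "v w $ 1 * partial_deriv 2 ?\<psi> w - v w $ 2 * partial_deriv 1 ?\<psi> w = D1 w + D2 w"
          proof (cases "orient x y w < 0")
            case True
            then have "w \<in> K'" using r2(2)[of w] w r(3) orient_swap[of y x w] by simp
            then have "v w = a K + b K *\<^sub>R ?rot w + d" using elim(2) b K by (simp add: d_def)
            then show ?thesis using True by (simp add: D1_def D2_def H_def algebra_simps)
          next
            case False
            then have "w \<in> K" using r1(2)[of w] w r(2) by simp
            then have "v w = a K + b K *\<^sub>R ?rot w" using elim(1) by simp
            then show ?thesis using False by (simp add: D1_def D2_def H_def)
          qed
        qed
      qed
    qed
    then have "integral\<^sup>L lborel D2 = 0"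
      using Bochner_Integration.integral_add[OF i1 i2] ID1 by simp
    then show ?thesis
      using half_plane_jump[OF xyn z0 r(1), of d] unfolding D2_def[abs_def] H_def d_def by blast
  qed
  moreover have "restricts_to v K (\<lambda>x. a K + (- k / 2) *\<^sub>R ?rot x)" if "K \<in> T" for K
    using q[OF that] b[OF that] by (simp add: a_def b_def)
  ultimately show ?thesis using that by blast
qed

end

text \<open>Summation by parts: forward differences on \<open>\<phi>\<close> are adjoint to backward differences on \<open>\<psi>\<close>,
  and the latter commute. No second derivatives of \<open>\<psi>\<close> are needed.\<close>

lemma integral_mixed_differences_zero:
  fixes \<phi> \<psi> :: "real^2 \<Rightarrow> real"
  assumes m: "\<phi> \<in> borel_measurable borel" "\<psi> \<in> borel_measurable borel"
    and int: "\<And>s t. integrable lborel (\<lambda>x. \<phi> (x + s) * \<psi> (x + t))"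
  shows "integral\<^sup>L lborel (\<lambda>x. (\<phi> (x + a) - \<phi> x) * (\<psi> x - \<psi> (x - b)) - (\<phi> (x + b) - \<phi> x) * (\<psi> x - \<psi> (x - a))) = 0"
proof -
  define E where "E s t x = \<phi> (x + s) * \<psi> (x + t)" for s t x
  have iE: "integrable lborel (E s t)" for s t unfolding E_def[abs_def] by (rule int)
  have shift: "integral\<^sup>L lborel (E (s + u) (t + u)) = integral\<^sup>L lborel (E s t)" for s t u
  proof -
    have "E s t \<in> borel_measurable borel" using iE[of s t] by simp
    moreover have "E (s + u) (t + u) = (\<lambda>x. E s t (x + u))"
      by (simp add: E_def fun_eq_iff algebra_simps)
    ultimately show ?thesis using integral_lborel_shift[of "E s t" u] by simp
  qed
  \<comment> \<open>The two terms \<open>E 0 0\<close> cancel, and each remaining bracket is the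
    difference of two translates.\<close>
  have eq: "(\<phi> (x + a) - \<phi> x) * (\<psi> x - \<psi> (x - b)) - (\<phi> (x + b) - \<phi> x) * (\<psi> x - \<psi> (x - a))
    = (E a 0 x - E 0 (- a) x) - (E b 0 x - E 0 (- b) x) - (E a (- b) x - E b (- a) x)" for x
    by (simp add: E_def algebra_simps)
  have "integral\<^sup>L lborel (E a 0) = integral\<^sup>L lborel (E 0 (- a))"
    using shift[of 0 a "- a"] by simp
  moreover have "integral\<^sup>L lborel (E b 0) = integral\<^sup>L lborel (E 0 (- b))"
    using shift[of 0 b "- b"] by simp
  moreover have "integral\<^sup>L lborel (E a (- b)) = integral\<^sup>L lborel (E b (- a))"
    using shift[of a b "- b"] shift[of b a "- a"] by (simp add: add.commute)
  ultimately show ?thesis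
    unfolding eq by (simp add: iE)
qed

section \<open>Weak curl of the gradient of a continuous piecewise affine function\<close>

context polygon_mesh
begin

lemma compact_P: "compact P"
  using finite_T compact_triangle Union_T by (metis compact_Union)

lemma AE_interior_triangle: "AE x in lebesgue. x \<in> P \<longrightarrow> (\<exists>K\<in>T. x \<in> interior K)"
proof -
  have "negligible (\<Union>K\<in>T. frontier K)"
    using finite_T convex_triangle negligible_convex_frontier by (intro negligible_Union) auto
  then have "(\<Union>K\<in>T. frontier K) \<in> null_sets lebesgue" by (simp add: negligible_iff_null_sets)
  then have "AE x in lebesgue. x \<notin> (\<Union>K\<in>T. frontier K)" by (rule AE_not_in)
  then show ?thesis
  proof eventually_elim
    case (elim x)
    show ?case
    proof
      assume "x \<in> P"
      then obtain K where "K \<in> T" "x \<in> K" using Union_T by blast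
      moreover from this have "x \<notin> frontier K" using elim by blast
      ultimately show "\<exists>K\<in>T. x \<in> interior K" using closure_subset[of K] by (auto simp: frontier_def)
    qed
  qed
qed

lemma sum_indicator_interior:
  fixes f :: "(real^2) set \<Rightarrow> 'a::real_vector"
  assumes "K \<in> T" "x \<in> interior K"
  shows "(\<Sum>L\<in>T. indicator (interior L) x *\<^sub>R f L) = f K"
proof -
  have "(\<Sum>L\<in>T. indicator (interior L) x *\<^sub>R f L) = (\<Sum>L\<in>T. if L = K then f L else 0)"
  proof (intro sum.cong refl)
    fix L assume "L \<in> T"
    then show "indicator (interior L) x *\<^sub>R f L = (if L = K then f L else 0)"
      using interior_disjoint[OF \<open>L \<in> T\<close> assms(1), of x] assms interior_subset[of K] by (auto simp: indicator_def)
  qed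
  then show ?thesis using finite_T assms(1) by simp
qed

text \<open>The mixed differences of \<open>integral_mixed_differences_zero\<close>, divided by the
  squared step length, tend to the integrand \<open>D\<close> off the triangle boundaries. They stay
  bounded because the potential is Lipschitz, and this is where its continuity across edges
  enters.\<close>

lemma affine_pieces_weak_curl:
  fixes g :: "(real^2) set \<Rightarrow> real^2" and s :: "(real^2) set \<Rightarrow> real"
  assumes cont: "\<And>K K' x. \<lbrakk>K \<in> T; K' \<in> T; x \<in> K; x \<in> K'\<rbrakk> \<Longrightarrow> g K \<bullet> x + s K = g K' \<bullet> x + s K'"
    and \<psi>: "\<psi> \<in> test_functions (interior P)"
  defines "D \<equiv> \<lambda>x. \<Sum>K\<in>T. indicator (interior K) x *\<^sub>R (g K $ 1 * partial_deriv 2 \<psi> x - g K $ 2 * partial_deriv 1 \<psi> x)"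
  shows "D \<in> borel_measurable borel" "integral\<^sup>L lborel D = 0"
proof -
  define S where "S = closure {x. \<psi> x \<noteq> 0}"
  have S: "compact S" "S \<subseteq> interior P" unfolding S_def by (rule test_function_support[OF \<psi>])+
  have zero: "\<psi> x = 0" "partial_deriv i \<psi> x = 0" if "x \<notin> S" for x i
    by (rule test_function_zero[OF \<psi> that[unfolded S_def]])+
  note pm = test_function_measurable[OF \<psi>]
  show Dm: "D \<in> borel_measurable borel"
    unfolding D_def
  proof (intro borel_measurable_sum borel_measurable_scaleR borel_measurable_indicator)
    show "interior K \<in> sets borel" for K :: "(real^2) set" by simp
    show "(\<lambda>x. g K $ 1 * partial_deriv 2 \<psi> x - g K $ 2 * partial_deriv 1 \<psi> x) \<in> borel_measurable borel" for K
      by (intro borel_measurable_diff borel_measurable_times borel_measurable_const pm)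
  qed
  \<comment> \<open>The potential, glued from the affine pieces; by \<open>cont\<close> the choice
    of the triangle is immaterial. Its possible jump at the boundary of \<open>P\<close> does no
    harm, since \<psi> vanishes near it.\<close>
  define \<phi> where "\<phi> x = (if x \<in> P then (let K = (SOME K. K \<in> T \<and> x \<in> K) in g K \<bullet> x + s K) else 0)" for x
  have \<phi>: "\<phi> x = g K \<bullet> x + s K" if "K \<in> T" "x \<in> K" for x K
  proof -
    let ?L = "SOME K. K \<in> T \<and> x \<in> K"
    have "?L \<in> T \<and> x \<in> ?L" by (rule someI[of _ K]) (use that in blast)
    moreover have "x \<in> P" using that Union_T by blast
    ultimately show ?thesis using cont[of ?L K x] that by (simp add: \<phi>_def Let_def)
  qed
  have \<phi>cont: "continuous_on P \<phi>"
  proof -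
    have "continuous_on (\<Union>K\<in>T. K) \<phi>"
    proof (rule continuous_on_closed_Union[OF finite_T])
      fix K assume K: "K \<in> T"
      show "closed K" using compact_triangle[OF K] compact_imp_closed by blast
      have "continuous_on K (\<lambda>x. g K \<bullet> x + s K)" by (intro continuous_intros)
      then show "continuous_on K \<phi>" using \<phi>[OF K] by (simp cong: continuous_on_cong)
    qed
    then show ?thesis using Union_T by simp
  qed
  have \<phi>m: "\<phi> \<in> borel_measurable borel"
  proof -
    have Pb: "P \<in> sets borel" by (rule borel_closed[OF compact_imp_closed[OF compact_P]])
    have "(\<lambda>x. if x \<in> P then \<phi> x else 0) \<in> borel_measurable borel"
      by (rule borel_measurable_continuous_on_if[OF Pb \<phi>cont continuous_on_const])
    moreover have "(\<lambda>x. if x \<in> P then \<phi> x else 0) = \<phi>" by (intro ext) (simp add: \<phi>_def)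
    ultimately show ?thesis by simp
  qed
  obtain C\<phi> where C\<phi>: "\<And>x. \<bar>\<phi> x\<bar> \<le> C\<phi>"
  proof -
    have "bounded (\<phi> ` P)" by (rule compact_imp_bounded[OF compact_continuous_image[OF \<phi>cont compact_P]])
    then obtain C where C: "\<And>x. x \<in> P \<Longrightarrow> norm (\<phi> x) \<le> C" unfolding bounded_iff by blast
    have "\<bar>\<phi> x\<bar> \<le> max C 0" for x
    proof (cases "x \<in> P")
      case True
      then show ?thesis using C[OF True] by simp
    next
      case False
      then have "\<phi> x = 0" by (simp add: \<phi>_def)
      then show ?thesis by simp
    qed
    then show ?thesis using that by blast
  qed
  obtain C\<psi> where C\<psi>: "\<And>x. \<bar>\<psi> x\<bar> \<le> C\<psi>"
    using continuous_support_bound[OF test_function_continuous[OF \<psi>] S(1) zero(1)] by blast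
  obtain R where R: "S \<subseteq> cball 0 R" using bounded_support_cball[OF S(1)] .
  have int: "integrable lborel (\<lambda>x. \<phi> (x + a) * \<psi> (x + b))" for a b
  proof (rule integrable_bounded_support)
    have sh: "(\<lambda>x. F (x + c)) \<in> borel_measurable borel" if "F \<in> borel_measurable borel" for F :: "real^2 \<Rightarrow> real" and c
      using measurable_compose[OF _ that, of "\<lambda>x. x + c" borel] by simp
    show "(\<lambda>x. \<phi> (x + a) * \<psi> (x + b)) \<in> borel_measurable borel"
      by (intro borel_measurable_times sh \<phi>m pm)
    show "\<bar>\<phi> (x + a) * \<psi> (x + b)\<bar> \<le> C\<phi> * C\<psi>" for x
      unfolding abs_mult using C\<phi>[of "x + a"] C\<psi>[of "x + b"] by (intro mult_mono) auto
    show "\<phi> (x + a) * \<psi> (x + b) = 0" if "x \<notin> cball 0 (R + norm b)" for x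
    proof -
      have "norm (x + b) \<ge> norm x - norm b" by (metis norm_diff_ineq)
      then have "x + b \<notin> cball 0 R" using that by simp
      then have "\<psi> (x + b) = 0" using R by (intro zero) blast
      then show ?thesis by simp
    qed
  qed
  \<comment> \<open>A margin around the support of \<psi> in which difference quotients of \<phi>
    never leave \<open>P\<close>.\<close>
  obtain \<delta> where \<delta>: "\<delta> > 0" "(\<Union>x\<in>S. ball x \<delta>) \<subseteq> interior P"
    using compact_subset_open_imp_ball_epsilon_subset[OF S(1) open_interior S(2)] by blast
  define M where "M = (\<Sum>K\<in>T. norm (g K))"
  have M0: "M \<ge> 0" by (simp add: M_def sum_nonneg)
  \<comment> \<open>A segment may pass through the triangles in any pattern. Its preimages under the
    parametrisation form a finite closed cover of an interval, and a common Lipschitz constant on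
    the parts of such a cover is one for the interval.\<close>
  have \<phi>lip: "\<bar>\<phi> (x + h *\<^sub>R e) - \<phi> x\<bar> \<le> M * h"
    if h: "h \<ge> 0" and e: "norm e = 1" and seg: "\<And>t. t \<in> {0..h} \<Longrightarrow> x + t *\<^sub>R e \<in> P" for x h e
  proof -
    have "M-lipschitz_on {0..h} (\<lambda>t. \<phi> (x + t *\<^sub>R e))"
    proof (rule lipschitz_on_closed_Union[where I = T and U = "\<lambda>K. {0..h} \<inter> (\<lambda>t. x + t *\<^sub>R e) -` K"])
      fix K assume K: "K \<in> T"
      show "M-lipschitz_on ({0..h} \<inter> (\<lambda>t. x + t *\<^sub>R e) -` K) (\<lambda>t. \<phi> (x + t *\<^sub>R e))"
      proof (rule lipschitz_onI[OF _ M0])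
        fix t u assume tu: "t \<in> {0..h} \<inter> (\<lambda>t. x + t *\<^sub>R e) -` K" "u \<in> {0..h} \<inter> (\<lambda>t. x + t *\<^sub>R e) -` K"
        have "\<phi> (x + t *\<^sub>R e) - \<phi> (x + u *\<^sub>R e) = (t - u) * (g K \<bullet> e)"
          using tu \<phi>[OF K, of "x + t *\<^sub>R e"] \<phi>[OF K, of "x + u *\<^sub>R e"]
          by (simp add: inner_add_right algebra_simps)
        moreover have "\<bar>g K \<bullet> e\<bar> \<le> M"
        proof -
          have "\<bar>g K \<bullet> e\<bar> \<le> norm (g K)" using Cauchy_Schwarz_ineq2[of "g K" e] e by simp
          also have "\<dots> \<le> M" unfolding M_def using finite_T K by (intro member_le_sum) auto
          finally show ?thesis .
        qed
        ultimately show "dist (\<phi> (x + t *\<^sub>R e)) (\<phi> (x + u *\<^sub>R e)) \<le> M * dist t u"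
          using mult_left_mono[of "\<bar>g K \<bullet> e\<bar>" M "\<bar>t - u\<bar>"]
          by (simp add: dist_real_def abs_mult mult.commute[of M])
      qed
      show "closed ({0..h} \<inter> (\<lambda>t. x + t *\<^sub>R e) -` K)"
        using compact_triangle[OF K] compact_imp_closed
        by (intro continuous_closed_preimage continuous_intros) auto
    next
      show "{0..h} \<subseteq> (\<Union>K\<in>T. {0..h} \<inter> (\<lambda>t. x + t *\<^sub>R e) -` K)"
      proof
        fix t assume t: "t \<in> {0..h}"
        then have "x + t *\<^sub>R e \<in> \<Union>T" using seg[OF t] Union_T by simp
        then show "t \<in> (\<Union>K\<in>T. {0..h} \<inter> (\<lambda>t. x + t *\<^sub>R e) -` K)" using t by auto
      qed
    qed (use finite_T M0 in simp_all)
    from lipschitz_onD[OF this, of h 0] show ?thesis using h by (simp add: dist_real_def)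
  qed
  define e1 where "e1 = (axis 1 1 :: real^2)"
  define e2 where "e2 = (axis 2 1 :: real^2)"
  have e: "norm e1 = 1" "norm e2 = 1" by (simp_all add: e1_def e2_def)
  obtain L1 where L1: "\<And>x h. \<bar>\<psi> (x + h *\<^sub>R e1) - \<psi> x\<bar> \<le> L1 * \<bar>h\<bar>" using test_function_lipschitz[OF \<psi>] by blast
  obtain L2 where L2: "\<And>x h. \<bar>\<psi> (x + h *\<^sub>R e2) - \<psi> x\<bar> \<le> L2 * \<bar>h\<bar>" using test_function_lipschitz[OF \<psi>] by blast
  \<comment> \<open>The factor 1/4 leaves room for two steps, one for \<phi> and one for \<psi>,
    within the margin \<delta>.\<close>
  define h where "h n = (\<delta> / 4) / real (Suc n)" for n
  have h: "h n > 0" "2 * h n < \<delta>" for n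
  proof -
    show "h n > 0" using \<delta>(1) by (simp add: h_def)
    have "h n \<le> \<delta> / 4" using \<delta>(1) unfolding h_def by (simp add: divide_le_eq mult_le_cancel_left1)
    then show "2 * h n < \<delta>" using \<delta>(1) by linarith
  qed
  \<comment> \<open>Either the difference of \<psi> vanishes, or one of its two arguments lies in
    the support; in that case the segment along which \<phi> is compared stays within the
    margin.\<close>
  have prod: "\<bar>(\<phi> (x + h n *\<^sub>R a) - \<phi> x) * (\<psi> x - \<psi> (x - h n *\<^sub>R b))\<bar> \<le> M * L * (h n)\<^sup>2"
    if a: "norm a = 1" and b: "norm b = 1" and L: "\<And>x h. \<bar>\<psi> (x + h *\<^sub>R b) - \<psi> x\<bar> \<le> L * \<bar>h\<bar>" for x n a b L
  proof (cases "x \<in> S \<or> x - h n *\<^sub>R b \<in> S")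
    case True
    have "x + t *\<^sub>R a \<in> P" if t: "t \<in> {0..h n}" for t
    proof -
      have "norm (t *\<^sub>R a + h n *\<^sub>R b) \<le> norm (t *\<^sub>R a) + norm (h n *\<^sub>R b)" by (rule norm_triangle_ineq)
      then have 1: "norm (t *\<^sub>R a + h n *\<^sub>R b) < \<delta>" using t h[of n] a b by simp
      have 2: "norm (t *\<^sub>R a) < \<delta>" using t h[of n] a by simp
      have "dist (x - h n *\<^sub>R b) (x + t *\<^sub>R a) = norm (t *\<^sub>R a + h n *\<^sub>R b)"
        unfolding dist_norm by (subst norm_minus_commute) (simp add: algebra_simps)
      moreover have "dist x (x + t *\<^sub>R a) = norm (t *\<^sub>R a)" by (simp add: dist_norm)
      ultimately have "x + t *\<^sub>R a \<in> ball x \<delta>" "x + t *\<^sub>R a \<in> ball (x - h n *\<^sub>R b) \<delta>" using 1 2 by simp_all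
      then have "x + t *\<^sub>R a \<in> interior P" using True \<delta>(2) by blast
      then show ?thesis using interior_subset by blast
    qed
    then have A: "\<bar>\<phi> (x + h n *\<^sub>R a) - \<phi> x\<bar> \<le> M * h n" using h(1)[of n] a by (intro \<phi>lip) auto
    have B: "\<bar>\<psi> x - \<psi> (x - h n *\<^sub>R b)\<bar> \<le> L * h n"
      using L[of x "- h n"] h(1)[of n] by (simp add: abs_minus_commute)
    have "\<bar>\<phi> (x + h n *\<^sub>R a) - \<phi> x\<bar> * \<bar>\<psi> x - \<psi> (x - h n *\<^sub>R b)\<bar> \<le> (M * h n) * (L * h n)"
      using mult_mono[OF A B] M0 h(1)[of n] by simp
    then show ?thesis unfolding abs_mult power2_eq_square by (simp only: mult_ac)
  next
    case False
    then have "\<psi> x = 0" "\<psi> (x - h n *\<^sub>R b) = 0" using zero by blast+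
    moreover have "L \<ge> 0" using L[of 0 1] by simp
    ultimately show ?thesis using M0 by simp
  qed
  define G where "G n x = ((\<phi> (x + h n *\<^sub>R e1) - \<phi> x) * (\<psi> x - \<psi> (x - h n *\<^sub>R e2))
    - (\<phi> (x + h n *\<^sub>R e2) - \<phi> x) * (\<psi> x - \<psi> (x - h n *\<^sub>R e1))) / (h n)\<^sup>2" for n x
  show "integral\<^sup>L lborel D = 0"
  proof (rule integral_limit_zero[OF _ Dm])
    show "G n \<in> borel_measurable borel" for n
    proof -
      have sh: "(\<lambda>x. F (x + c)) \<in> borel_measurable borel" "(\<lambda>x. F (x - c)) \<in> borel_measurable borel"
        if "F \<in> borel_measurable borel" for F :: "real^2 \<Rightarrow> real" and c
        using measurable_compose[OF _ that, of "\<lambda>x. x + c" borel] measurable_compose[OF _ that, of "\<lambda>x. x - c" borel] by simp_all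
      note sh\<phi> = sh(1)[OF \<phi>m] and sh\<psi> = sh(2)[OF pm(1)]
      show ?thesis
        unfolding G_def[abs_def]
        by (intro borel_measurable_divide borel_measurable_diff borel_measurable_times sh\<phi> sh\<psi> \<phi>m pm(1) borel_measurable_const)
    qed
    show "\<bar>G n x\<bar> \<le> M * L2 + M * L1" for n x
    proof -
      have "\<bar>(\<phi> (x + h n *\<^sub>R e1) - \<phi> x) * (\<psi> x - \<psi> (x - h n *\<^sub>R e2))
        - (\<phi> (x + h n *\<^sub>R e2) - \<phi> x) * (\<psi> x - \<psi> (x - h n *\<^sub>R e1))\<bar> \<le> (M * L2 + M * L1) * (h n)\<^sup>2"
        using prod[OF e L2, of x n] prod[OF e(2,1) L1, of x n] by (simp add: distrib_right)
      then show ?thesis using h(1)[of n] by (simp add: G_def abs_divide divide_le_eq)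
    qed
    show "G n x = 0" if "x \<notin> cball 0 (R + \<delta>)" for n x
    proof -
      have "\<psi> (x - h n *\<^sub>R b) = 0" if "norm b = 1" for b
      proof -
        have "norm (x - h n *\<^sub>R b) \<ge> norm x - norm (h n *\<^sub>R b)" by (rule norm_triangle_ineq2)
        moreover have "norm (h n *\<^sub>R b) < \<delta>" using h[of n] that by simp
        ultimately have "x - h n *\<^sub>R b \<notin> cball 0 R" using \<open>x \<notin> cball 0 (R + \<delta>)\<close> by simp
        then show ?thesis using R by (intro zero) blast
      qed
      moreover have "\<psi> x = 0"
      proof -
        have "x \<notin> cball 0 R" using that \<delta>(1) by simp
        then show ?thesis using R by (intro zero) blast
      qed
      ultimately show ?thesis using e by (simp add: G_def)
    qed
    have "AE x in lborel. x \<in> P \<longrightarrow> (\<exists>K\<in>T. x \<in> interior K)"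
      using AE_interior_triangle by (simp add: AE_completion_iff)
    then show "AE x in lborel. (\<lambda>n. G n x) \<longlonglongrightarrow> D x"
    proof eventually_elim
      case (elim x)
      have hlim: "h \<longlonglongrightarrow> 0"
      proof -
        have "(\<lambda>n. (\<delta> / 4) * inverse (real (Suc n))) \<longlonglongrightarrow> (\<delta> / 4) * 0"
          by (intro tendsto_intros LIMSEQ_inverse_real_of_nat)
        moreover have "h = (\<lambda>n. (\<delta> / 4) * inverse (real (Suc n)))"
          unfolding h_def[abs_def] by (simp only: divide_inverse)
        ultimately show ?thesis by (simp only: mult_zero_right)
      qed
      have ev: "\<forall>\<^sub>F n in sequentially. x + h n *\<^sub>R a \<in> U" if "open U" "x \<in> U" for U a
      proof -
        have "(\<lambda>n. x + h n *\<^sub>R a) \<longlonglongrightarrow> x + 0 *\<^sub>R a" by (intro tendsto_intros hlim)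
        then show ?thesis using that by (simp add: topological_tendstoD)
      qed
      show ?case
      proof (cases "x \<in> S")
        case False
        have o: "open (- S)" using S(1) compact_imp_closed by blast
        have xS: "x \<in> - S" using False by blast
        have "\<forall>\<^sub>F n in sequentially. G n x = 0"
          using ev[OF o xS, of "- e1"] ev[OF o xS, of "- e2"]
        proof eventually_elim
          case (elim n)
          then have "x - h n *\<^sub>R e1 \<notin> S" "x - h n *\<^sub>R e2 \<notin> S" by simp_all
          then show ?case using zero(1) False by (simp add: G_def)
        qed
        moreover have "D x = 0" using zero(2)[OF False] by (simp add: D_def)
        ultimately show ?thesis by (simp add: tendsto_eventually)
      next
        case True
        then have "x \<in> P" using S(2) interior_subset by blast
        then obtain K where K: "K \<in> T" "x \<in> interior K" using elim by blast
        have Dx: "D x = g K $ 1 * partial_deriv 2 \<psi> x - g K $ 2 * partial_deriv 1 \<psi> x"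
          unfolding D_def by (rule sum_indicator_interior[OF K])
        \<comment> \<open>\<open>x\<close> is interior to a triangle on which \<phi> is affine, so
          the quotients are eventually equal to the limit.\<close>
        have q\<phi>: "(\<lambda>n. (\<phi> (x + h n *\<^sub>R a) - \<phi> x) / h n) \<longlonglongrightarrow> g K \<bullet> a" for a
        proof (rule tendsto_eventually)
          show "\<forall>\<^sub>F n in sequentially. (\<phi> (x + h n *\<^sub>R a) - \<phi> x) / h n = g K \<bullet> a"
            using ev[OF open_interior K(2), of a]
          proof eventually_elim
            case (elim n)
            then have "x + h n *\<^sub>R a \<in> K" "x \<in> K" using K(2) interior_subset by blast+
            then have "\<phi> (x + h n *\<^sub>R a) - \<phi> x = h n * (g K \<bullet> a)"
              using \<phi>[OF K(1)] by (simp add: inner_add_right)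
            then show ?case using h(1)[of n] by simp
          qed
        qed
        have q\<psi>: "(\<lambda>n. (\<psi> x - \<psi> (x - h n *\<^sub>R b)) / h n) \<longlonglongrightarrow> b $ 1 * partial_deriv 1 \<psi> x + b $ 2 * partial_deriv 2 \<psi> x" for b
        proof -
          have "((\<lambda>h. (\<psi> (x + h *\<^sub>R (- b)) - \<psi> (x + 0 *\<^sub>R (- b))) / h) \<longlongrightarrow> (- b) $ 1 * partial_deriv 1 \<psi> x + (- b) $ 2 * partial_deriv 2 \<psi> x) (at 0)"
            using test_function_quotient_tendsto[OF \<psi>, of x "- b"] by simp
          from tendsto_difference_quotient_seq[where f = "\<lambda>h. \<psi> (x + h *\<^sub>R (- b))", OF this, of "\<delta> / 4"] \<delta>(1)
          have "(\<lambda>n. (\<psi> (x - h n *\<^sub>R b) - \<psi> x) / h n) \<longlonglongrightarrow> - (b $ 1 * partial_deriv 1 \<psi> x + b $ 2 * partial_deriv 2 \<psi> x)"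
            by (simp add: h_def)
          from tendsto_minus[OF this] show ?thesis by (simp add: minus_divide_left add.commute)
        qed
        have "(\<lambda>n. ((\<phi> (x + h n *\<^sub>R e1) - \<phi> x) / h n) * ((\<psi> x - \<psi> (x - h n *\<^sub>R e2)) / h n)
            - ((\<phi> (x + h n *\<^sub>R e2) - \<phi> x) / h n) * ((\<psi> x - \<psi> (x - h n *\<^sub>R e1)) / h n)) \<longlonglongrightarrow>
          (g K \<bullet> e1) * (e2 $ 1 * partial_deriv 1 \<psi> x + e2 $ 2 * partial_deriv 2 \<psi> x)
            - (g K \<bullet> e2) * (e1 $ 1 * partial_deriv 1 \<psi> x + e1 $ 2 * partial_deriv 2 \<psi> x)"
          by (intro tendsto_diff tendsto_mult q\<phi> q\<psi>)
        moreover have "(g K \<bullet> e1) * (e2 $ 1 * partial_deriv 1 \<psi> x + e2 $ 2 * partial_deriv 2 \<psi> x)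
            - (g K \<bullet> e2) * (e1 $ 1 * partial_deriv 1 \<psi> x + e1 $ 2 * partial_deriv 2 \<psi> x) = D x"
          unfolding Dx e1_def e2_def inner_axis by (simp add: axis_def)
        moreover have "((\<phi> (x + h n *\<^sub>R e1) - \<phi> x) / h n) * ((\<psi> x - \<psi> (x - h n *\<^sub>R e2)) / h n)
            - ((\<phi> (x + h n *\<^sub>R e2) - \<phi> x) / h n) * ((\<psi> x - \<psi> (x - h n *\<^sub>R e1)) / h n) = G n x" for n
          by (simp only: G_def power2_eq_square times_divide_times_eq diff_divide_distrib[symmetric])
        ultimately show ?thesis by simp
      qed
    qed
    show "integral\<^sup>L lborel (G n) = 0" for n
      unfolding G_def
      using integral_mixed_differences_zero[OF \<phi>m pm(1) int, of "h n *\<^sub>R e1" "h n *\<^sub>R e2"] by simp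
  qed
qed

end

section \<open>Unisolvence\<close>

lemma inner_perp: "vector [x $ 2, - (x $ 1)] \<bullet> (u :: real^2) = - cross2 x u"
  by (simp add: inner_vec_def sum_2 cross2_def)

lemma affine_interpolation:
  assumes "orient a b c > 0"
  obtains g s where "g \<bullet> a + s = \<alpha> a" "g \<bullet> b + s = \<alpha> b" "g \<bullet> c + s = (\<alpha> c :: real)"
proof -
  define J :: "real^2 \<Rightarrow> real^2" where "J u = vector [- (u $ 2), u $ 1]" for u
  define D where "D = orient a b c"
  have J: "J u \<bullet> x = cross2 u x" for u x
    by (simp add: J_def inner_vec_def sum_2 cross2_def)
  \<comment> \<open>\<open>J (c - b)\<close> divided by \<open>D\<close> is the gradient of the
    barycentric coordinate belonging to \<open>a\<close>, and cyclically; \<open>s\<close> collects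
    the constant terms.\<close>
  define g where "g = (1 / D) *\<^sub>R (\<alpha> a *\<^sub>R J (c - b) + \<alpha> b *\<^sub>R J (a - c) + \<alpha> c *\<^sub>R J (b - a))"
  define s where "s = - (\<alpha> a * cross2 (c - b) b + \<alpha> b * cross2 (a - c) c + \<alpha> c * cross2 (b - a) a) / D"
  have val: "g \<bullet> x + s = (\<alpha> a * orient b c x + \<alpha> b * orient c a x + \<alpha> c * orient a b x) / D" for x
  proof -
    have "g \<bullet> x = (\<alpha> a * cross2 (c - b) x + \<alpha> b * cross2 (a - c) x + \<alpha> c * cross2 (b - a) x) / D"
      unfolding g_def by (simp only: inner_scaleR_left inner_add_left J) simp
    then have "g \<bullet> x + s = (\<alpha> a * (cross2 (c - b) x - cross2 (c - b) b) + \<alpha> b * (cross2 (a - c) x - cross2 (a - c) c)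
       + \<alpha> c * (cross2 (b - a) x - cross2 (b - a) a)) / D"
      unfolding s_def by (simp only: add_divide_distrib[symmetric] right_diff_distrib) (simp add: algebra_simps)
    then show ?thesis unfolding orient_def by (simp only: cross2_simps)
  qed
  have D: "D > 0" "orient b c a = D" "orient c a b = D" "orient a b c = D"
    using assms by (simp_all add: D_def orient_alt)
  show ?thesis
  proof (rule that)
    show "g \<bullet> a + s = \<alpha> a" unfolding val using D by simp
    show "g \<bullet> b + s = \<alpha> b" unfolding val using D by simp
    show "g \<bullet> c + s = \<alpha> c" unfolding val using D by simp
  qed
qed

lemma inner_zero_two_directions:
  fixes d u v :: "real^2"
  assumes "d \<bullet> u = 0" "d \<bullet> v = 0" "cross2 u v \<noteq> 0"
  shows "d = 0"
proof -
  have "d $ 1 * cross2 u v = v $ 2 * (d \<bullet> u) - u $ 2 * (d \<bullet> v)"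
    "d $ 2 * cross2 u v = u $ 1 * (d \<bullet> v) - v $ 1 * (d \<bullet> u)"
    by (simp_all add: cross2_def inner_vec_def sum_2 algebra_simps)
  then show ?thesis using assms by (simp add: vec_eq_iff forall_2)
qed

lemma finite_measure_open_bounded:
  fixes \<Omega> :: "(real^2) set"
  assumes "open \<Omega>" "bounded \<Omega>"
  shows "finite_measure (lebesgue_on \<Omega>)"
  using lmeasurable_open[OF assms(2,1)] by (rule finite_measure_lebesgue_on)

lemma bounded_square_integrable:
  fixes f :: "real^2 \<Rightarrow> 'b::euclidean_space"
  assumes "open \<Omega>" "bounded \<Omega>" "f \<in> borel_measurable borel" "\<And>x. x \<in> \<Omega> \<Longrightarrow> norm (f x) \<le> C"
  shows "square_integrable_on f \<Omega>"
proof -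
  have m: "f \<in> borel_measurable (lebesgue_on \<Omega>)"
    using assms(3) by (intro measurable_restrict_space1 measurable_completion) simp
  have "integrable (lebesgue_on \<Omega>) (\<lambda>x. (norm (f x))\<^sup>2)"
  proof (rule finite_measure.integrable_const_bound[OF finite_measure_open_bounded[OF assms(1,2)]])
    show "AE x in lebesgue_on \<Omega>. norm ((norm (f x))\<^sup>2) \<le> C\<^sup>2"
    proof (rule AE_I2)
      fix x assume "x \<in> space (lebesgue_on \<Omega>)"
      then have "norm (f x) \<le> C" using assms(4) by simp
      then show "norm ((norm (f x))\<^sup>2) \<le> C\<^sup>2" using power_mono[of "norm (f x)" C 2] by simp
    qed
    show "(\<lambda>x. (norm (f x))\<^sup>2) \<in> borel_measurable (lebesgue_on \<Omega>)"
      using m by measurable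
  qed
  with m show ?thesis by (simp add: square_integrable_on_def)
qed

section \<open>Construction of fields in \<open>V_h\<close> and reading off their edge
  values\<close>

context polygon_mesh
begin

lemma affine_pieces_in_V_h:
  fixes g :: "(real^2) set \<Rightarrow> real^2" and s :: "(real^2) set \<Rightarrow> real"
  assumes cont: "\<And>K K' x. \<lbrakk>K \<in> T; K' \<in> T; x \<in> K; x \<in> K'\<rbrakk> \<Longrightarrow> g K \<bullet> x + s K = g K' \<bullet> x + s K'"
  obtains v where "v \<in> V_h P T"
    "\<And>K. K \<in> T \<Longrightarrow> restricts_to v K (\<lambda>x. g K + (- k / 2) *\<^sub>R vector [x $ 2, - (x $ 1)])"
proof -
  let ?\<Omega> = "interior P"
  define rot :: "real^2 \<Rightarrow> real^2" where "rot x = vector [x $ 2, - (x $ 1)]" for x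
  have rot_nth: "rot x $ 1 = x $ 2" "rot x $ 2 = - (x $ 1)" for x by (simp_all add: rot_def)
  have rot_cont: "continuous_on S rot" for S
  proof -
    have "linear rot" by (rule linearI) (simp_all add: rot_nth vec_eq_iff forall_2)
    then show ?thesis by (simp add: linear_continuous_on linear_conv_bounded_linear)
  qed
  define q where "q K x = g K + (- k / 2) *\<^sub>R rot x" for K x
  have q_cont: "continuous_on S (q K)" for K S
    unfolding q_def[abs_def] by (intro continuous_intros rot_cont)
  \<comment> \<open>The interiors are disjoint, so at most one summand is nonzero; on the triangle
    boundaries, a null set, the value is 0.\<close>
  define v where "v x = (\<Sum>K\<in>T. indicator (interior K) x *\<^sub>R q K x)" for x
  have v_int: "v x = q K x" if "K \<in> T" "x \<in> interior K" for K x
    unfolding v_def by (rule sum_indicator_interior[OF that])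
  have vm: "v \<in> borel_measurable borel"
    unfolding v_def[abs_def]
  proof (intro borel_measurable_sum borel_measurable_scaleR borel_measurable_indicator)
    show "interior K \<in> sets borel" for K :: "(real^2) set" by simp
    show "q K \<in> borel_measurable borel" for K by (rule borel_measurable_continuous_onI[OF q_cont])
  qed
  have bP: "bounded P" using compact_P compact_imp_bounded by blast
  have b\<Omega>: "bounded ?\<Omega>" by (rule bounded_subset[OF bP interior_subset])
  have r: "restricts_to v K (q K)" if K: "K \<in> T" for K
    unfolding AE_restricts_to[OF triangle_lebesgue[OF K]] using AE_interior_triangle
  proof eventually_elim
    case (elim x)
    show ?case
    proof
      assume x: "x \<in> K"
      then have "x \<in> P" using triangle_subset_P[OF K] by blast
      then obtain L where L: "L \<in> T" "x \<in> interior L" using elim by blast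
      then have "L = K" using interior_disjoint[OF L(1) K L(2) x] by simp
      then show "v x = q K x" using v_int L by simp
    qed
  qed
  obtain C where C: "\<And>x. x \<in> P \<Longrightarrow> norm (v x) \<le> C"
  proof -
    have "\<exists>B. \<forall>x\<in>P. norm (q K x) \<le> B" for K
      using compact_imp_bounded[OF compact_continuous_image[OF q_cont compact_P]] unfolding bounded_iff by auto
    then obtain B where B: "\<And>K x. x \<in> P \<Longrightarrow> norm (q K x) \<le> B K" by metis
    have "norm (v x) \<le> (\<Sum>K\<in>T. B K)" if "x \<in> P" for x
      unfolding v_def
    proof (rule order_trans[OF norm_sum sum_mono])
      fix K
      have "norm (indicator (interior K) x *\<^sub>R q K x) \<le> norm (q K x)" by (simp add: indicator_def)
      then show "norm (indicator (interior K) x *\<^sub>R q K x) \<le> B K" using B[OF that, of K] by linarith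
    qed
    then show ?thesis using that by blast
  qed
  have sq: "square_integrable_on v ?\<Omega>"
    by (rule bounded_square_integrable[OF open_interior b\<Omega> vm]) (use C interior_subset in blast)
  have sqk: "square_integrable_on (\<lambda>x. k) ?\<Omega>"
    by (rule bounded_square_integrable[OF open_interior b\<Omega>, where C = "\<bar>k\<bar>"]) auto
  have vml: "v \<in> borel_measurable (lebesgue_on ?\<Omega>)" using sq by (simp add: square_integrable_on_def)
  have wc: "has_weak_curl ?\<Omega> v (\<lambda>x. k)"
    unfolding has_weak_curl_def
  proof
    fix \<psi> assume \<psi>: "\<psi> \<in> test_functions ?\<Omega>"
    define S where "S = closure {x. \<psi> x \<noteq> 0}"
    have S: "compact S" "S \<subseteq> ?\<Omega>" unfolding S_def by (rule test_function_support[OF \<psi>])+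
    have zero: "\<psi> x = 0" "partial_deriv i \<psi> x = 0" if "x \<notin> S" for x i
      by (rule test_function_zero[OF \<psi> that[unfolded S_def]])+
    define D where "D x = (\<Sum>K\<in>T. indicator (interior K) x *\<^sub>R (g K $ 1 * partial_deriv 2 \<psi> x - g K $ 2 * partial_deriv 1 \<psi> x))" for x
    \<comment> \<open>The summand 0 gives the rotational part the form of a Nedelec polynomial with
      vanishing constant, to which \<open>nedelec_weak_curl\<close> applies.\<close>
    define E where "E x = (0 + (- k / 2) *\<^sub>R rot x) $ 1 * partial_deriv 2 \<psi> x - (0 + (- k / 2) *\<^sub>R rot x) $ 2 * partial_deriv 1 \<psi> x" for x
    have Dm: "D \<in> borel_measurable borel"
      unfolding D_def[abs_def] by (rule affine_pieces_weak_curl(1)[where s = s, OF cont \<psi>]; assumption)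
    have D0: "integral\<^sup>L lborel D = 0"
      unfolding D_def[abs_def] by (rule affine_pieces_weak_curl(2)[where s = s, OF cont \<psi>]; assumption)
    have iE: "integral\<^sup>L lborel E = k * integral\<^sup>L lborel \<psi>"
    proof -
      have "integral\<^sup>L lborel E = - 2 * (- k / 2) * integral\<^sup>L lborel \<psi>"
        unfolding E_def by (rule nedelec_weak_curl[OF \<psi>]) (simp add: rot_def)
      then show ?thesis by simp
    qed
    have cE: "continuous_on UNIV E"
      unfolding E_def[abs_def] by (simp add: rot_nth, intro continuous_intros test_function_partial_continuous[OF \<psi>]) simp_all
    have Ez: "E x = 0" "D x = 0" if "x \<notin> S" for x
      using zero(2)[OF that] by (simp_all add: E_def D_def)
    have intE: "integrable lborel E" by (rule continuous_support_integrable[OF cE S(1) Ez(1)])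
    obtain R where R: "S \<subseteq> cball 0 R" using bounded_support_cball[OF S(1)] .
    have intD: "integrable lborel D"
    proof -
      have "\<exists>B. \<forall>x. \<bar>g K $ 1 * partial_deriv 2 \<psi> x - g K $ 2 * partial_deriv 1 \<psi> x\<bar> \<le> B" for K
      proof -
        have c: "continuous_on UNIV (\<lambda>x. g K $ 1 * partial_deriv 2 \<psi> x - g K $ 2 * partial_deriv 1 \<psi> x)"
          by (intro continuous_intros test_function_partial_continuous[OF \<psi>])
        have z: "g K $ 1 * partial_deriv 2 \<psi> x - g K $ 2 * partial_deriv 1 \<psi> x = 0" if "x \<notin> S" for x
          using zero(2)[OF that] by simp
        show ?thesis using continuous_support_bound[OF c S(1) z] by blast
      qed
      then obtain B where B: "\<And>K x. \<bar>g K $ 1 * partial_deriv 2 \<psi> x - g K $ 2 * partial_deriv 1 \<psi> x\<bar> \<le> B K" by metis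
      show ?thesis
      proof (rule integrable_bounded_support[OF Dm])
        show "\<bar>D x\<bar> \<le> (\<Sum>K\<in>T. B K)" for x
          unfolding D_def
        proof (rule order_trans[OF sum_abs sum_mono])
          fix K
          have "0 \<le> B K" using B[of K 0] by linarith
          then show "\<bar>indicator (interior K) x *\<^sub>R (g K $ 1 * partial_deriv 2 \<psi> x - g K $ 2 * partial_deriv 1 \<psi> x)\<bar> \<le> B K"
            using B[of K x] by (simp add: indicator_def)
        qed
        show "D x = 0" if "x \<notin> cball 0 R" for x using R that by (intro Ez(2)) blast
      qed
    qed
    have "(LINT x|lebesgue_on ?\<Omega>. v x $ 1 * partial_deriv 2 \<psi> x - v x $ 2 * partial_deriv 1 \<psi> x)
      = integral\<^sup>L lborel (\<lambda>x. D x + E x)"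
    proof (rule integral_lebesgue_on_eq_lborel[OF open_interior weak_curl_integrand_measurable[OF vml \<psi>]])
      show "(\<lambda>x. D x + E x) \<in> borel_measurable borel"
        using Dm borel_measurable_continuous_onI[OF cE] by simp
      show "D x + E x = 0" if "x \<notin> ?\<Omega>" for x
      proof -
        have "x \<notin> S" using S(2) that by blast
        then show ?thesis using Ez by simp
      qed
      show "AE x in lebesgue. x \<in> ?\<Omega> \<longrightarrow> v x $ 1 * partial_deriv 2 \<psi> x - v x $ 2 * partial_deriv 1 \<psi> x = D x + E x"
        using AE_interior_triangle
      proof eventually_elim
        case (elim x)
        show ?case
        proof
          assume "x \<in> ?\<Omega>"
          then obtain K where K: "K \<in> T" "x \<in> interior K" using elim interior_subset by blast
          have Dx: "D x = g K $ 1 * partial_deriv 2 \<psi> x - g K $ 2 * partial_deriv 1 \<psi> x"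
            unfolding D_def by (rule sum_indicator_interior[OF K])
          have vx: "v x = g K + (- k / 2) *\<^sub>R rot x" using v_int[OF K] by (simp add: q_def)
          show "v x $ 1 * partial_deriv 2 \<psi> x - v x $ 2 * partial_deriv 1 \<psi> x = D x + E x"
            unfolding Dx E_def vx by (simp add: algebra_simps)
        qed
      qed
    qed
    also have "\<dots> = k * integral\<^sup>L lborel \<psi>"
      using Bochner_Integration.integral_add[OF intD intE] D0 iE by simp
    also have "\<dots> = integral\<^sup>L lborel (\<lambda>x. k * \<psi> x)" by simp
    also have "\<dots> = (LINT x|lebesgue_on ?\<Omega>. k * \<psi> x)"
    proof (rule integral_lebesgue_on_eq_lborel[symmetric, OF open_interior])
      show m: "(\<lambda>x. k * \<psi> x) \<in> borel_measurable borel" using test_function_measurable(1)[OF \<psi>] by simp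
      show "(\<lambda>x. k * \<psi> x) \<in> borel_measurable (lebesgue_on ?\<Omega>)"
        using m by (intro measurable_restrict_space1 measurable_completion) simp
      show "k * \<psi> x = 0" if "x \<notin> ?\<Omega>" for x
      proof -
        have "x \<notin> S" using S(2) that by blast
        then show ?thesis using zero by simp
      qed
    qed simp
    finally show "(LINT x|lebesgue_on ?\<Omega>. v x $ 1 * partial_deriv 2 \<psi> x - v x $ 2 * partial_deriv 1 \<psi> x)
      = (LINT x|lebesgue_on ?\<Omega>. k * \<psi> x)" .
  qed
  have "v \<in> V_h P T"
    unfolding V_h_def H_curl_def
  proof (intro CollectI conjI ballI)
    show "\<exists>w. square_integrable_on w ?\<Omega> \<and> has_weak_curl ?\<Omega> v w" using sqk wc by blast
    show "\<exists>k. has_weak_curl ?\<Omega> v (\<lambda>x. k)" using wc by blast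
    fix K assume "K \<in> T"
    moreover have "q K \<in> nedelec" unfolding nedelec_def q_def[abs_def] rot_def by blast
    ultimately show "\<exists>q\<in>nedelec. restricts_to v K q" using r by blast
  qed (fact sq)
  then show ?thesis using that[of v] r unfolding q_def[abs_def] rot_def by blast
qed

text \<open>Partial sums along the polygon, starting from 0 at \<open>p ! 0\<close>. The hypothesis
  is what the closing edge requires; distinctness of the vertices lets the index be read off from
  the vertex.\<close>

lemma vertex_potential:
  assumes "(\<Sum>i<N. d i) = (0::real)"
  obtains \<alpha> where "\<And>i. i < N \<Longrightarrow> \<alpha> (p ! nxt i) - \<alpha> (p ! i) = d i"
proof -
  define \<alpha> where "\<alpha> v = (\<Sum>i<(THE j. j < N \<and> p ! j = v). d i)" for v
  have \<alpha>: "\<alpha> (p ! j) = (\<Sum>i<j. d i)" if "j < N" for j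
  proof -
    have "(THE i. i < N \<and> p ! i = p ! j) = j"
      using that nth_eq by (intro the_equality) auto
    then show ?thesis by (simp add: \<alpha>_def)
  qed
  have "\<alpha> (p ! nxt i) - \<alpha> (p ! i) = d i" if i: "i < N" for i
  proof (cases "Suc i < N")
    case True
    then show ?thesis using \<alpha>[OF i] \<alpha>[OF True] by simp
  next
    case False
    then have N: "N = Suc i" using i by simp
    have "p ! nxt i = p ! 0" using N by simp
    moreover have "(\<Sum>j<i. d j) + d i = 0" using assms N by simp
    moreover have "0 < N" using N_ge_3 by linarith
    ultimately show ?thesis using \<alpha>[OF i] \<alpha>[of 0] by simp
  qed
  then show ?thesis using that by blast
qed

text \<open>Two triangles meet in a face of both, which is the convex hull of its extreme points.
  These are common vertices, where both affine functions take the value of \<alpha>; the set on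
  which two affine functions agree is convex.\<close>

lemma piecewise_affine_interpolant:
  fixes \<alpha> :: "real^2 \<Rightarrow> real"
  obtains g s where "\<And>K v. \<lbrakk>K \<in> T; v extreme_point_of K\<rbrakk> \<Longrightarrow> g K \<bullet> v + s K = \<alpha> v"
    and "\<And>K K' x. \<lbrakk>K \<in> T; K' \<in> T; x \<in> K; x \<in> K'\<rbrakk> \<Longrightarrow> g K \<bullet> x + s K = g K' \<bullet> x + s K'"
proof -
  have "\<forall>K\<in>T. \<exists>gs. \<forall>v. v extreme_point_of K \<longrightarrow> fst gs \<bullet> v + snd gs = \<alpha> v"
  proof
    fix K assume "K \<in> T"
    then obtain a b c where abc: "orient a b c > 0" "K = convex hull {a,b,c}" using triangleE by blast
    obtain g s where "g \<bullet> a + s = \<alpha> a" "g \<bullet> b + s = \<alpha> b" "g \<bullet> c + s = \<alpha> c"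
      using affine_interpolation[OF abc(1)] by blast
    then show "\<exists>gs. \<forall>v. v extreme_point_of K \<longrightarrow> fst gs \<bullet> v + snd gs = \<alpha> v"
      using extreme_points_triangle[OF abc(1)] abc(2) by (intro exI[of _ "(g,s)"]) auto
  qed
  from bchoice[OF this] obtain gs where gs: "\<forall>K\<in>T. \<forall>v. v extreme_point_of K \<longrightarrow> fst (gs K) \<bullet> v + snd (gs K) = \<alpha> v" ..
  define g where "g K = fst (gs K)" for K
  define s where "s K = snd (gs K)" for K
  have ext: "g K \<bullet> v + s K = \<alpha> v" if "K \<in> T" "v extreme_point_of K" for K v
    using gs that by (simp add: g_def s_def)
  have "g K \<bullet> x + s K = g K' \<bullet> x + s K'" if K: "K \<in> T" "K' \<in> T" and x: "x \<in> K" "x \<in> K'" for K K' x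
  proof -
    let ?F = "K \<inter> K'"
    let ?A = "{x. (g K - g K') \<bullet> x = s K' - s K}"
    have "compact ?F" "convex ?F"
      using compact_triangle convex_triangle K by (auto intro: compact_Int convex_Int)
    then have F: "?F = convex hull {v. v extreme_point_of ?F}" by (rule Krein_Milman_Minkowski)
    have "{v. v extreme_point_of ?F} \<subseteq> ?A"
    proof
      fix v assume "v \<in> {v. v extreme_point_of ?F}"
      then have "v extreme_point_of ?F" by simp
      then have "v extreme_point_of K" "v extreme_point_of K'"
        using extreme_point_of_face[OF face[OF K]] extreme_point_of_face[OF face'[OF K]] by blast+
      then have "g K \<bullet> v + s K = g K' \<bullet> v + s K'" using ext K by simp
      then show "v \<in> ?A" by (simp add: inner_diff_left)
    qed
    then have "?F \<subseteq> ?A" using F hull_minimal[of _ ?A convex] convex_hyperplane by metis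
    then have "x \<in> ?A" using x by blast
    then show ?thesis by (simp add: inner_diff_left)
  qed
  with ext show ?thesis using that by blast
qed

text \<open>Continuous functions that agree almost everywhere agree on the interior of
  \<open>K\<close>, and a convex set with nonempty interior lies in the closure of its
  interior.\<close>

lemma restricts_to_unique:
  assumes K: "K \<in> T" and r: "restricts_to v K q" "restricts_to v K q'"
    and c: "continuous_on UNIV q" "continuous_on UNIV q'" and x: "x \<in> K"
  shows "q x = q' x"
proof -
  have eq: "interior K \<subseteq> {x. q x = q' x}"
  proof (rule ccontr)
    assume n: "\<not> interior K \<subseteq> {x. q x = q' x}"
    let ?U = "interior K \<inter> {x. q x \<noteq> q' x}"
    have "closed {x. q x = q' x}" by (intro closed_Collect_eq c)
    then have "open (- {x. q x = q' x})" by (rule open_Compl)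
    then have U: "open ?U" by (intro open_Int open_interior) (simp add: Collect_neg_eq)
    have "AE x in lebesgue. x \<notin> ?U"
      using r[unfolded AE_restricts_to[OF triangle_lebesgue[OF K]]]
    proof eventually_elim
      case (elim x)
      then show ?case using interior_subset[of K] by auto
    qed
    moreover have "?U \<in> sets lebesgue" using U by simp
    ultimately have "?U \<in> null_sets lebesgue" using AE_iff_null_sets[of ?U lebesgue] by blast
    then have "negligible ?U" by (simp add: negligible_iff_null_sets)
    then show False using open_not_negligible[OF U] n by blast
  qed
  have "closed {x. q x = q' x}" by (intro closed_Collect_eq c)
  then have "closure (interior K) \<subseteq> {x. q x = q' x}" using eq by (rule closure_minimal[rotated])
  moreover have "closure (interior K) = closure K"
    by (rule convex_closure_interior[OF convex_triangle[OF K] interior_triangle_nonempty[OF K]])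
  ultimately show ?thesis using x closure_subset[of K] by blast
qed

lemma nedelec_continuous: "q \<in> nedelec \<Longrightarrow> continuous_on UNIV q"
proof -
  assume "q \<in> nedelec"
  then obtain a b where q: "q = (\<lambda>x. a + b *\<^sub>R vector [x $ 2, - (x $ 1)])" by (auto simp: nedelec_def)
  have "linear (\<lambda>x::real^2. vector [x $ 2, - (x $ 1)] :: real^2)"
    by (rule linearI) (simp_all add: vec_eq_iff forall_2)
  then have "continuous_on UNIV (\<lambda>x::real^2. vector [x $ 2, - (x $ 1)] :: real^2)"
    by (simp add: linear_continuous_on linear_conv_bounded_linear)
  then show ?thesis unfolding q by (intro continuous_intros)
qed

text \<open>\<open>tangential_value\<close> leaves both the triangle and the polynomial open. The
  ends of a polygon edge are vertices of any triangle that contains it, and such an edge belongs to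
  one triangle only, so both are determined; the value is then computed at the end point
  \<open>p ! i\<close>.\<close>

lemma tangential_value_boundary:
  assumes i: "i < N" and tv: "tangential_value T v (polygon_edge p i) (\<sigma> *\<^sub>R (p ! nxt i - p ! i)) c" and \<sigma>: "\<sigma> \<noteq> 0"
    and r: "\<And>K. K \<in> T \<Longrightarrow> restricts_to v K (\<lambda>x. a K + (- k / 2) *\<^sub>R vector [x $ 2, - (x $ 1)])"
    and K: "K \<in> T" "(p ! i, p ! nxt i) \<in> oedges K \<or> (p ! nxt i, p ! i) \<in> oedges K"
  shows "a K \<bullet> (p ! nxt i - p ! i) + (k / 2) * cross2 (p ! i) (p ! nxt i) = c / \<sigma>"
proof -
  let ?x = "p ! i" and ?y = "p ! nxt i"
  let ?q = "\<lambda>x::real^2. a K + (- k / 2) *\<^sub>R vector [x $ 2, - (x $ 1)]"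
  obtain L q where L: "L \<in> T" "polygon_edge p i \<subseteq> L" "q \<in> nedelec" "restricts_to v L q"
    "\<forall>x\<in>polygon_edge p i. q x \<bullet> (\<sigma> *\<^sub>R (?y - ?x)) = c"
    using tv unfolding tangential_value_def by blast
  have xy: "?x \<in> polygon_edge p i" "?y \<in> polygon_edge p i" by (simp_all add: polygon_edge_def)
  have "?x \<in> set p" "?y \<in> set p" using i nxt_less by auto
  then have "?x extreme_point_of L" "?y extreme_point_of L"
    using vertex_extreme[OF _ L(1)] L(2) xy by blast+
  then have "(?x,?y) \<in> oedges L \<or> (?y,?x) \<in> oedges L"
    using triangleE[OF L(1)] extreme_pair_oedges[of _ _ _ L ?x ?y] edge_ends_neq[OF i] by metis
  then have "L = K"
    using K boundary_edge_not_both[OF i L(1) K(1)] boundary_edge_not_both[OF i K(1) L(1)]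
      oedge_unique[OF L(1) K(1)] by blast
  moreover have "?q \<in> nedelec" unfolding nedelec_def by blast
  ultimately have "q ?x = ?q ?x"
    using restricts_to_unique[OF K(1) _ r[OF K(1)] nedelec_continuous[OF L(3)] nedelec_continuous, of ?x]
      L(2,4) xy(1) by blast
  then have "?q ?x \<bullet> (\<sigma> *\<^sub>R (?y - ?x)) = c" using L(5) xy(1) by metis
  then have "\<sigma> * (?q ?x \<bullet> (?y - ?x)) = c" by simp
  then have "?q ?x \<bullet> (?y - ?x) = c / \<sigma>" using \<sigma> by (simp add: field_simps)
  then show ?thesis by (simp only: inner_add_left inner_scaleR_left inner_perp) simp
qed

text \<open>\<sigma> absorbs the length and the direction of the unit tangent:
  \<open>c i / \<sigma> i\<close> is the prescribed integral of the tangential component along the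
  i-th edge as listed.\<close>

lemma interpolating_field_exists:
  assumes \<sigma>: "\<And>i. i < N \<Longrightarrow> \<sigma> i \<noteq> 0"
  obtains v where "v \<in> V_h P T"
    "\<And>i. i < N \<Longrightarrow> tangential_value T v (polygon_edge p i) (\<sigma> i *\<^sub>R (p ! nxt i - p ! i)) (c i)"
proof -
  define X where "X i = cross2 (p ! i) (p ! nxt i)" for i
  \<comment> \<open>the only curl for which the increments below sum to zero\<close>
  define k where "k = 2 * (\<Sum>i<N. c i / \<sigma> i) / (\<Sum>i<N. X i)"
  have "(\<Sum>i<N. X i) \<noteq> 0" using shoelace_nonzero by (simp add: X_def)
  then have "(\<Sum>i<N. c i / \<sigma> i - k / 2 * X i) = 0"
    by (simp only: sum_subtractf sum_distrib_left[symmetric]) (simp add: k_def)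
  then obtain \<alpha> where \<alpha>: "\<And>i. i < N \<Longrightarrow> \<alpha> (p ! nxt i) - \<alpha> (p ! i) = c i / \<sigma> i - k / 2 * X i"
    using vertex_potential by blast
  obtain g s where gs: "\<And>K v. \<lbrakk>K \<in> T; v extreme_point_of K\<rbrakk> \<Longrightarrow> g K \<bullet> v + s K = \<alpha> v"
    and cont: "\<And>K K' x. \<lbrakk>K \<in> T; K' \<in> T; x \<in> K; x \<in> K'\<rbrakk> \<Longrightarrow> g K \<bullet> x + s K = g K' \<bullet> x + s K'"
  proof (rule piecewise_affine_interpolant[where \<alpha> = \<alpha>])
  qed (rule that)
  obtain v where v: "v \<in> V_h P T"
    "\<And>K. K \<in> T \<Longrightarrow> restricts_to v K (\<lambda>x. g K + (- k / 2) *\<^sub>R vector [x $ 2, - (x $ 1)])"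
  proof (rule affine_pieces_in_V_h[where g = g and s = s and k = k])
    show "g K \<bullet> x + s K = g K' \<bullet> x + s K'" if K: "K \<in> T" "K' \<in> T" "x \<in> K" "x \<in> K'" for K K' x
      by (rule cont[OF K])
  qed (rule that)
  have "tangential_value T v (polygon_edge p i) (\<sigma> i *\<^sub>R (p ! nxt i - p ! i)) (c i)" if i: "i < N" for i
  proof -
    let ?x = "p ! i" and ?y = "p ! nxt i"
    obtain K where K: "K \<in> T" "(?x,?y) \<in> oedges K \<or> (?y,?x) \<in> oedges K"
      using boundary_edge_exists[OF i] by blast
    then have sub: "polygon_edge p i \<subseteq> K"
      using oedges_subset[of ?x ?y K] oedges_subset[of ?y ?x K]
      unfolding polygon_edge_def closed_segment_commute[of ?y ?x] by blast
    have ext: "?x extreme_point_of K" "?y extreme_point_of K" using K oedges_extreme by blast+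
    have gxy: "g K \<bullet> (?y - ?x) = c i / \<sigma> i - k / 2 * X i"
      using gs[OF K(1) ext(1)] gs[OF K(1) ext(2)] \<alpha>[OF i] by (simp add: inner_diff_right)
    let ?q = "\<lambda>x::real^2. g K + (- k / 2) *\<^sub>R vector [x $ 2, - (x $ 1)]"
    have "?q x \<bullet> (\<sigma> i *\<^sub>R (?y - ?x)) = c i" if x: "x \<in> polygon_edge p i" for x
    proof -
      obtain u where "x = (1 - u) *\<^sub>R ?x + u *\<^sub>R ?y" using x by (auto simp: polygon_edge_def in_segment)
      then have "x = ?x + u *\<^sub>R (?y - ?x)" by (simp add: algebra_simps)
      then have "cross2 x (?y - ?x) = X i" by (simp add: X_def cross2_commute[of ?y ?x])
      then have "?q x \<bullet> (?y - ?x) = c i / \<sigma> i"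
        using gxy by (simp only: inner_add_left inner_scaleR_left inner_perp)
      then show ?thesis using \<sigma>[OF i] by simp
    qed
    moreover have "?q \<in> nedelec" unfolding nedelec_def by blast
    ultimately show ?thesis
      unfolding tangential_value_def using K(1) sub v(2)[OF K(1)] by blast
  qed
  with v(1) show ?thesis using that by blast
qed

lemma interpolating_field_unique:
  assumes v: "v \<in> V_h P T" and w: "w \<in> V_h P T"
    and \<sigma>: "\<And>i. i < N \<Longrightarrow> \<sigma> i \<noteq> 0"
    and tv: "\<And>i. i < N \<Longrightarrow> tangential_value T v (polygon_edge p i) (\<sigma> i *\<^sub>R (p ! nxt i - p ! i)) (c i)"
    and tw: "\<And>i. i < N \<Longrightarrow> tangential_value T w (polygon_edge p i) (\<sigma> i *\<^sub>R (p ! nxt i - p ! i)) (c i)"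
  shows "AE x in lebesgue_on P. w x = v x"
proof -
  obtain kv av where rv: "\<And>K. K \<in> T \<Longrightarrow> restricts_to v K (\<lambda>x. av K + (- kv / 2) *\<^sub>R vector [x $ 2, - (x $ 1)])"
    and jv: "\<And>K K' x y. \<lbrakk>K \<in> T; K' \<in> T; (x,y) \<in> oedges K; (y,x) \<in> oedges K'\<rbrakk> \<Longrightarrow> (av K' - av K) \<bullet> (y - x) = 0"
  proof (rule V_h_pieces[OF v])
  qed (rule that)
  obtain kw aw where rw: "\<And>K. K \<in> T \<Longrightarrow> restricts_to w K (\<lambda>x. aw K + (- kw / 2) *\<^sub>R vector [x $ 2, - (x $ 1)])"
    and jw: "\<And>K K' x y. \<lbrakk>K \<in> T; K' \<in> T; (x,y) \<in> oedges K; (y,x) \<in> oedges K'\<rbrakk> \<Longrightarrow> (aw K' - aw K) \<bullet> (y - x) = 0"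
  proof (rule V_h_pieces[OF w])
  qed (rule that)
  define D where "D K = aw K - av K" for K
  define \<kappa> where "\<kappa> = kw - kv"
  \<comment> \<open>symmetric in \<open>x\<close> and \<open>y\<close>, so that \<open>g\<close> is antisymmetric by construction\<close>
  define tri where "tri x y = (SOME K. K \<in> T \<and> ((x,y) \<in> oedges K \<or> (y,x) \<in> oedges K))" for x y
  define g where "g x y = D (tri x y) \<bullet> (y - x) + \<kappa> / 2 * cross2 x y" for x y
  have tri_sym: "tri y x = tri x y" for x y
    unfolding tri_def by (rule arg_cong[of _ _ Eps]) auto
  have g_anti: "g y x = - g x y" for x y
    by (simp add: g_def tri_sym[of y x] cross2_commute[of y x] inner_diff_right)
  have g_edge: "g x y = D K \<bullet> (y - x) + \<kappa> / 2 * cross2 x y" if K: "K \<in> T" "(x,y) \<in> oedges K" for x y K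
  proof -
    have "tri x y \<in> T \<and> ((x,y) \<in> oedges (tri x y) \<or> (y,x) \<in> oedges (tri x y))"
      unfolding tri_def by (rule someI[of _ K]) (use K in blast)
    then consider "tri x y = K" | "tri x y \<in> T" "(y,x) \<in> oedges (tri x y)"
      using oedge_unique[OF _ K(1) _ K(2)] by blast
    then show ?thesis
    proof cases
      case 2
      have "(D (tri x y) - D K) \<bullet> (y - x) = 0"
        using jv[OF K(1) 2(1) K(2) 2(2)] jw[OF K(1) 2(1) K(2) 2(2)]
        by (simp add: D_def inner_diff_left)
      then show ?thesis by (simp add: g_def inner_diff_left)
    qed (simp add: g_def)
  qed
  have g_bd: "g (p ! i) (p ! nxt i) = 0" if i: "i < N" for i
  proof -
    let ?x = "p ! i" and ?y = "p ! nxt i"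
    obtain K where K: "K \<in> T" "(?x,?y) \<in> oedges K \<or> (?y,?x) \<in> oedges K"
      using boundary_edge_exists[OF i] by blast
    have "D K \<bullet> (?y - ?x) + \<kappa> / 2 * cross2 ?x ?y = 0"
      using tangential_value_boundary[OF i tv[OF i] \<sigma>[OF i] rv K]
        tangential_value_boundary[OF i tw[OF i] \<sigma>[OF i] rw K]
      by (simp add: D_def \<kappa>_def inner_diff_left left_diff_distrib diff_divide_distrib)
    then show ?thesis
      using K g_edge[OF K(1)] g_anti[of ?x ?y] cross2_commute[of ?x ?y] by (auto simp: inner_diff_right)
  qed
  have circ: "circulation g K = \<kappa> / 2 * circulation cross2 K" if K: "K \<in> T" for K
  proof (rule triangleE[OF K])
    fix a b c assume abc: "orient a b c > 0" "K = convex hull {a,b,c}"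
    have e: "(a,b) \<in> oedges K" "(b,c) \<in> oedges K" "(c,a) \<in> oedges K"
      using oedges_triangle[OF abc(1)] abc(2) by auto
    have "g a b + g b c + g c a = \<kappa> / 2 * (cross2 a b + cross2 b c + cross2 c a)"
      using g_edge[OF K e(1)] g_edge[OF K e(2)] g_edge[OF K e(3)]
      by (simp add: inner_diff_right algebra_simps)
    then show ?thesis by (simp add: abc(2) circulation_triangle[OF abc(1)])
  qed
  have "edge_sign 0 * (\<Sum>i<N. g (p ! i) (p ! nxt i)) = \<kappa> / 2 * (edge_sign 0 * (\<Sum>i<N. cross2 (p ! i) (p ! nxt i)))"
    unfolding discrete_Stokes[of g, OF g_anti, symmetric] discrete_Stokes[of cross2, OF cross2_commute, symmetric]
    by (simp add: circ sum_distrib_left)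
  then have "\<kappa> * (edge_sign 0 * (\<Sum>i<N. cross2 (p ! i) (p ! nxt i))) = 0" using g_bd by simp
  then have \<kappa>0: "\<kappa> = 0" using shoelace_nonzero by (auto simp: edge_sign_def split: if_splits)
  have D0: "D K = 0" if K: "K \<in> T" for K
  proof (rule triangleE[OF K])
    fix a b c assume abc: "orient a b c > 0" "K = convex hull {a,b,c}"
    have e: "(a,b) \<in> oedges K" "(b,c) \<in> oedges K" "(c,a) \<in> oedges K"
      using oedges_triangle[OF abc(1)] abc(2) by auto
    have z: "D K \<bullet> (y - x) = 0" if xy: "(x,y) \<in> oedges K" for x y
    proof -
      have "g x y = 0"
        by (rule closed_cochain_zero[OF g_anti _ g_bd K xy]) (simp_all add: circ \<kappa>0)
      then show ?thesis using g_edge[OF K xy] \<kappa>0 by simp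
    qed
    have "D K \<bullet> (b - a) = 0" "D K \<bullet> (c - a) = 0"
      using z[OF e(1)] z[OF e(3)] by (simp_all add: inner_diff_right)
    then show ?thesis using inner_zero_two_directions abc(1) by (auto simp: orient_def)
  qed
  have AE_eq: "AE x in lebesgue. \<forall>K\<in>T. x \<in> K \<longrightarrow> w x = v x"
  proof (rule AE_finite_allI[OF finite_T])
    fix K assume K: "K \<in> T"
    have "kw = kv" "aw K = av K" using \<kappa>0 D0[OF K] by (simp_all add: \<kappa>_def D_def)
    then show "AE x in lebesgue. x \<in> K \<longrightarrow> w x = v x"
      using rv[OF K, unfolded AE_restricts_to[OF triangle_lebesgue[OF K]]]
        rw[OF K, unfolded AE_restricts_to[OF triangle_lebesgue[OF K]]]
      by (auto elim: eventually_elim2)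
  qed
  have "AE x in lebesgue. x \<in> P \<longrightarrow> w x = v x"
    using AE_eq
  proof eventually_elim
    case (elim x)
    then show ?case using Union_T by blast
  qed
  moreover have "P \<in> sets lebesgue"
    using borel_closed[OF compact_imp_closed[OF compact_P]] by simp
  ultimately show ?thesis by (simp add: AE_restrict_space_iff)
qed

end

theorem lemma3p2:
  fixes p :: "(real^2) list"
    and T :: "(real^2) set set"
    and t :: "nat \<Rightarrow> real^2"
    and c :: "nat \<Rightarrow> real"
  assumes "simple_polygon p"
    and "triangle_mesh (polygon_region p) T"
    and "mesh_vertices T = set p"
    and "\<forall>i<length p. unit_tangent p i (t i)"
  shows "\<exists>v\<in>V_h (polygon_region p) T.
           (\<forall>i<length p. tangential_value T v (polygon_edge p i) (t i) (c i)) \<and>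
           (\<forall>w\<in>V_h (polygon_region p) T.
              (\<forall>i<length p. tangential_value T w (polygon_edge p i) (t i) (c i)) \<longrightarrow>
              (AE x in lebesgue_on (polygon_region p). w x = v x))"
proof -
  interpret polygon_mesh p T using assms by unfold_locales
  have "\<forall>i\<in>{..<N}. \<exists>\<sigma>. \<sigma> \<noteq> 0 \<and> t i = \<sigma> *\<^sub>R (p ! nxt i - p ! i)"
  proof
    fix i assume "i \<in> {..<N}"
    then obtain \<sigma> where "norm (t i) = 1" "t i = \<sigma> *\<^sub>R (p ! nxt i - p ! i)"
      using assms(4) by (auto simp: unit_tangent_def)
    then show "\<exists>\<sigma>. \<sigma> \<noteq> 0 \<and> t i = \<sigma> *\<^sub>R (p ! nxt i - p ! i)"
      by (intro exI[of _ \<sigma>]) auto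
  qed
  from bchoice[OF this] obtain \<sigma> where "\<forall>i\<in>{..<N}. \<sigma> i \<noteq> 0 \<and> t i = \<sigma> i *\<^sub>R (p ! nxt i - p ! i)" ..
  then have \<sigma>: "\<sigma> i \<noteq> 0" and t: "t i = \<sigma> i *\<^sub>R (p ! nxt i - p ! i)" if "i < N" for i
    using that by auto
  have "\<exists>v\<in>V_h P T. \<forall>i<N. tangential_value T v (polygon_edge p i) (\<sigma> i *\<^sub>R (p ! nxt i - p ! i)) (c i)"
  proof (rule interpolating_field_exists[where \<sigma> = \<sigma> and c = c])
    show "\<sigma> i \<noteq> 0" if "i < N" for i using that by (rule \<sigma>)
  qed blast
  then obtain v where v: "v \<in> V_h P T"
    "\<And>i. i < N \<Longrightarrow> tangential_value T v (polygon_edge p i) (\<sigma> i *\<^sub>R (p ! nxt i - p ! i)) (c i)"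
    by blast
  have "AE x in lebesgue_on P. w x = v x"
    if "w \<in> V_h P T" "\<forall>i<N. tangential_value T w (polygon_edge p i) (t i) (c i)" for w
    using that(2) by (intro interpolating_field_unique[OF v(1) that(1) \<sigma> v(2)]) (simp_all add: t)
  then show ?thesis using v t by (intro bexI[of _ v]) auto
qed

end
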